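(* Let $H:\mathbb{R}\times\mathbb{R}^N\to\mathbb{R}$ be a continuous function and let $L(x,t,\xi)=H(t,\xi)$ for every $(x,t,\xi)\in\Omega\times\mathbb{R}\times\mathbb{R}^N$. Assume that there exists $C\geq1$ such that for every $t\in\mathbb{R}$ and every $\xi\in\mathbb{R}^N$, one has $$|H(t,-\xi)|\leq C(|H(t,\xi)|+1).$$ Then $\mathcal L$ is $L^\infty(\Omega)$-regular at every $u\in\mathcal A$.
   Context: Let $N\ge 1$, let $\Omega\subset\mathbb{R}^N$ be a bounded open set, $1\leq p\leq N$, and $\varphi\in W^{1,p}(\mathbb{R}^N)\cap L^\infty(\mathbb{R}^N)$. $W^{1,p}_0(\Omega)$ is the closure in $W^{1,p}(\Omega)$ of the $C^1$ functions with compact support in $\Omega$, and $W^{1,p}_\varphi(\Omega)=\varphi+W^{1,p}_0(\Omega)$. Given $L:\Omega\times\mathbb{R}\times\mathbb{R}^N\to\mathbb{R}$, set $\mathcal L(u)=\int_\Omega L(x,u(x),\nabla u(x))\,dx$, and let $\mathcal A=\{u\in W^{1,p}_\varphi(\Omega): L(x,u,\nabla u)\in L^1(\Omega)\}$. The functional $\mathcal L$ is said to be $L^\infty(\Omega)$-regular at $u\in\mathcal A$ if there exists a sequence $(u_k)_{k\ge1}\subset\mathcal A\cap L^\infty(\Omega)$ such that $u_k\to u$ in $W^{1,p}(\Omega)$ and $L(x,u_k,\nabla u_k)\to L(x,u,\nabla u)$ in $L^1(\Omega)$. *)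

theory Defs
  imports "HOL-Analysis.Analysis"
begin

(* Elements of the spaces below are represented by functions on the whole of the Euclidean space.
   Every space over Om and every integral over Om depends only on the values on Om, up to null
   sets; classes modulo almost-everywhere equality are not formed. *)

definition Lp_space ::
  "real \<Rightarrow> 'a::euclidean_space set \<Rightarrow> ('a \<Rightarrow> 'b::euclidean_space) set" where
  "Lp_space p Om = {f \<in> borel_measurable (lebesgue_on Om).
      integrable (lebesgue_on Om) (\<lambda>x. norm (f x) powr p)}"

definition Lp_norm ::
  "real \<Rightarrow> 'a::euclidean_space set \<Rightarrow> ('a \<Rightarrow> 'b::euclidean_space) \<Rightarrow> real" where
  "Lp_norm p Om f = (LINT x|lebesgue_on Om. norm (f x) powr p) powr (1 / p)"

definition Linfty_space :: "'a::euclidean_space set \<Rightarrow> ('a \<Rightarrow> real) set" where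
  "Linfty_space Om = {f \<in> borel_measurable (lebesgue_on Om).
      \<exists>M. AE x in lebesgue_on Om. \<bar>f x\<bar> \<le> M}"

definition loc_integrable ::
  "'a::euclidean_space set \<Rightarrow> ('a \<Rightarrow> 'b::euclidean_space) \<Rightarrow> bool" where
  "loc_integrable Om f \<longleftrightarrow> (\<forall>K. compact K \<and> K \<subseteq> Om \<longrightarrow> integrable (lebesgue_on K) f)"

(* C^1 functions with compact support in Om, extended by zero to the whole space. *)
definition C1_compact_support :: "'a::euclidean_space set \<Rightarrow> ('a \<Rightarrow> real) set" where
  "C1_compact_support Om = {v.
      (\<exists>D. continuous_on UNIV D \<and> (\<forall>x. GDERIV v x :> D x)) \<and>
      compact (closure {x. v x \<noteq> 0}) \<and> closure {x. v x \<noteq> 0} \<subseteq> Om}"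

(* Integration by parts, in each coordinate direction, against C^1 test functions: the class that
   also defines W0 below. *)
definition has_weak_gradient ::
  "'a::euclidean_space set \<Rightarrow> ('a \<Rightarrow> real) \<Rightarrow> ('a \<Rightarrow> 'a) \<Rightarrow> bool" where
  "has_weak_gradient Om u g \<longleftrightarrow> loc_integrable Om u \<and> loc_integrable Om g \<and>
     (\<forall>v \<in> C1_compact_support Om. \<forall>D. (\<forall>x. GDERIV v x :> D x) \<longrightarrow>
       (\<forall>i \<in> Basis. (LINT x|lebesgue_on Om. u x * (D x \<bullet> i)) =
                   - (LINT x|lebesgue_on Om. (g x \<bullet> i) * v x)))"

(* On an open set the weak gradient, if it exists, is unique up to null sets, so the choice of
   representative is immaterial. *)
definition weak_gradient ::
  "'a::euclidean_space set \<Rightarrow> ('a \<Rightarrow> real) \<Rightarrow> 'a \<Rightarrow> 'a" where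
  "weak_gradient Om u = (SOME g. has_weak_gradient Om u g)"

definition W1 :: "real \<Rightarrow> 'a::euclidean_space set \<Rightarrow> ('a \<Rightarrow> real) set" where
  "W1 p Om = {u \<in> Lp_space p Om. \<exists>g \<in> Lp_space p Om. has_weak_gradient Om u g}"

definition W1_norm :: "real \<Rightarrow> 'a::euclidean_space set \<Rightarrow> ('a \<Rightarrow> real) \<Rightarrow> real" where
  "W1_norm p Om u = Lp_norm p Om u + Lp_norm p Om (weak_gradient Om u)"

definition W0 :: "real \<Rightarrow> 'a::euclidean_space set \<Rightarrow> ('a \<Rightarrow> real) set" where
  "W0 p Om = {u \<in> W1 p Om. \<forall>e>0. \<exists>v \<in> C1_compact_support Om. W1_norm p Om (\<lambda>x. v x - u x) < e}"

definition W1_bdry ::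
  "real \<Rightarrow> ('a::euclidean_space \<Rightarrow> real) \<Rightarrow> 'a set \<Rightarrow> ('a \<Rightarrow> real) set" where
  "W1_bdry p phi Om = {(\<lambda>x. phi x + w x) | w. w \<in> W0 p Om}"

definition admissible ::
  "real \<Rightarrow> ('a::euclidean_space \<Rightarrow> real) \<Rightarrow> 'a set \<Rightarrow> ('a \<Rightarrow> real \<Rightarrow> 'a \<Rightarrow> real) \<Rightarrow> ('a \<Rightarrow> real) set" where
  "admissible p phi Om L = {u \<in> W1_bdry p phi Om.
      integrable (lebesgue_on Om) (\<lambda>x. L x (u x) (weak_gradient Om u x))}"

definition Linfty_regular_at ::
  "real \<Rightarrow> ('a::euclidean_space \<Rightarrow> real) \<Rightarrow> 'a set \<Rightarrow> ('a \<Rightarrow> real \<Rightarrow> 'a \<Rightarrow> real) \<Rightarrow> ('a \<Rightarrow> real) \<Rightarrow> bool" where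
  "Linfty_regular_at p phi Om L u \<longleftrightarrow>
     (\<exists>U :: nat \<Rightarrow> 'a \<Rightarrow> real.
        (\<forall>k. U k \<in> admissible p phi Om L \<inter> Linfty_space Om) \<and>
        (\<lambda>k. W1_norm p Om (\<lambda>x. U k x - u x)) \<longlonglongrightarrow> 0 \<and>
        (\<lambda>k. LINT x|lebesgue_on Om.
               \<bar>L x (U k x) (weak_gradient Om (U k) x) - L x (u x) (weak_gradient Om u x)\<bar>)
          \<longlonglongrightarrow> 0)"

end

theory Submission
  imports Defs
begin

text \<open>
  The approximation cuts \<open>u\<close> off from above and from below by barriers: \<open>U = max (- a) (min u b)\<close>.
  A constant barrier \<open>b = s\<close> could be too expensive, because \<open>H (s, 0)\<close> may be huge. Instead \<open>b\<close>
  oscillates in a tiny interval above \<open>s\<close> with gradient \<open>\<plusminus>\<xi>\<close> almost everywhere, so that by continuity of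
  \<open>H\<close> and the symmetry assumption its energy density is at most about \<open>C * (\<bar>H (s, \<xi>)\<bar> + 1)\<close>. The pair
  \<open>(s, \<xi>)\<close> is \<open>(u x, \<nabla>u x)\<close> at a point \<open>x\<close> of \<open>{u > m}\<close> at which \<open>\<bar>H (u, \<nabla>u)\<bar> + \<bar>\<nabla>u\<bar>\<^sup>p\<close> does not exceed
  its average over \<open>{u > m}\<close>. As \<open>b \<ge> s > m\<close>, the energy of \<open>b\<close> on \<open>{u > b}\<close> is then controlled by
  the integral of that function over \<open>{u > m}\<close> and by the measure of this set, and both vanish
  as \<open>m\<close> tends to infinity.
\<close>

section \<open>Continuity of translations and Jensen's inequality\<close>

text \<open>No growth bound links \<open>H\<close> to the exponent \<open>p\<close>, so convergence
  of the energies cannot come from domination by powers of \<open>u\<close> and its gradient.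
  Instead \<open>u\<close> is left untouched off two small sets, and on these its energy pays for
  that of the replacement. The boundary values must survive as well. For this the levels start at an
  essential bound of \<open>\<bar>phi\<bar>\<close>: then \<open>b - phi\<close> is nonnegative and
  \<open>- a - phi\<close> is nonpositive, and truncating an element of \<open>W0\<close> from above
  or below by such functions stays in \<open>W0\<close>, although they need not vanish at the
  boundary. The gradient of a barrier has to alternate between two opposite values, because a
  function with the constant gradient \<open>\<xi>\<close> would in general leave a tiny interval.
  The power of the gradient is averaged together with \<open>\<bar>H\<bar>\<close> so that the same
  barrier is also small in the Sobolev norm where it is used. The lower barrier is an upper barrier
  for \<open>- u\<close> and the integrand \<open>H (- t, - \<xi>)\<close>. The truncation facts
  rest on a chain rule for weak gradients, proved by mollification, and on the vanishing of the
  gradient on level sets.\<close>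

lemma lborel_distr_add_right: "distr lborel borel (\<lambda>x. x + c) = (lborel :: 'a::euclidean_space measure)"
proof -
  have "(\<lambda>x. x + c) = (+) c" by (auto simp: add.commute)
  then show ?thesis by (simp add: lborel_distr_plus)
qed

lemma lborel_integrable_translate_iff:
  fixes f :: "'a::euclidean_space \<Rightarrow> 'b::{banach, second_countable_topology}"
  assumes [measurable]: "f \<in> borel_measurable borel"
  shows "integrable lborel (\<lambda>x. f (x + c)) \<longleftrightarrow> integrable lborel f"
proof -
  have "integrable (distr lborel borel (\<lambda>x. x + c)) f = integrable lborel (\<lambda>x. f (x + c))"
    by (rule integrable_distr_eq) auto
  then show ?thesis by (simp add: lborel_distr_add_right)
qed

lemma lborel_integral_translate:
  fixes f :: "'a::euclidean_space \<Rightarrow> 'b::{banach, second_countable_topology}"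
  assumes [measurable]: "f \<in> borel_measurable borel"
  shows "(LINT x|lborel. f (x + c)) = integral\<^sup>L lborel f"
proof -
  have "integral\<^sup>L (distr lborel borel (\<lambda>x. x + c)) f = (LINT x|lborel. f (x + c))"
    by (rule integral_distr) auto
  then show ?thesis by (simp add: lborel_distr_add_right)
qed

lemma integrable_translate_diff:
  fixes f :: "'a::euclidean_space \<Rightarrow> 'b::{banach, second_countable_topology}"
  assumes f: "integrable lborel f"
  shows "integrable lborel (\<lambda>x. f (x + c) - f x)"
proof -
  have "f \<in> borel_measurable borel" using borel_measurable_integrable[OF f] by simp
  then show ?thesis
    using f by (intro Bochner_Integration.integrable_diff) (simp_all add: lborel_integrable_translate_iff)
qed

text \<open>For open \<open>U\<close> a point of \<open>U\<close> stays in \<open>U\<close> under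
  small translations, so the minimum of the two indicators tends to the indicator of
  \<open>U\<close> everywhere; boundary points do no harm because the minimum is 0 off
  \<open>U\<close>. The identity \<open>\<bar>a - b\<bar> = a + b - 2 * min a b\<close> and
  translation invariance turn this into convergence in mean.\<close>

lemma translate_indicator_open_L1:
  fixes U :: "'a::euclidean_space set"
  assumes U: "open U" "emeasure lborel U < \<infinity>" and z: "z \<longlonglongrightarrow> 0"
  shows "(\<lambda>n. LINT x|lborel. \<bar>indicat_real U (x + z n) - indicat_real U x\<bar>) \<longlonglongrightarrow> 0"
proof -
  have [measurable]: "U \<in> sets borel" using U by auto
  let ?I = "\<lambda>x. indicat_real U x"
  have iU: "integrable lborel ?I" using U by (simp add: integrable_indicator_iff)
  have iUt: "integrable lborel (\<lambda>x. ?I (x + c))" for c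
    using iU by (subst lborel_integrable_translate_iff) auto
  have imin: "integrable lborel (\<lambda>x. min (?I (x + c)) (?I x))" for c
    by (rule Bochner_Integration.integrable_bound[OF iU]) (auto simp: indicator_def)
  have "(\<lambda>n. LINT x|lborel. min (?I (x + z n)) (?I x)) \<longlonglongrightarrow> integral\<^sup>L lborel ?I"
  proof (rule integral_dominated_convergence[OF _ _ iU])
    show "AE x in lborel. (\<lambda>n. min (?I (x + z n)) (?I x)) \<longlonglongrightarrow> ?I x"
    proof (rule AE_I2)
      fix x :: 'a
      show "(\<lambda>n. min (?I (x + z n)) (?I x)) \<longlonglongrightarrow> ?I x"
      proof (cases "x \<in> U")
        case True
        have "(\<lambda>n. x + z n) \<longlonglongrightarrow> x" using tendsto_add[OF tendsto_const z, of x] by simp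
        then have "\<forall>\<^sub>F n in sequentially. x + z n \<in> U" using U True topological_tendstoD by blast
        then show ?thesis
          by (intro tendsto_eventually) (auto elim!: eventually_mono simp: True)
      qed (auto simp: indicator_def min_def intro!: tendsto_eventually)
    qed
  qed (auto simp: indicator_def)
  then have "(\<lambda>n. integral\<^sup>L lborel ?I + integral\<^sup>L lborel ?I - 2 * (LINT x|lborel. min (?I (x + z n)) (?I x)))
      \<longlonglongrightarrow> integral\<^sup>L lborel ?I + integral\<^sup>L lborel ?I - 2 * integral\<^sup>L lborel ?I"
    by (intro tendsto_intros)
  moreover have "(LINT x|lborel. \<bar>?I (x + c) - ?I x\<bar>)
      = integral\<^sup>L lborel ?I + integral\<^sup>L lborel ?I - 2 * (LINT x|lborel. min (?I (x + c)) (?I x))" for c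
  proof -
    have "(LINT x|lborel. \<bar>?I (x + c) - ?I x\<bar>)
      = (LINT x|lborel. ?I (x + c) + ?I x - 2 * min (?I (x + c)) (?I x))"
      by (intro Bochner_Integration.integral_cong) (auto simp: min_def abs_if)
    also have "\<dots> = (LINT x|lborel. ?I (x + c)) + (LINT x|lborel. ?I x) - 2 * (LINT x|lborel. min (?I (x + c)) (?I x))"
      using iU iUt imin by simp
    also have "(LINT x|lborel. ?I (x + c)) = integral\<^sup>L lborel ?I"
      by (rule lborel_integral_translate) auto
    finally show ?thesis .
  qed
  ultimately show ?thesis by simp
qed

text \<open>Outer regularity replaces \<open>A\<close> by an open superset \<open>U\<close> with
  \<open>U - A\<close> of measure below \<open>r / 3\<close>. The error consists of the translation
  error of \<open>U\<close> and of the indicator of \<open>U - A\<close> at \<open>x\<close> and at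
  \<open>x + z n\<close>, and the last two have equal integrals.\<close>

lemma translate_indicator_L1:
  fixes A :: "'a::euclidean_space set"
  assumes A: "A \<in> sets lborel" "emeasure lborel A < \<infinity>" and z: "z \<longlonglongrightarrow> 0"
  shows "(\<lambda>n. LINT x|lborel. \<bar>indicat_real A (x + z n) - indicat_real A x\<bar>) \<longlonglongrightarrow> 0"
proof (rule LIMSEQ_I)
  fix r :: real assume r: "0 < r"
  have [measurable]: "A \<in> sets borel" using A by simp
  obtain U where U: "open U" "A \<subseteq> U" "emeasure lborel (U - A) < ennreal (r / 3)"
    using outer_regular_lborel[of A "r/3"] A r by auto
  have [measurable]: "U \<in> sets borel" using U by auto
  have "emeasure lborel U = emeasure lborel A + emeasure lborel (U - A)"
    using U(2) A by (subst plus_emeasure) (auto intro!: arg_cong[of _ _ "emeasure lborel"])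
  also have "\<dots> < \<infinity>" using A U(3) by (auto simp: ennreal_add_less_top less_trans[OF U(3)])
  finally have Ufin: "emeasure lborel U < \<infinity>" .
  have iUA: "integrable lborel (indicat_real (U - A))"
    using U(3) by (auto simp: integrable_indicator_iff intro: less_trans)
  have iUAt: "integrable lborel (\<lambda>x. indicat_real (U - A) (x + c))" for c
    using iUA by (subst lborel_integrable_translate_iff) auto
  have iU: "integrable lborel (indicat_real U)" using Ufin by (simp add: integrable_indicator_iff)
  have iA: "integrable lborel (indicat_real A)" using A by (simp add: integrable_indicator_iff)
  have m: "(LINT x|lborel. indicat_real (U - A) x) < r / 3"
  proof -
    have "emeasure lborel (U - A) < top" using U(3) by (auto intro: less_trans)
    then show ?thesis using U(3) by (simp add: measure_def enn2real_less_iff del: less_divide_eq_numeral1)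
  qed
  obtain n0 where n0: "\<And>n. n \<ge> n0 \<Longrightarrow> (LINT x|lborel. \<bar>indicat_real U (x + z n) - indicat_real U x\<bar>) < r / 3"
    using LIMSEQ_D[OF translate_indicator_open_L1[OF U(1) Ufin z], of "r/3"] r by auto
  show "\<exists>no. \<forall>n\<ge>no. norm ((LINT x|lborel. \<bar>indicat_real A (x + z n) - indicat_real A x\<bar>) - 0) < r"
  proof (intro exI allI impI)
    fix n assume n: "n \<ge> n0"
    have "(LINT x|lborel. \<bar>indicat_real A (x + z n) - indicat_real A x\<bar>)
      \<le> (LINT x|lborel. \<bar>indicat_real U (x + z n) - indicat_real U x\<bar> + indicat_real (U - A) (x + z n) + indicat_real (U - A) x)"
    proof (rule integral_mono)
      show "\<bar>indicat_real A (x + z n) - indicat_real A x\<bar>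
        \<le> \<bar>indicat_real U (x + z n) - indicat_real U x\<bar> + indicat_real (U - A) (x + z n) + indicat_real (U - A) x" for x
        using U(2) by (auto simp: indicator_def)
    qed (intro Bochner_Integration.integrable_add integrable_abs iUA iUAt integrable_translate_diff iU iA)+
    also have "\<dots> = (LINT x|lborel. \<bar>indicat_real U (x + z n) - indicat_real U x\<bar>)
       + (LINT x|lborel. indicat_real (U - A) (x + z n)) + (LINT x|lborel. indicat_real (U - A) x)"
      using iUA iUAt integrable_translate_diff[OF iU] by simp
    also have "(LINT x|lborel. indicat_real (U - A) (x + z n)) = (LINT x|lborel. indicat_real (U - A) x)"
      by (rule lborel_integral_translate) auto
    finally have "(LINT x|lborel. \<bar>indicat_real A (x + z n) - indicat_real A x\<bar>) < r"
      using n0[OF n] m by linarith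
    then show "norm ((LINT x|lborel. \<bar>indicat_real A (x + z n) - indicat_real A x\<bar>) - 0) < r"
      by (simp add: integral_nonneg_AE)
  qed
qed

text \<open>Induction over integrable functions: indicators times vectors, sums, and dominated
  pointwise limits. In the limit case the approximation errors at \<open>x\<close> and at
  \<open>x + z n\<close> have the same integral by translation invariance, so one good index
  \<open>i\<close> serves for all \<open>n\<close>.\<close>

lemma translate_L1:
  fixes f :: "'a::euclidean_space \<Rightarrow> 'b::euclidean_space"
  assumes f: "integrable lborel f" and z: "z \<longlonglongrightarrow> 0"
  shows "(\<lambda>n. LINT x|lborel. norm (f (x + z n) - f x)) \<longlonglongrightarrow> 0"
  using f
proof (induction rule: integrable_induct)
  case (base A c)
  have "norm (indicat_real A (x + z n) *\<^sub>R c - indicat_real A x *\<^sub>R c)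
     = norm c * \<bar>indicat_real A (x + z n) - indicat_real A x\<bar>" for x n
    by (simp add: scaleR_diff_left[symmetric])
  then show ?case
    using tendsto_mult_right_zero[OF translate_indicator_L1[OF base z], of "norm c"] by simp
next
  case (add f g)
  have "(\<lambda>n. (LINT x|lborel. norm (f (x + z n) - f x)) + (LINT x|lborel. norm (g (x + z n) - g x))) \<longlonglongrightarrow> 0"
    using tendsto_add[OF add(3,4)] by simp
  then show ?case
  proof (rule Lim_null_comparison[rotated], intro always_eventually allI)
    fix n
    have "(LINT x|lborel. norm (f (x + z n) + g (x + z n) - (f x + g x)))
       \<le> (LINT x|lborel. norm (f (x + z n) - f x) + norm (g (x + z n) - g x))"
      using integrable_translate_diff[OF add(1)] integrable_translate_diff[OF add(2)]
        integrable_translate_diff[OF Bochner_Integration.integrable_add[OF add(1,2)]]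
      by (intro integral_mono) (auto simp: add_diff_add norm_triangle_ineq)
    also have "\<dots> = (LINT x|lborel. norm (f (x + z n) - f x)) + (LINT x|lborel. norm (g (x + z n) - g x))"
      using integrable_translate_diff[OF add(1)] integrable_translate_diff[OF add(2)] by simp
    finally show "norm (LINT x|lborel. norm (f (x + z n) + g (x + z n) - (f x + g x)))
       \<le> (LINT x|lborel. norm (f (x + z n) - f x)) + (LINT x|lborel. norm (g (x + z n) - g x))"
      by (simp add: integral_nonneg_AE)
  qed
next
  case (lim f s)
  have si: "integrable lborel (s i)" for i by (rule lim)
  have fi: "integrable lborel f" by (rule lim)
  have bd: "norm (s i x) \<le> 2 * norm (f x)" for i x by (rule lim) simp
  have IH: "(\<lambda>n. LINT x|lborel. norm (s i (x + z n) - s i x)) \<longlonglongrightarrow> 0" for i by (rule lim)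
  have "(\<lambda>i. LINT x|lborel. norm (s i x - f x)) \<longlonglongrightarrow> (LINT x|(lborel :: 'a measure). (0::real))"
  \<comment> \<open>The induction rule provides \<open>norm (s i x) \<le> 2 * norm (f x)\<close>,
    whence the dominating function \<open>3 * norm (f x)\<close>.\<close>
  proof (rule integral_dominated_convergence[where f = "\<lambda>x. 0::real" and s = "\<lambda>i x. norm (s i x - f x)" and w = "\<lambda>x. 3 * norm (f x)"])
    show "AE x in lborel. (\<lambda>i. norm (s i x - f x)) \<longlonglongrightarrow> 0"
    proof (rule AE_I2)
      fix x :: 'a
      have "(\<lambda>i. s i x) \<longlonglongrightarrow> f x" by (rule lim) simp
      then show "(\<lambda>i. norm (s i x - f x)) \<longlonglongrightarrow> 0" by (intro tendsto_norm_zero LIM_zero)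
    qed
    show "AE x in lborel. norm (norm (s i x - f x)) \<le> 3 * norm (f x)" for i
    proof (rule AE_I2)
      fix x :: 'a
      have "norm (s i x - f x) \<le> norm (s i x) + norm (f x)" by (rule norm_triangle_ineq4)
      then show "norm (norm (s i x - f x)) \<le> 3 * norm (f x)" using bd[of i x] by simp
    qed
  qed (use si fi in auto)
  then have L: "(\<lambda>i. LINT x|lborel. norm (s i x - f x)) \<longlonglongrightarrow> 0" by simp
  show ?case
  proof (rule LIMSEQ_I)
    fix r :: real assume r: "0 < r"
    obtain i where i: "(LINT x|lborel. norm (s i x - f x)) < r / 3"
      using LIMSEQ_D[OF L, of "r/3"] r by auto
    obtain n0 where n0: "\<And>n. n \<ge> n0 \<Longrightarrow> (LINT x|lborel. norm (s i (x + z n) - s i x)) < r / 3"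
      using LIMSEQ_D[OF IH[of i], of "r/3"] r by auto
    have id: "integrable lborel (\<lambda>x. s i x - f x)" using si fi by auto
    have [measurable]: "s i \<in> borel_measurable borel" "f \<in> borel_measurable borel"
      using borel_measurable_integrable[OF si] borel_measurable_integrable[OF fi] by auto
    have idt: "integrable lborel (\<lambda>x. s i (x + c) - f (x + c))" for c
      using lborel_integrable_translate_iff[of "\<lambda>x. s i x - f x" c] id by auto
    show "\<exists>no. \<forall>n\<ge>no. norm ((LINT x|lborel. norm (f (x + z n) - f x)) - 0) < r"
    proof (intro exI allI impI)
      fix n assume n: "n \<ge> n0"
      have "(LINT x|lborel. norm (f (x + z n) - f x))
        \<le> (LINT x|lborel. norm (s i (x + z n) - s i x) + norm (s i (x + z n) - f (x + z n)) + norm (s i x - f x))"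
      proof (rule integral_mono)
        fix x
        have "f (x + z n) - f x = ((s i (x + z n) - s i x) - (s i (x + z n) - f (x + z n))) + (s i x - f x)" by simp
        also have "norm \<dots> \<le> norm ((s i (x + z n) - s i x) - (s i (x + z n) - f (x + z n))) + norm (s i x - f x)"
          by (rule norm_triangle_ineq)
        also have "\<dots> \<le> norm (s i (x + z n) - s i x) + norm (s i (x + z n) - f (x + z n)) + norm (s i x - f x)"
          by (intro add_right_mono norm_triangle_ineq4)
        finally show "norm (f (x + z n) - f x) \<le> norm (s i (x + z n) - s i x) + norm (s i (x + z n) - f (x + z n)) + norm (s i x - f x)" .
      qed (use integrable_translate_diff[OF fi] integrable_translate_diff[OF si] id idt in auto)
      also have "\<dots> = (LINT x|lborel. norm (s i (x + z n) - s i x)) + (LINT x|lborel. norm (s i (x + z n) - f (x + z n))) + (LINT x|lborel. norm (s i x - f x))"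
        using integrable_translate_diff[OF si] id idt by simp
      also have "(LINT x|lborel. norm (s i (x + z n) - f (x + z n))) = (LINT x|lborel. norm (s i x - f x))"
        by (rule lborel_integral_translate[of "\<lambda>x. norm (s i x - f x)"]) auto
      finally have "(LINT x|lborel. norm (f (x + z n) - f x)) < r"
        using n0[OF n] i by linarith
      then show "norm ((LINT x|lborel. norm (f (x + z n) - f x)) - 0) < r"
        by (simp add: integral_nonneg_AE)
    qed
  qed
qed

section \<open>Inequalities for powers, Jensen's inequality, and translations in the p-th power
  mean\<close>

lemma powr_add_le:
  fixes a b p :: real
  assumes "0 \<le> a" "0 \<le> b" "0 \<le> p"
  shows "(a + b) powr p \<le> 2 powr p * (a powr p + b powr p)"
proof -
  \<comment> \<open>The constant \<open>2 powr p\<close> comes from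
    \<open>a + b \<le> 2 * max a b\<close>; no convexity is involved, so it serves for every
    nonnegative exponent.\<close>
  have "(a + b) powr p \<le> (2 * max a b) powr p"
    using assms by (intro powr_mono2) auto
  also have "\<dots> = 2 powr p * max a b powr p"
    by (simp add: powr_mult)
  also have "max a b powr p \<le> a powr p + b powr p"
    by (auto simp: max_def)
  finally show ?thesis by simp
qed

lemma norm_add_powr_le:
  fixes x y :: "'b::real_normed_vector"
  assumes "0 \<le> p"
  shows "norm (x + y) powr p \<le> 2 powr p * (norm x powr p + norm y powr p)"
proof -
  have "norm (x + y) powr p \<le> (norm x + norm y) powr p"
    using assms by (intro powr_mono2 norm_triangle_ineq) auto
  also have "\<dots> \<le> 2 powr p * (norm x powr p + norm y powr p)"
    using assms by (intro powr_add_le) auto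
  finally show ?thesis .
qed

lemma norm_diff_powr_le:
  fixes x y :: "'b::real_normed_vector"
  assumes "0 \<le> p"
  shows "norm (x - y) powr p \<le> 2 powr p * (norm x powr p + norm y powr p)"
  using norm_add_powr_le[OF assms, of x "- y"] by simp

text \<open>Convexity of the power, written as a supporting line at \<open>a\<close>. Dividing by
  \<open>a powr p\<close> reduces it to Bernoulli's inequality, which is Young's inequality for
  \<open>(t / a) powr p\<close> and 1 with the weights \<open>1 / p\<close> and
  \<open>1 - 1 / p\<close>.\<close>

lemma powr_ge_tangent:
  fixes a t p :: real
  assumes "0 < a" "0 \<le> t" "1 \<le> p"
  shows "a powr p + p * a powr (p - 1) * (t - a) \<le> t powr p"
proof (cases "t = 0")
  case True
  have "a powr (p - 1) * a = a powr p" using assms by (simp add: powr_diff)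
  then have "a powr p + p * a powr (p - 1) * (t - a) = (1 - p) * a powr p"
    using True by (simp add: algebra_simps)
  also have "\<dots> \<le> 0" using assms by (intro mult_nonpos_nonneg) auto
  finally show ?thesis using True by simp
next
  case False
  then have t: "t > 0" using assms by simp
  have "((t / a) powr p) powr (1 / p) * 1 powr (1 - 1 / p) \<le> (1 / p) * (t / a) powr p + (1 - 1 / p) * 1"
    using assms t by (intro Youngs_inequality_0) (auto simp: divide_simps)
  then have "t / a \<le> (1 / p) * (t / a) powr p + (1 - 1 / p)"
    using assms t by (simp add: powr_powr)
  then have "p * (t / a) \<le> p * ((1 / p) * (t / a) powr p + (1 - 1 / p))"
    using assms by (intro mult_left_mono) auto
  also have "\<dots> = (t / a) powr p + (p - 1)"
    using assms by (simp add: distrib_left right_diff_distrib)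
  finally have *: "1 + p * (t / a - 1) \<le> (t / a) powr p"
    by (simp add: right_diff_distrib)
  have "a powr p * (1 + p * (t / a - 1)) \<le> a powr p * (t / a) powr p"
    by (intro mult_left_mono *) auto
  also have "\<dots> = t powr p" using assms t by (simp add: powr_divide)
  also have "a powr p * (1 + p * (t / a - 1)) = a powr p + p * a powr (p - 1) * (t - a)"
    using assms by (simp add: powr_diff field_simps)
  finally show ?thesis by simp
qed

text \<open>Integrate the supporting line at the mean \<open>a\<close> against the probability
  density \<open>k\<close>; the linear term drops out. The right-hand side is a nonnegative integral
  that may be infinite, which lets the bound enter Tonelli's theorem before any integrability of the
  p-th power is known.\<close>

lemma jensen_powr_nn:
  fixes k h :: "'a \<Rightarrow> real"
  assumes [measurable]: "k \<in> borel_measurable M" "h \<in> borel_measurable M"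
    and k: "\<And>x. 0 \<le> k x" "integrable M k" "integral\<^sup>L M k = 1"
    and h: "\<And>x. 0 \<le> h x" and kh: "integrable M (\<lambda>x. k x * h x)" and p: "1 \<le> p"
  shows "ennreal ((LINT x|M. k x * h x) powr p) \<le> (\<integral>\<^sup>+ x. ennreal (k x * h x powr p) \<partial>M)"
proof (cases "(\<integral>\<^sup>+ x. ennreal (k x * h x powr p) \<partial>M) < \<infinity>")
  case False
  then show ?thesis by (simp add: less_top[symmetric])
next
  case True
  have ip: "integrable M (\<lambda>x. k x * h x powr p)"
    using True k by (intro integrableI_nonneg) auto
  define a where "a = (LINT x|M. k x * h x)"
  have a0: "0 \<le> a" unfolding a_def using k h by (intro integral_nonneg_AE) auto
  have "a powr p \<le> (LINT x|M. k x * h x powr p)"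
  proof (cases "a = 0")
    case True
    then show ?thesis using k by (auto intro!: integral_nonneg_AE)
  next
    case False
    then have a: "0 < a" using a0 by simp
    have "(LINT x|M. a powr p * k x + p * a powr (p - 1) * (k x * h x - a * k x)) \<le> (LINT x|M. k x * h x powr p)"
    proof (rule integral_mono)
      show "integrable M (\<lambda>x. a powr p * k x + p * a powr (p - 1) * (k x * h x - a * k x))"
        using k kh by simp
      fix x
      have "k x * (a powr p + p * a powr (p - 1) * (h x - a)) \<le> k x * h x powr p"
        using k h a p by (intro mult_left_mono powr_ge_tangent) auto
      then show "a powr p * k x + p * a powr (p - 1) * (k x * h x - a * k x) \<le> k x * h x powr p"
        by (simp add: algebra_simps)
    qed (fact ip)
    also have "(LINT x|M. a powr p * k x + p * a powr (p - 1) * (k x * h x - a * k x)) = a powr p"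
      using k kh by (simp add: a_def[symmetric])
    finally show ?thesis .
  qed
  also have "ennreal (LINT x|M. k x * h x powr p) = (\<integral>\<^sup>+ x. ennreal (k x * h x powr p) \<partial>M)"
    using ip k by (intro nn_integral_eq_integral[symmetric]) auto
  finally show ?thesis unfolding a_def by (simp add: ennreal_leI)
qed

text \<open>Serves truncation arguments: choose the level \<open>m\<close> first to make
  \<open>A m\<close> small, then let \<open>n\<close> grow with \<open>m\<close> fixed.\<close>

lemma LIMSEQ_zero_double:
  fixes T :: "nat \<Rightarrow> real"
  assumes T: "\<And>n. 0 \<le> T n" "\<And>m n. T n \<le> A m + B m n"
    and A: "A \<longlonglongrightarrow> 0" and B: "\<And>m::nat. B m \<longlonglongrightarrow> 0"
  shows "T \<longlonglongrightarrow> 0"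
proof (rule LIMSEQ_I)
  fix r :: real assume r: "0 < r"
  obtain m where "norm (A m - 0) < r / 2" using LIMSEQ_D[OF A, of "r/2"] r by auto
  then have m: "A m < r / 2" by simp
  obtain n0 where n0': "\<And>n. n \<ge> n0 \<Longrightarrow> norm (B m n - 0) < r / 2" using LIMSEQ_D[OF B[of m], of "r/2"] r by auto
  have n0: "B m n < r / 2" if "n \<ge> n0" for n using n0'[OF that] by simp
  show "\<exists>no. \<forall>n\<ge>no. norm (T n - 0) < r"
  proof (intro exI allI impI)
    fix n assume "n \<ge> n0"
    then show "norm (T n - 0) < r" using T(1)[of n] T(2)[of n m] m n0[of n] by simp
  qed
qed

text \<open>Split \<open>f\<close> at height \<open>m\<close>. For the bounded part
  \<open>g m\<close> differences are at most \<open>2 * m\<close>, so their p-th power is at most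
  \<open>(2 * m) powr (p - 1)\<close> times the first power, and continuity in mean applies. The
  tail \<open>h m\<close> has a small p-th power integral, unaffected by translation.\<close>

lemma translate_Lp:
  fixes f :: "'a::euclidean_space \<Rightarrow> 'b::euclidean_space"
  assumes f: "integrable lborel f" and fp: "integrable lborel (\<lambda>x. norm (f x) powr p)"
    and p: "1 \<le> p" and z: "z \<longlonglongrightarrow> 0"
  shows "(\<lambda>n. LINT x|lborel. norm (f (x + z n) - f x) powr p) \<longlonglongrightarrow> 0"
proof -
  have [measurable]: "f \<in> borel_measurable borel" using borel_measurable_integrable[OF f] by simp
  define S where "S m = {x. norm (f x) \<le> real m}" for m
  have [measurable]: "S m \<in> sets borel" for m unfolding S_def by measurable
  define g where "g m x = indicat_real (S m) x *\<^sub>R f x" for m x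
  define h where "h m x = indicat_real (- S m) x *\<^sub>R f x" for m x
  have [measurable]: "g m \<in> borel_measurable borel" "h m \<in> borel_measurable borel" for m
    unfolding g_def[abs_def] h_def[abs_def] by measurable
  have fgh: "f x = g m x + h m x" for x m by (auto simp: g_def h_def indicator_def)
  have gi: "integrable lborel (g m)" for m
    by (rule Bochner_Integration.integrable_bound[OF f]) (auto simp: g_def indicator_def)
  have hp: "integrable lborel (\<lambda>x. norm (h m x) powr p)" for m
    by (rule Bochner_Integration.integrable_bound[OF fp]) (auto simp: h_def indicator_def)
  have hpt: "integrable lborel (\<lambda>x. norm (h m (x + c)) powr p)" for m c
    using lborel_integrable_translate_iff[of "\<lambda>x. norm (h m x) powr p" c] hp by simp
  have fpt: "integrable lborel (\<lambda>x. norm (f (x + c)) powr p)" for c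
    using lborel_integrable_translate_iff[of "\<lambda>x. norm (f x) powr p" c] fp by simp
  have fd: "integrable lborel (\<lambda>x. norm (f (x + c) - f x) powr p)" for c
  proof (rule Bochner_Integration.integrable_bound)
    show "integrable lborel (\<lambda>x. 2 powr p * (norm (f (x + c)) powr p + norm (f x) powr p))"
      using fp fpt by simp
    show "AE x in lborel. norm (norm (f (x + c) - f x) powr p) \<le> norm (2 powr p * (norm (f (x + c)) powr p + norm (f x) powr p))"
      using norm_diff_powr_le[of p] p by (intro AE_I2) (auto simp: abs_mult)
  qed auto
  have gb: "norm (g m (x + c) - g m x) powr p \<le> (2 * real m) powr (p - 1) * norm (g m (x + c) - g m x)" for m x c
  proof (cases "g m (x + c) - g m x = 0")
    case False
    have b: "norm (g m y) \<le> real m" for y by (auto simp: g_def indicator_def S_def)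
    have "norm (g m (x + c) - g m x) \<le> 2 * real m"
      using norm_triangle_ineq4[of "g m (x + c)" "g m x"] b[of x] b[of "x + c"] by linarith
    then have "norm (g m (x + c) - g m x) powr (p - 1) \<le> (2 * real m) powr (p - 1)"
      using p by (intro powr_mono2) auto
    moreover have "norm (g m (x + c) - g m x) powr p = norm (g m (x + c) - g m x) powr (p - 1) * norm (g m (x + c) - g m x)"
      using False by (simp add: powr_diff)
    ultimately show ?thesis by (simp add: mult_right_mono)
  qed auto
  have H0: "(\<lambda>m. LINT x|lborel. norm (h m x) powr p) \<longlonglongrightarrow> (LINT x|(lborel :: 'a measure). (0::real))"
  proof (rule integral_dominated_convergence[where f = "\<lambda>x. 0" and s = "\<lambda>m x. norm (h m x) powr p" and w = "\<lambda>x. norm (f x) powr p"])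
    show "AE x in lborel. (\<lambda>m. norm (h m x) powr p) \<longlonglongrightarrow> 0"
    proof (rule AE_I2)
      fix x
      have "\<forall>\<^sub>F m in sequentially. norm (f x) \<le> real m"
        by (rule eventually_sequentiallyI[of "nat \<lceil>norm (f x)\<rceil>"]) linarith
      then show "(\<lambda>m. norm (h m x) powr p) \<longlonglongrightarrow> 0"
        by (intro tendsto_eventually) (auto elim!: eventually_mono simp: h_def S_def)
    qed
  qed (use fp in \<open>auto simp: h_def indicator_def\<close>)
  show ?thesis
  proof (rule LIMSEQ_zero_double)
    show "0 \<le> (LINT x|lborel. norm (f (x + z n) - f x) powr p)" for n
      by (intro integral_nonneg_AE) auto
    show "(\<lambda>m. 2 powr p * (2 powr p * (2 * (LINT x|lborel. norm (h m x) powr p)))) \<longlonglongrightarrow> 0"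
      using H0 by (intro tendsto_mult_right_zero) simp
    show "(\<lambda>n. 2 powr p * ((2 * real m) powr (p - 1) * (LINT x|lborel. norm (g m (x + z n) - g m x)))) \<longlonglongrightarrow> 0" for m
      using translate_L1[OF gi z] by (intro tendsto_mult_right_zero)
    fix m n
    have "(LINT x|lborel. norm (f (x + z n) - f x) powr p)
      \<le> (LINT x|lborel. 2 powr p * (2 powr p * (norm (h m (x + z n)) powr p + norm (h m x) powr p)) +
            2 powr p * ((2 * real m) powr (p - 1) * norm (g m (x + z n) - g m x)))"
    proof (rule integral_mono)
      fix x
      have "norm (f (x + z n) - f x) powr p = norm ((h m (x + z n) - h m x) + (g m (x + z n) - g m x)) powr p"
        using fgh[of x m] fgh[of "x + z n" m] by (simp add: algebra_simps)
      also have "\<dots> \<le> 2 powr p * (norm (h m (x + z n) - h m x) powr p + norm (g m (x + z n) - g m x) powr p)"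
        using p by (intro norm_add_powr_le) auto
      also have "\<dots> \<le> 2 powr p * (2 powr p * (norm (h m (x + z n)) powr p + norm (h m x) powr p) + (2 * real m) powr (p - 1) * norm (g m (x + z n) - g m x))"
        using p gb by (intro mult_left_mono add_mono norm_diff_powr_le) auto
      finally show "norm (f (x + z n) - f x) powr p \<le> 2 powr p * (2 powr p * (norm (h m (x + z n)) powr p + norm (h m x) powr p)) +
            2 powr p * ((2 * real m) powr (p - 1) * norm (g m (x + z n) - g m x))"
        by (simp add: algebra_simps)
    qed (use fd hp hpt integrable_translate_diff[OF gi] in auto)
    also have "\<dots> = 2 powr p * (2 powr p * ((LINT x|lborel. norm (h m (x + z n)) powr p) + (LINT x|lborel. norm (h m x) powr p))) +
            2 powr p * ((2 * real m) powr (p - 1) * (LINT x|lborel. norm (g m (x + z n) - g m x)))"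
      using hp hpt integrable_translate_diff[OF gi] by simp
    also have "(LINT x|lborel. norm (h m (x + z n)) powr p) = (LINT x|lborel. norm (h m x) powr p)"
      by (rule lborel_integral_translate[of "\<lambda>x. norm (h m x) powr p"]) auto
    finally show "(LINT x|lborel. norm (f (x + z n) - f x) powr p) \<le> 2 powr p * (2 powr p * (2 * (LINT x|lborel. norm (h m x) powr p))) +
       2 powr p * ((2 * real m) powr (p - 1) * (LINT x|lborel. norm (g m (x + z n) - g m x)))"
      by simp
  qed
qed

section \<open>A compactly supported mollifier with continuous gradient\<close>

definition bump :: "real \<Rightarrow> 'a::euclidean_space \<Rightarrow> real" where
  "bump e x = (max 0 (e\<^sup>2 - x \<bullet> x))\<^sup>2"

definition mollifier :: "real \<Rightarrow> 'a::euclidean_space \<Rightarrow> real" where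
  "mollifier e x = bump e x / integral\<^sup>L lborel (bump e :: 'a \<Rightarrow> real)"

text \<open>The gradient in closed form. The squared positive part has the continuous derivative
  \<open>2 * max 0 t\<close>, so the kernel is continuously differentiable, which is exactly the
  regularity asked of test functions.\<close>

definition mollifier_grad :: "real \<Rightarrow> 'a::euclidean_space \<Rightarrow> 'a" where
  "mollifier_grad e x = (- 4 * max 0 (e\<^sup>2 - x \<bullet> x) / integral\<^sup>L lborel (bump e :: 'a \<Rightarrow> real)) *\<^sub>R x"

lemma continuous_bump [continuous_intros]: "continuous_on S (bump e)"
  unfolding bump_def by (intro continuous_intros)

lemma bump_nonneg: "0 \<le> bump e x" by (simp add: bump_def)

lemma inner_ge_square: "0 < e \<Longrightarrow> e \<le> norm x \<Longrightarrow> e\<^sup>2 \<le> x \<bullet> x"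
  by (metis dot_square_norm less_imp_le power_mono)

lemma bump_eq_0: "0 < e \<Longrightarrow> e \<le> norm x \<Longrightarrow> bump e x = 0"
  using inner_ge_square[of e x] by (simp add: bump_def max_def)

lemma bump_pos: "0 < e \<Longrightarrow> 0 < bump e 0"
  by (simp add: bump_def max_def)

lemma integrable_continuous_compact_support:
  fixes f :: "'a::euclidean_space \<Rightarrow> 'b::euclidean_space"
  assumes f: "continuous_on UNIV f" and e: "\<And>x. e \<le> norm x \<Longrightarrow> f x = 0"
  shows "integrable lborel f"
proof -
  have "integrable lborel (\<lambda>x. indicator (cball 0 e) x *\<^sub>R f x)"
    by (rule borel_integrable_compact) (auto intro: continuous_on_subset[OF f])
  also have "(\<lambda>x. indicator (cball 0 e) x *\<^sub>R f x) = f"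
    using e by (force simp: indicator_def fun_eq_iff)
  finally show ?thesis .
qed

text \<open>The integrand is nonnegative and positive on a nonempty open set, which is not
  negligible; without this the normalization in \<open>mollifier\<close> would be
  meaningless.\<close>

lemma integral_bump_pos: "0 < e \<Longrightarrow> 0 < integral\<^sup>L lborel (bump e :: 'a::euclidean_space \<Rightarrow> real)"
proof -
  assume e: "0 < e"
  have i: "integrable lborel (bump e :: 'a \<Rightarrow> real)"
    using e by (intro integrable_continuous_compact_support[of _ e] continuous_bump bump_eq_0)
  define S where "S = {x::'a. 0 < bump e x}"
  have S: "open S" unfolding S_def by (intro open_Collect_less continuous_intros)
  have "0 \<in> S" using bump_pos[OF e] by (simp add: S_def)
  then have "\<not> negligible S" using S open_not_negligible by auto
  moreover have "negligible S" if "AE x in lborel. x \<notin> S"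
  proof -
    from that have "S \<in> null_sets lborel" using S by (simp add: AE_iff_null_sets)
    then show ?thesis by (simp add: negligible_iff_null_sets null_sets_completionI)
  qed
  moreover have "integral\<^sup>L lborel (bump e :: 'a \<Rightarrow> real) = 0 \<longleftrightarrow> (AE x in lborel. bump e (x::'a) = 0)"
    by (intro integral_nonneg_eq_0_iff_AE i AE_I2 bump_nonneg)
  ultimately have "integral\<^sup>L lborel (bump e :: 'a \<Rightarrow> real) \<noteq> 0"
    unfolding S_def by (metis (mono_tags, lifting) eventually_mono less_irrefl mem_Collect_eq)
  then show ?thesis
    by (simp add: order_less_le integral_nonneg_AE bump_nonneg)
qed

lemma mollifier_nonneg: "0 < e \<Longrightarrow> 0 \<le> mollifier e x"
  by (simp add: mollifier_def bump_nonneg less_imp_le[OF integral_bump_pos])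

lemma mollifier_eq_0: "0 < e \<Longrightarrow> e \<le> norm x \<Longrightarrow> mollifier e x = 0"
  by (simp add: mollifier_def bump_eq_0)

lemma mollifier_grad_eq_0: "0 < e \<Longrightarrow> e \<le> norm x \<Longrightarrow> mollifier_grad e x = 0"
  using inner_ge_square[of e x] by (simp add: mollifier_grad_def max_def)

lemma continuous_mollifier [continuous_intros]: "continuous_on S (mollifier e)"
  unfolding mollifier_def[abs_def] divide_inverse by (intro continuous_intros)

lemma continuous_mollifier_grad [continuous_intros]: "continuous_on S (mollifier_grad e)"
  unfolding mollifier_grad_def[abs_def] divide_inverse by (intro continuous_intros)

lemma borel_measurable_mollifier [measurable]: "mollifier e \<in> borel_measurable borel"
  by (intro borel_measurable_continuous_onI continuous_intros)

lemma borel_measurable_mollifier_grad [measurable]: "mollifier_grad e \<in> borel_measurable borel"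
  by (intro borel_measurable_continuous_onI continuous_intros)

lemma integrable_mollifier: "0 < e \<Longrightarrow> integrable lborel (mollifier e)"
  by (intro integrable_continuous_compact_support[of _ e] continuous_mollifier mollifier_eq_0)

lemma integral_mollifier: "0 < e \<Longrightarrow> integral\<^sup>L lborel (mollifier e :: 'a::euclidean_space \<Rightarrow> real) = 1"
  unfolding mollifier_def[abs_def] using integral_bump_pos[where 'a='a, of e] by simp

lemma GDERIV_mollifier: "GDERIV (mollifier e) x :> mollifier_grad e x"
proof -
  have D: "((\<lambda>t::real. (max 0 t)\<^sup>2) has_real_derivative 2 * max 0 t) (at t)" for t
  proof (cases "t = 0")
    case False
    show ?thesis
    proof (cases "t > 0")
      case True
      have "((\<lambda>t::real. t\<^sup>2) has_real_derivative 2 * t) (at t)"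
        by (auto intro!: derivative_eq_intros)
      then have "((\<lambda>t::real. (max 0 t)\<^sup>2) has_real_derivative 2 * t) (at t)"
        by (rule has_field_derivative_transform_within_open[of _ _ _ "{0<..}"]) (use True in auto)
      then show ?thesis using True by simp
    next
      case t: False
      have "((\<lambda>t::real. 0) has_real_derivative 0) (at t)" by simp
      then have "((\<lambda>t::real. (max 0 t)\<^sup>2) has_real_derivative 0) (at t)"
        by (rule has_field_derivative_transform_within_open[of _ _ _ "{..<0}"]) (use False t in auto)
      then show ?thesis using False t by simp
    qed
  next
    case True
    \<comment> \<open>At the kink the difference quotient of the squared positive part is at most
      \<open>\<bar>h\<bar>\<close>.\<close>
    have "((\<lambda>h::real. (max 0 h)\<^sup>2 / h) \<longlongrightarrow> 0) (at 0)"
    proof (rule Lim_null_comparison[of _ "\<lambda>h. \<bar>h\<bar>"])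
      show "\<forall>\<^sub>F h in at 0. norm ((max 0 h)\<^sup>2 / h) \<le> \<bar>h::real\<bar>"
        by (intro always_eventually allI) (auto simp: max_def power2_eq_square)
    qed (auto intro!: tendsto_eq_intros)
    then show ?thesis using True by (simp add: DERIV_def)
  qed
  have "((\<lambda>x. e\<^sup>2 - x \<bullet> x) has_derivative (\<lambda>h. - (2 * (h \<bullet> x)))) (at x)"
    by (auto intro!: derivative_eq_intros simp: inner_commute)
  from has_derivative_compose[OF this D[of "e\<^sup>2 - x \<bullet> x", unfolded has_field_derivative_def]]
  have "((\<lambda>x. (max 0 (e\<^sup>2 - x \<bullet> x))\<^sup>2) has_derivative (\<lambda>h. 2 * max 0 (e\<^sup>2 - x \<bullet> x) * (- (2 * (h \<bullet> x))))) (at x)"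
    by simp
  from has_derivative_mult_left[OF this, of "inverse (integral\<^sup>L lborel (bump e :: 'a \<Rightarrow> real))"]
  show ?thesis
    unfolding gderiv_def mollifier_def[abs_def] mollifier_grad_def bump_def[symmetric] divide_inverse
    by (simp add: algebra_simps)
qed

section \<open>Mollification\<close>

lemma bounded_continuous_compact_support:
  fixes k :: "'a::euclidean_space \<Rightarrow> 'b::real_normed_vector"
  assumes k: "continuous_on UNIV k" and e: "\<And>x. e \<le> norm x \<Longrightarrow> k x = 0"
  obtains B where "0 \<le> B" "\<And>x. norm (k x) \<le> B"
proof -
  have "bounded (k ` cball 0 e)"
    by (intro compact_imp_bounded compact_continuous_image continuous_on_subset[OF k]) auto
  then obtain B where "\<forall>y\<in>k ` cball 0 e. norm y \<le> B"
    unfolding bounded_iff by blast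
  then have B: "norm (k x) \<le> B" if "x \<in> cball 0 e" for x using that by blast
  have "norm (k x) \<le> max B 0" for x
    using B[of x] e[of x] by (cases "norm x \<le> e") auto
  then show ?thesis by (intro that[of "max B 0"]) auto
qed

lemma uniformly_continuous_compact_support:
  fixes k :: "'a::euclidean_space \<Rightarrow> 'b::real_normed_vector"
  assumes k: "continuous_on UNIV k" and e: "\<And>x. e \<le> norm x \<Longrightarrow> k x = 0"
  shows "uniformly_continuous_on UNIV k"
proof -
  have u: "uniformly_continuous_on (cball 0 (e + 1)) k"
    by (intro compact_uniformly_continuous continuous_on_subset[OF k]) auto
  show ?thesis
    unfolding uniformly_continuous_on_def
  proof (intro allI impI)
    fix r :: real assume r: "0 < r"
    obtain d where d: "d > 0" "\<And>x y. x \<in> cball 0 (e+1) \<Longrightarrow> y \<in> cball 0 (e+1) \<Longrightarrow> dist y x < d \<Longrightarrow> dist (k y) (k x) < r"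
      using u r unfolding uniformly_continuous_on_def by meson
    \<comment> \<open>The ball was enlarged by one and the points are closer than one: either both
      lie in it, or both have norm above \<open>e\<close>, where \<open>k\<close> vanishes.\<close>
    have "dist (k y) (k x) < r" if "dist y x < min d 1" for x y
    proof (cases "norm x \<le> e + 1 \<and> norm y \<le> e + 1")
      case True then show ?thesis using d that by auto
    next
      case False
      have "\<bar>norm y - norm x\<bar> < 1" using that norm_triangle_ineq3[of y x] by (simp add: dist_norm)
      then have "k x = 0" "k y = 0" using False e[of x] e[of y] by linarith+
      then show ?thesis using r by simp
    qed
    then show "\<exists>d>0. \<forall>x\<in>UNIV. \<forall>x'\<in>UNIV. dist x' x < d \<longrightarrow> dist (k x') (k x) < r"
      using d(1) by (intro exI[of _ "min d 1"]) auto
  qed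
qed

text \<open>The mollifier is even, so this is the usual convolution.\<close>

definition convol :: "real \<Rightarrow> ('a::euclidean_space \<Rightarrow> 'b::euclidean_space) \<Rightarrow> 'a \<Rightarrow> 'b" where
  "convol e f x = (LINT z|lborel. mollifier e z *\<^sub>R f (x + z))"

text \<open>The derivative falls on the kernel; the minus sign comes from differentiating
  \<open>mollifier e (y - x)\<close> in \<open>x\<close> rather than in \<open>y\<close>.\<close>

definition convol_grad :: "real \<Rightarrow> ('a::euclidean_space \<Rightarrow> real) \<Rightarrow> 'a \<Rightarrow> 'a" where
  "convol_grad e f x = (LINT y|lborel. - (f y *\<^sub>R mollifier_grad e (y - x)))"

lemma mollifier_bounded:
  assumes "0 < e"
  obtains B where "0 \<le> B" "\<And>x::'a::euclidean_space. norm (mollifier e x) \<le> B"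
  using assms by (rule_tac bounded_continuous_compact_support[of "mollifier e :: 'a \<Rightarrow> real" e])
    (auto intro: continuous_mollifier mollifier_eq_0)

lemma mollifier_grad_bounded:
  assumes "0 < e"
  obtains B where "0 \<le> B" "\<And>x::'a::euclidean_space. norm (mollifier_grad e x) \<le> B"
  using assms by (rule_tac bounded_continuous_compact_support[of "mollifier_grad e :: 'a \<Rightarrow> 'a" e])
    (auto intro: continuous_mollifier_grad mollifier_grad_eq_0)

lemma integrable_borel_measurable_borel: "integrable lborel f \<Longrightarrow> f \<in> borel_measurable borel"
  using borel_measurable_integrable[of lborel f] by simp

lemma integrable_bounded_scaleR:
  fixes f :: "'a \<Rightarrow> 'b::{banach, second_countable_topology}"
  assumes f: "integrable M f" and [measurable]: "k \<in> borel_measurable M" and B: "\<And>x. x \<in> space M \<Longrightarrow> \<bar>k x\<bar> \<le> B"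
  shows "integrable M (\<lambda>x. k x *\<^sub>R f x)"
proof (rule Bochner_Integration.integrable_bound)
  show "integrable M (\<lambda>x. B *\<^sub>R f x)" using f by simp
  show "AE x in M. norm (k x *\<^sub>R f x) \<le> norm (B *\<^sub>R f x)"
  proof (rule AE_I2)
    fix x assume "x \<in> space M"
    then have "\<bar>k x\<bar> * norm (f x) \<le> \<bar>B\<bar> * norm (f x)" using B[of x] by (intro mult_right_mono) auto
    then show "norm (k x *\<^sub>R f x) \<le> norm (B *\<^sub>R f x)" by simp
  qed
qed (use f in simp)

lemma convol_integrable:
  fixes f :: "'a::euclidean_space \<Rightarrow> 'b::euclidean_space"
  assumes f: "integrable lborel f" and e: "0 < e"
  shows "integrable lborel (\<lambda>z. mollifier e z *\<^sub>R f (x + z))"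
proof -
  obtain B where B: "\<And>x::'a. norm (mollifier e x) \<le> B" using mollifier_bounded[OF e] by blast
  have "integrable lborel (\<lambda>z. f (x + z))"
    using lborel_integrable_translate_iff[of f x] integrable_borel_measurable_borel[OF f] f
    by (simp add: add.commute)
  then show ?thesis using B by (intro integrable_bounded_scaleR[where B = B]) auto
qed

lemma convol_altdef:
  assumes [measurable]: "f \<in> borel_measurable borel"
  shows "convol e f x = (LINT y|lborel. mollifier e (y - x) *\<^sub>R f y)"
  using lborel_integral_translate[of "\<lambda>y. mollifier e (y - x) *\<^sub>R f y" x]
  by (simp add: convol_def add.commute)

text \<open>The error at \<open>x\<close> is the average of \<open>f (x + z) - f x\<close> with
  respect to the probability density \<open>mollifier e\<close>. Jensen's inequality for each
  \<open>x\<close> and Tonelli's theorem bound its p-th power integral by the largest one among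
  translations shorter than \<open>e\<close>, which is what \<open>r\<close> stands for.\<close>

lemma convol_Lp:
  fixes f :: "'a::euclidean_space \<Rightarrow> 'b::euclidean_space"
  assumes f: "integrable lborel f" and p: "1 \<le> p" and e: "0 < e" and r: "0 \<le> r"
    and fi: "\<And>z. integrable lborel (\<lambda>x. norm (f (x + z) - f x) powr p)"
    and le: "\<And>z. norm z < e \<Longrightarrow> (LINT x|lborel. norm (f (x + z) - f x) powr p) \<le> r"
  shows "integrable lborel (\<lambda>x. norm (convol e f x - f x) powr p)"
    and "(LINT x|lborel. norm (convol e f x - f x) powr p) \<le> r"
proof -
  note [measurable] = integrable_borel_measurable_borel[OF f]
  have [measurable]: "convol e f \<in> borel_measurable borel"
    unfolding convol_def[abs_def] by measurable
  have pw: "ennreal (norm (convol e f x - f x) powr p) \<le> (\<integral>\<^sup>+ z. ennreal (mollifier e z * norm (f (x + z) - f x) powr p) \<partial>lborel)" for x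
  proof -
    have i1: "integrable lborel (\<lambda>z. mollifier e z *\<^sub>R (f (x + z) - f x))"
      unfolding scaleR_diff_right
      by (intro Bochner_Integration.integrable_diff convol_integrable f e integrable_scaleR_left integrable_mollifier)
    then have i2: "integrable lborel (\<lambda>z. mollifier e z * norm (f (x + z) - f x))"
      using integrable_norm[OF i1] by (simp add: mollifier_nonneg[OF e])
    have "convol e f x - f x = (LINT z|lborel. mollifier e z *\<^sub>R (f (x + z) - f x))"
    proof -
      have k: "integrable lborel (mollifier e :: 'a \<Rightarrow> real)" by (rule integrable_mollifier[OF e])
      have "(LINT z|lborel. mollifier e (z::'a) *\<^sub>R f x) = f x"
        using integral_mollifier[OF e, where 'a='a] k by (subst integral_scaleR_left) auto
      then show ?thesis
        unfolding scaleR_diff_right convol_def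
        by (subst Bochner_Integration.integral_diff[OF convol_integrable[OF f e] integrable_scaleR_left[OF k]]) simp
    qed
    also have "norm \<dots> \<le> (LINT z|lborel. norm (mollifier e z *\<^sub>R (f (x + z) - f x)))"
      by (rule integral_norm_bound)
    also have "\<dots> = (LINT z|lborel. mollifier e z * norm (f (x + z) - f x))"
      by (simp add: mollifier_nonneg[OF e])
    finally have "norm (convol e f x - f x) powr p \<le> (LINT z|lborel. mollifier e z * norm (f (x + z) - f x)) powr p"
      using p by (intro powr_mono2) auto
    also have "ennreal \<dots> \<le> (\<integral>\<^sup>+ z. ennreal (mollifier e z * norm (f (x + z) - f x) powr p) \<partial>lborel)"
      by (rule jensen_powr_nn) (auto simp: mollifier_nonneg[OF e] integrable_mollifier[OF e] integral_mollifier[OF e] i2 p)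
    finally show ?thesis by (simp add: ennreal_leI)
  qed
  have "(\<integral>\<^sup>+ x. ennreal (norm (convol e f x - f x) powr p) \<partial>lborel)
    \<le> (\<integral>\<^sup>+ x. (\<integral>\<^sup>+ z. ennreal (mollifier e z * norm (f (x + z) - f x) powr p) \<partial>lborel) \<partial>lborel)"
    by (intro nn_integral_mono pw)
  also have "\<dots> = (\<integral>\<^sup>+ z. (\<integral>\<^sup>+ x. ennreal (mollifier e z * norm (f (x + z) - f x) powr p) \<partial>lborel) \<partial>lborel)"
    by (rule lborel_pair.Fubini') measurable
  also have "\<dots> \<le> (\<integral>\<^sup>+ z. ennreal (mollifier e z * r) \<partial>(lborel :: 'a measure))"
  proof (rule nn_integral_mono)
    fix z :: 'a
    have "(\<integral>\<^sup>+ x. ennreal (mollifier e z * norm (f (x + z) - f x) powr p) \<partial>lborel)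
      = ennreal (LINT x|lborel. mollifier e z * norm (f (x + z) - f x) powr p)"
      using fi[of z] by (intro nn_integral_eq_integral) (auto simp: mollifier_nonneg[OF e])
    also have "\<dots> = ennreal (mollifier e z * (LINT x|lborel. norm (f (x + z) - f x) powr p))"
      by simp
    also have "\<dots> \<le> ennreal (mollifier e z * r)"
    proof (cases "norm z < e")
      case True then show ?thesis using le[of z] mollifier_nonneg[OF e] by (intro ennreal_leI mult_left_mono) auto
    next
      case False then show ?thesis using mollifier_eq_0[OF e, of z] by simp
    qed
    finally show "(\<integral>\<^sup>+ x. ennreal (mollifier e z * norm (f (x + z) - f x) powr p) \<partial>lborel) \<le> ennreal (mollifier e z * r)" .
  qed
  also have "\<dots> = ennreal (LINT z|(lborel :: 'a measure). mollifier e z * r)"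
    using r integrable_mollifier[OF e, where 'a='a]
    by (intro nn_integral_eq_integral) (auto simp: mollifier_nonneg[OF e])
  also have "\<dots> = ennreal r"
    using integrable_mollifier[OF e, where 'a='a] integral_mollifier[OF e, where 'a='a] by simp
  finally have nn: "(\<integral>\<^sup>+ x. ennreal (norm (convol e f x - f x) powr p) \<partial>lborel) \<le> ennreal r" .
  show i: "integrable lborel (\<lambda>x. norm (convol e f x - f x) powr p)"
    using nn by (intro integrableI_nonneg) (auto simp: less_top[symmetric] top_unique)
  have "ennreal (LINT x|lborel. norm (convol e f x - f x) powr p) \<le> ennreal r"
    using nn i by (subst nn_integral_eq_integral[symmetric]) auto
  then show "(LINT x|lborel. norm (convol e f x - f x) powr p) \<le> r"
    using r by simp
qed

lemma convol_Lp_tendsto: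
  fixes f :: "'a::euclidean_space \<Rightarrow> 'b::euclidean_space"
  assumes f: "integrable lborel f" and fp: "integrable lborel (\<lambda>x. norm (f x) powr p)" and p: "1 \<le> p"
    and e: "\<And>n. 0 < e n" "e \<longlonglongrightarrow> 0"
  shows "integrable lborel (\<lambda>x. norm (convol (e n) f x - f x) powr p)"
    and "(\<lambda>n. LINT x|lborel. norm (convol (e n) f x - f x) powr p) \<longlonglongrightarrow> 0"
proof -
  note [measurable] = integrable_borel_measurable_borel[OF f]
  have fd: "integrable lborel (\<lambda>x. norm (f (x + c) - f x) powr p)" for c
  proof (rule Bochner_Integration.integrable_bound)
    have "integrable lborel (\<lambda>x. norm (f (x + c)) powr p)"
      using lborel_integrable_translate_iff[of "\<lambda>x. norm (f x) powr p" c] fp by simp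
    then show "integrable lborel (\<lambda>x. 2 powr p * (norm (f (x + c)) powr p + norm (f x) powr p))"
      using fp by simp
    show "AE x in lborel. norm (norm (f (x + c) - f x) powr p) \<le> norm (2 powr p * (norm (f (x + c)) powr p + norm (f x) powr p))"
      using norm_diff_powr_le[of p] p by (intro AE_I2) (auto simp: abs_mult)
  qed auto
  define T where "T z = (LINT x|lborel. norm (f (x + z) - f x) powr p)" for z
  have T0: "0 \<le> T z" for z unfolding T_def by (intro integral_nonneg_AE) auto
  have Tlim: "(T \<longlongrightarrow> 0) (at 0)"
    unfolding tendsto_at_iff_sequentially comp_def T_def
    using translate_Lp[OF f fp p] by auto
  have T00: "T 0 = 0" by (simp add: T_def)
  have key: "\<exists>d>0. \<forall>z. norm z < d \<longrightarrow> T z \<le> r" if r: "0 < r" for r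
  proof -
    have "\<forall>\<^sub>F z in at 0. dist (T z) 0 < r" using tendstoD[OF Tlim r] .
    then obtain d where d: "d > 0" "\<And>z. z \<noteq> 0 \<Longrightarrow> dist z 0 < d \<Longrightarrow> dist (T z) 0 < r"
      by (auto simp: eventually_at)
    have "T z \<le> r" if "norm z < d" for z
      using d(2)[of z] that T00 r by (cases "z = 0") auto
    then show ?thesis using d(1) by auto
  qed
  \<comment> \<open>A bound valid for all translations, small or not: it yields integrability of the
    mollification error for every \<open>n\<close>, not only for large ones.\<close>
  have Tb: "T z \<le> 2 powr p * (2 * (LINT x|lborel. norm (f x) powr p))" for z
  proof -
    have "integrable lborel (\<lambda>x. norm (f (x + z)) powr p)"
      using lborel_integrable_translate_iff[of "\<lambda>x. norm (f x) powr p" z] fp by simp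
    then have "T z \<le> 2 powr p * ((LINT x|lborel. norm (f (x + z)) powr p) + (LINT x|lborel. norm (f x) powr p))"
      unfolding T_def using fp fd[of z] p norm_diff_powr_le[of p]
      by (subst Bochner_Integration.integral_add[symmetric], simp, simp,
          subst Bochner_Integration.integral_mult_right_zero[symmetric], intro integral_mono) auto
    also have "(LINT x|lborel. norm (f (x + z)) powr p) = (LINT x|lborel. norm (f x) powr p)"
      by (rule lborel_integral_translate[of "\<lambda>x. norm (f x) powr p"]) auto
    finally show ?thesis by simp
  qed
  show "integrable lborel (\<lambda>x. norm (convol (e n) f x - f x) powr p)"
    by (rule convol_Lp(1)[OF f p e(1) order_trans[OF T0 Tb] fd]) (use Tb in \<open>auto simp: T_def\<close>)
  show "(\<lambda>n. LINT x|lborel. norm (convol (e n) f x - f x) powr p) \<longlonglongrightarrow> 0"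
  proof (rule LIMSEQ_I)
    fix r :: real assume r: "0 < r"
    obtain d where d: "d > 0" "\<And>z. norm z < d \<Longrightarrow> T z \<le> r / 2" using key[of "r/2"] r by auto
    obtain n0 where n0: "\<And>n. n \<ge> n0 \<Longrightarrow> norm (e n - 0) < d" using LIMSEQ_D[OF e(2) d(1)] by auto
    show "\<exists>no. \<forall>n\<ge>no. norm ((LINT x|lborel. norm (convol (e n) f x - f x) powr p) - 0) < r"
    proof (intro exI allI impI)
      fix n assume "n \<ge> n0"
      then have "e n < d" using n0[of n] e(1)[of n] by simp
      then have "(LINT x|lborel. norm (convol (e n) f x - f x) powr p) \<le> r / 2"
        using r d(2) by (intro convol_Lp(2)[OF f p e(1) _ fd]) (auto simp: T_def)
      then show "norm ((LINT x|lborel. norm (convol (e n) f x - f x) powr p) - 0) < r"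
        using r by (simp add: integral_nonneg_AE)
    qed
  qed
qed

lemma convol_eq_0:
  assumes e: "0 < e" and f: "\<And>y. dist y x < e \<Longrightarrow> f y = 0"
  shows "convol e f x = 0"
proof -
  have "mollifier e z *\<^sub>R f (x + z) = 0" for z
    using f[of "x + z"] mollifier_eq_0[OF e, of z] by (cases "norm z < e") (auto simp: dist_norm)
  then show ?thesis by (simp only: convol_def Bochner_Integration.integral_zero)
qed

text \<open>The mean value inequality on \<open>ball a d\<close> for
  \<open>k x - x \<bullet> kg a\<close>, whose gradient \<open>kg x - kg a\<close> has norm below
  \<open>r\<close> there. Uniform continuity makes \<open>d\<close> independent of \<open>a\<close>,
  so the estimate can be integrated over \<open>a\<close>.\<close>

lemma GDERIV_linearization:
  fixes k :: "'a::euclidean_space \<Rightarrow> real"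
  assumes k: "\<And>x. GDERIV k x :> kg x" and u: "uniformly_continuous_on UNIV kg" and r: "0 < r"
  obtains d where "0 < d" "\<And>a h. norm h < d \<Longrightarrow> \<bar>k (a + h) - k a - h \<bullet> kg a\<bar> \<le> r * norm h"
proof -
  obtain d where d: "d > 0" and d': "\<forall>x\<in>UNIV. \<forall>y\<in>UNIV. dist y x < d \<longrightarrow> dist (kg y) (kg x) < r"
    using u[unfolded uniformly_continuous_on_def] r by blast
  have "\<bar>k (a + h) - k a - h \<bullet> kg a\<bar> \<le> r * norm h" if h: "norm h < d" for a h
  proof -
    have D: "((\<lambda>x. k x - x \<bullet> kg a) has_derivative (\<lambda>v. v \<bullet> (kg x - kg a))) (at x within ball a d)" for x
    proof -
      have "((\<lambda>x. k x - x \<bullet> kg a) has_derivative (\<lambda>v. v \<bullet> kg x - v \<bullet> kg a)) (at x)"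
        by (intro has_derivative_diff k[unfolded gderiv_def] bounded_linear_imp_has_derivative bounded_linear_inner_left)
      then show ?thesis by (auto simp: inner_diff_right intro: has_derivative_at_withinI)
    qed
    have on: "onorm (\<lambda>v. v \<bullet> (kg x - kg a)) \<le> r" if "x \<in> ball a d" for x
    proof (rule onorm_le)
      fix v :: 'a
      have "norm (v \<bullet> (kg x - kg a)) \<le> norm v * norm (kg x - kg a)" by (simp add: Cauchy_Schwarz_ineq2)
      also have "\<dots> \<le> norm v * r"
        using d'[rule_format, of a x] that by (intro mult_left_mono) (auto simp: dist_norm norm_minus_commute)
      finally show "norm (v \<bullet> (kg x - kg a)) \<le> r * norm v" by (simp add: mult.commute)
    qed
    have "norm ((k (a + h) - (a + h) \<bullet> kg a) - (k a - a \<bullet> kg a)) \<le> r * norm ((a + h) - a)"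
      by (rule differentiable_bound[OF convex_ball D on]) (use h d in \<open>auto simp: dist_norm\<close>)
    then show ?thesis by (simp add: inner_add_left algebra_simps)
  qed
  with d show ?thesis by (rule that)
qed

lemma convol_grad_integrable:
  assumes f: "integrable lborel f" and e: "0 < e"
  shows "integrable lborel (\<lambda>y. f y *\<^sub>R mollifier_grad e (y - x))"
proof -
  note [measurable] = integrable_borel_measurable_borel[OF f]
  obtain B where B: "0 \<le> B" "\<And>x::'a. norm (mollifier_grad e x) \<le> B" using mollifier_grad_bounded[OF e] by blast
  show ?thesis
  proof (rule Bochner_Integration.integrable_bound)
    show "integrable lborel (\<lambda>x. B * norm (f x))" using f by simp
    show "AE y in lborel. norm (f y *\<^sub>R mollifier_grad e (y - x)) \<le> norm (B * norm (f y))"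
      using B by (intro AE_I2) (auto simp: mult.commute[of B] mult_left_mono abs_mult)
  qed measurable
qed

text \<open>The linearization error of the kernel is at most \<open>r' * norm (y - x)\<close>
  uniformly in the integration variable, so after multiplication by \<open>f\<close> it integrates
  to at most \<open>r' * I * norm (y - x)\<close>.\<close>

lemma GDERIV_convol:
  assumes f: "integrable lborel f" and e: "0 < e"
  shows "GDERIV (convol e f) x :> convol_grad e f x"
proof -
  note [measurable] = integrable_borel_measurable_borel[OF f]
  have i1: "integrable lborel (\<lambda>y. mollifier e (y - x) * f y)" for x
  proof -
    obtain B where "\<And>x::'a. norm (mollifier e x) \<le> B" using mollifier_bounded[OF e] by blast
    then show ?thesis using integrable_bounded_scaleR[OF f, of "\<lambda>y. mollifier e (y - x)" B] by simp
  qed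
  have u: "uniformly_continuous_on UNIV (mollifier_grad e :: 'a \<Rightarrow> 'a)"
    using e by (intro uniformly_continuous_compact_support[of _ e] continuous_mollifier_grad mollifier_grad_eq_0)
  define I where "I = (LINT y|lborel. \<bar>f y\<bar>)"
  have I0: "0 \<le> I" unfolding I_def by (intro integral_nonneg_AE) auto
  have cg: "h \<bullet> convol_grad e f x = (LINT y|lborel. - (f y * (h \<bullet> mollifier_grad e (y - x))))" for h
    unfolding convol_grad_def
    using convol_grad_integrable[OF f e, of x] by (subst integral_inner_right[symmetric]) auto
  have ig: "integrable lborel (\<lambda>y. f y * (h \<bullet> mollifier_grad e (y - x)))" for h
    using integrable_inner_right[OF convol_grad_integrable[OF f e, of x], of h] by (auto simp: inner_commute)
  show ?thesis
    unfolding gderiv_def has_derivative_at_alt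
  proof (intro conjI allI impI)
    show "bounded_linear (\<lambda>h. h \<bullet> convol_grad e f x)" by (rule bounded_linear_inner_left)
    fix r :: real assume r: "0 < r"
    \<comment> \<open>Dividing by \<open>I + 1\<close> gives \<open>r' * I \<le> r\<close> also when
      \<open>I = 0\<close>.\<close>
    define r' where "r' = r / (I + 1)"
    have r': "0 < r'" using r I0 by (auto simp: r'_def)
    obtain d where d: "0 < d" "\<And>a h. norm h < d \<Longrightarrow> \<bar>mollifier e (a + h) - mollifier e a - h \<bullet> mollifier_grad e (a::'a)\<bar> \<le> r' * norm h"
      using GDERIV_linearization[OF GDERIV_mollifier u r'] by blast
    have "norm (convol e f y - convol e f x - (y - x) \<bullet> convol_grad e f x) \<le> r * norm (y - x)" if y: "norm (y - x) < d" for y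
    proof -
      define R where "R t = f t * (mollifier e ((t - x) + (x - y)) - mollifier e (t - x) - (x - y) \<bullet> mollifier_grad e (t - x))" for t
      have R_eq: "R = (\<lambda>t. mollifier e (t - y) * f t - mollifier e (t - x) * f t - - (f t * ((y - x) \<bullet> mollifier_grad e (t - x))))"
        by (auto simp: R_def algebra_simps inner_diff_left)
      have iR: "integrable lborel R"
        unfolding R_eq by (intro Bochner_Integration.integrable_diff Bochner_Integration.integrable_minus i1 ig)
      have "convol e f y - convol e f x - (y - x) \<bullet> convol_grad e f x = integral\<^sup>L lborel R"
        unfolding cg R_eq using i1 ig by (simp add: convol_altdef)
      then have "norm (convol e f y - convol e f x - (y - x) \<bullet> convol_grad e f x) \<le> (LINT t|lborel. norm (R t))"
        using integral_norm_bound[of lborel R] by simp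
      also have "\<dots> \<le> (LINT t|lborel. r' * norm (y - x) * \<bar>f t\<bar>)"
      proof (rule integral_mono)
        show "integrable lborel (\<lambda>t. norm (R t))" using iR by simp
        show "integrable lborel (\<lambda>t. r' * norm (y - x) * \<bar>f t\<bar>)" using f by simp
        fix t
        have "\<bar>f t\<bar> * \<bar>mollifier e ((t - x) + (x - y)) - mollifier e (t - x) - (x - y) \<bullet> mollifier_grad e (t - x)\<bar> \<le> \<bar>f t\<bar> * (r' * norm (x - y))"
          using y by (intro mult_left_mono d(2)) (auto simp: norm_minus_commute)
        then show "norm (R t) \<le> r' * norm (y - x) * \<bar>f t\<bar>"
          by (simp add: R_def abs_mult norm_minus_commute mult.commute)
      qed
      also have "\<dots> = r' * norm (y - x) * I" by (simp add: I_def)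
      also have "\<dots> = (r' * I) * norm (y - x)" by simp
      also have "\<dots> \<le> r * norm (y - x)"
        using r I0 by (intro mult_right_mono) (auto simp: r'_def field_simps)
      finally show ?thesis .
    qed
    then show "\<exists>d>0. \<forall>y. norm (y - x) < d \<longrightarrow> norm (convol e f y - convol e f x - (y - x) \<bullet> convol_grad e f x) \<le> r * norm (y - x)"
      using d(1) by blast
  qed
qed

lemma continuous_convol_grad:
  assumes f: "integrable lborel f" and e: "0 < e"
  shows "continuous_on S (convol_grad e f)"
proof -
  note [measurable] = integrable_borel_measurable_borel[OF f]
  obtain B where B: "0 \<le> B" "\<And>x::'a. norm (mollifier_grad e x) \<le> B" using mollifier_grad_bounded[OF e] by blast
  have "continuous_on UNIV (convol_grad e f)"
    unfolding continuous_on_sequentially comp_def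
  proof (intro ballI allI impI)
    fix x :: "nat \<Rightarrow> 'a" and a assume "(\<forall>n. x n \<in> UNIV) \<and> x \<longlonglongrightarrow> a"
    then have x: "x \<longlonglongrightarrow> a" by simp
    show "(\<lambda>n. convol_grad e f (x n)) \<longlonglongrightarrow> convol_grad e f a"
      unfolding convol_grad_def
    proof (rule integral_dominated_convergence[where w = "\<lambda>y. B * norm (f y)"])
      show "AE y in lborel. (\<lambda>n. - (f y *\<^sub>R mollifier_grad e (y - x n))) \<longlonglongrightarrow> - (f y *\<^sub>R mollifier_grad e (y - a))"
        by (intro AE_I2 tendsto_intros x continuous_on_tendsto_compose[OF continuous_mollifier_grad[of UNIV]]) auto
      show "AE y in lborel. norm (- (f y *\<^sub>R mollifier_grad e (y - x n))) \<le> B * norm (f y)" for n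
        using B by (intro AE_I2) (auto simp: mult.commute[of B] mult_left_mono)
    qed (use f in auto)
  qed
  then show ?thesis by (rule continuous_on_subset) simp
qed

section \<open>Weak gradients\<close>

lemma AE_lebesgue_on_iff:
  "S \<in> sets lebesgue \<Longrightarrow> (AE x in lebesgue_on S. P x) \<longleftrightarrow> (AE x in lborel. x \<in> S \<longrightarrow> P x)"
  by (simp add: AE_restrict_space_iff AE_completion_iff)

lemma integrable_lebesgue_on_iff:
  fixes f :: "'a::euclidean_space \<Rightarrow> 'b::euclidean_space"
  shows "S \<in> sets lebesgue \<Longrightarrow> integrable (lebesgue_on S) f \<longleftrightarrow> integrable lebesgue (\<lambda>x. indicator S x *\<^sub>R f x)"
  by (simp add: integrable_restrict_space)

lemma integral_lebesgue_on_eq: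
  fixes f :: "'a::euclidean_space \<Rightarrow> 'b::euclidean_space"
  shows "S \<in> sets lebesgue \<Longrightarrow> integral\<^sup>L (lebesgue_on S) f = integral\<^sup>L lebesgue (\<lambda>x. indicator S x *\<^sub>R f x)"
  by (simp add: integral_restrict_space)

lemma borel_measurable_lebesgue_on_cong_AE:
  fixes f g :: "'a::euclidean_space \<Rightarrow> 'b::euclidean_space"
  assumes S: "S \<in> sets lebesgue" and f: "f \<in> borel_measurable (lebesgue_on S)"
    and ae: "AE x in lebesgue_on S. f x = g x"
  shows "g \<in> borel_measurable (lebesgue_on S)"
proof -
  have "(\<lambda>x. indicator S x *\<^sub>R f x) \<in> borel_measurable lebesgue"
    using f S by (simp add: borel_measurable_restrict_space_iff)
  moreover have "AE x in lebesgue. indicator S x *\<^sub>R f x = indicator S x *\<^sub>R g x"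
    using ae S by (auto simp: AE_lebesgue_on_iff AE_completion_iff indicator_def elim!: eventually_mono)
  ultimately have "(\<lambda>x. indicator S x *\<^sub>R g x) \<in> borel_measurable lebesgue"
    by (rule borel_measurable_AE)
  then show ?thesis using S by (simp add: borel_measurable_restrict_space_iff)
qed

lemma integrable_lebesgue_on_cong_AE:
  fixes f g :: "'a::euclidean_space \<Rightarrow> 'b::euclidean_space"
  assumes S: "S \<in> sets lebesgue" and f: "integrable (lebesgue_on S) f"
    and ae: "AE x in lebesgue_on S. f x = g x"
  shows "integrable (lebesgue_on S) g"
  using integrable_cong_AE_imp[OF f borel_measurable_lebesgue_on_cong_AE[OF S _ ae]] f ae
  by (auto elim: eventually_mono)

text \<open>Lebesgue measure is complete, so measurability passes across almost everywhere equality.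
  If one function is not measurable, neither is the other, and both integrals have the default value
  0.\<close>

lemma integral_lebesgue_on_cong_AE:
  fixes f g :: "'a::euclidean_space \<Rightarrow> 'b::euclidean_space"
  assumes S: "S \<in> sets lebesgue" and ae: "AE x in lebesgue_on S. f x = g x"
  shows "integral\<^sup>L (lebesgue_on S) f = integral\<^sup>L (lebesgue_on S) g"
proof (cases "f \<in> borel_measurable (lebesgue_on S)")
  case True
  then show ?thesis
    using borel_measurable_lebesgue_on_cong_AE[OF S True ae] ae by (intro integral_cong_AE) auto
next
  case False
  have "AE x in lebesgue_on S. g x = f x" using ae by (auto elim: eventually_mono)
  then have "g \<notin> borel_measurable (lebesgue_on S)"
    using borel_measurable_lebesgue_on_cong_AE[OF S _ ] False by blast
  then show ?thesis
    using False by (metis borel_measurable_integrable not_integrable_integral_eq)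
qed

lemma AE_lebesgue_on_subset:
  assumes "S \<in> sets lebesgue" "T \<in> sets lebesgue" "T \<subseteq> S" "AE x in lebesgue_on S. P x"
  shows "AE x in lebesgue_on T. P x"
  using assms by (auto simp: AE_lebesgue_on_iff elim!: eventually_mono)

lemma integrable_lebesgue_on_subset:
  fixes f :: "'a::euclidean_space \<Rightarrow> 'b::euclidean_space"
  assumes "integrable (lebesgue_on S) f" "S \<in> sets lebesgue" "T \<in> sets lebesgue" "T \<subseteq> S"
  shows "integrable (lebesgue_on T) f"
proof -
  have "integrable lebesgue (\<lambda>x. indicator T x *\<^sub>R (indicator S x *\<^sub>R f x))"
    using assms by (intro integrable_mult_indicator[OF assms(3)]) (simp only: integrable_lebesgue_on_iff)
  also have "(\<lambda>x. indicator T x *\<^sub>R (indicator S x *\<^sub>R f x)) = (\<lambda>x. indicator T x *\<^sub>R f x)"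
    using assms(4) by (auto simp: indicator_def fun_eq_iff)
  finally show ?thesis using assms by (simp add: integrable_lebesgue_on_iff)
qed

lemma integral_lebesgue_on_vanish:
  fixes f :: "'a::euclidean_space \<Rightarrow> 'b::euclidean_space"
  assumes "S \<in> sets lebesgue" "\<And>x. x \<notin> S \<Longrightarrow> f x = 0"
  shows "integral\<^sup>L (lebesgue_on S) f = integral\<^sup>L lebesgue f"
proof -
  have "(\<lambda>x. indicator S x *\<^sub>R f x) = f" using assms(2) by (auto simp: indicator_def fun_eq_iff)
  then show ?thesis using integral_lebesgue_on_eq[OF assms(1), of f] by simp
qed

lemma integrable_lebesgue_on_vanish:
  fixes f :: "'a::euclidean_space \<Rightarrow> 'b::euclidean_space"
  assumes "S \<in> sets lebesgue" "\<And>x. x \<notin> S \<Longrightarrow> f x = 0"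
  shows "integrable (lebesgue_on S) f \<longleftrightarrow> integrable lebesgue f"
proof -
  have "(\<lambda>x. indicator S x *\<^sub>R f x) = f" using assms(2) by (auto simp: indicator_def fun_eq_iff)
  then show ?thesis using integrable_lebesgue_on_iff[OF assms(1), of f] by simp
qed

lemma integral_lebesgue_on_subset_vanish:
  fixes f :: "'a::euclidean_space \<Rightarrow> 'b::euclidean_space"
  assumes "S \<in> sets lebesgue" "T \<in> sets lebesgue" "T \<subseteq> S" "\<And>x. x \<in> S \<Longrightarrow> x \<notin> T \<Longrightarrow> f x = 0"
  shows "integral\<^sup>L (lebesgue_on S) f = integral\<^sup>L (lebesgue_on T) f"
proof -
  have "(\<lambda>x. indicator S x *\<^sub>R f x) = (\<lambda>x. indicator T x *\<^sub>R f x)"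
    using assms(3,4) by (auto simp: indicator_def fun_eq_iff)
  then show ?thesis by (simp only: integral_lebesgue_on_eq[OF assms(1)] integral_lebesgue_on_eq[OF assms(2)])
qed

lemma integrable_lebesgue_on_subset_vanish:
  fixes f :: "'a::euclidean_space \<Rightarrow> 'b::euclidean_space"
  assumes "S \<in> sets lebesgue" "T \<in> sets lebesgue" "T \<subseteq> S" "\<And>x. x \<in> S \<Longrightarrow> x \<notin> T \<Longrightarrow> f x = 0"
  shows "integrable (lebesgue_on S) f \<longleftrightarrow> integrable (lebesgue_on T) f"
proof -
  have "(\<lambda>x. indicator S x *\<^sub>R f x) = (\<lambda>x. indicator T x *\<^sub>R f x)"
    using assms(3,4) by (auto simp: indicator_def fun_eq_iff)
  then show ?thesis by (simp only: integrable_lebesgue_on_iff[OF assms(1)] integrable_lebesgue_on_iff[OF assms(2)])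
qed

lemma compact_sets_lebesgue [simp]: "compact (S :: 'a::euclidean_space set) \<Longrightarrow> S \<in> sets lebesgue"
  by (simp add: lmeasurable_compact fmeasurableD)

lemma open_sets_lebesgue [simp]: "open (S :: 'a::euclidean_space set) \<Longrightarrow> S \<in> sets lebesgue"
  by auto

lemma borel_measurable_lebesgue_on_continuous:
  fixes f :: "'a::euclidean_space \<Rightarrow> 'b::euclidean_space"
  assumes "continuous_on UNIV f"
  shows "f \<in> borel_measurable (lebesgue_on S)"
proof -
  have "f \<in> borel_measurable lborel" using assms borel_measurable_continuous_onI by auto
  then have "f \<in> borel_measurable lebesgue" by (rule measurable_completion)
  then show ?thesis by (rule measurable_restrict_space1)
qed

section \<open>Gradients and test functions\<close>

lemma GDERIV_unique:
  assumes "GDERIV f x :> D" "GDERIV f x :> E"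
  shows "D = E"
proof -
  have "(\<lambda>h. h \<bullet> D) = (\<lambda>h. h \<bullet> E)"
    using assms has_derivative_unique unfolding gderiv_def by blast
  then have "\<forall>h. h \<bullet> D = h \<bullet> E" by meson
  then show ?thesis by (simp add: vector_eq_ldot)
qed

lemma GDERIV_cong_open:
  assumes "GDERIV f x :> D" "open S" "x \<in> S" "\<And>y. y \<in> S \<Longrightarrow> f y = g y"
  shows "GDERIV g x :> D"
  using assms unfolding gderiv_def by (auto intro: has_derivative_transform_within_open)

lemma GDERIV_zero: "GDERIV (\<lambda>x. 0) x :> 0"
  unfolding gderiv_def by simp

lemma GDERIV_continuous_on:
  assumes "\<And>x. GDERIV f x :> D x"
  shows "continuous_on S f"
  using assms unfolding gderiv_def
  by (meson continuous_at_imp_continuous_on has_derivative_continuous)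

text \<open>The definition of a weak gradient ranges over every \<open>D\<close> that is a gradient
  of \<open>v\<close>. By uniqueness \<open>D\<close> is the continuous one, and it vanishes off the
  closed support because \<open>v\<close> is locally zero there.\<close>

lemma C1_compact_supportE:
  fixes v :: "'a::euclidean_space \<Rightarrow> real"
  assumes v: "v \<in> C1_compact_support Om" and D: "\<And>x. GDERIV v x :> D x"
  obtains K where "continuous_on UNIV D" "continuous_on UNIV v" "compact K" "K \<subseteq> Om"
    "\<And>x. x \<notin> K \<Longrightarrow> v x = 0" "\<And>x. x \<notin> K \<Longrightarrow> D x = 0"
proof -
  obtain E where E: "continuous_on UNIV E" "\<And>x. GDERIV v x :> E x"
    using v by (auto simp: C1_compact_support_def)
  have "D = E" using GDERIV_unique[OF D E(2)] by auto
  then have cD: "continuous_on UNIV D" using E by simp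
  define K where "K = closure {x. v x \<noteq> 0}"
  have K: "compact K" "K \<subseteq> Om" using v by (auto simp: C1_compact_support_def K_def)
  have v0: "v x = 0" if "x \<notin> K" for x using that closure_subset[of "{x. v x \<noteq> 0}"] by (auto simp: K_def)
  have D0: "D x = 0" if "x \<notin> K" for x
  proof -
    have "GDERIV v x :> 0"
      by (rule GDERIV_cong_open[OF GDERIV_zero, of "- K"]) (use v0 that K(1) in \<open>auto simp: compact_imp_closed\<close>)
    then show ?thesis using GDERIV_unique[OF D] by blast
  qed
  show ?thesis
    by (rule that[OF cD GDERIV_continuous_on[OF D] K]) (use v0 D0 in auto)
qed

lemma C1_compact_supportI:
  fixes v :: "'a::euclidean_space \<Rightarrow> real"
  assumes D: "\<And>x. GDERIV v x :> D x" "continuous_on UNIV D"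
    and K: "compact K" "K \<subseteq> Om" "\<And>x. x \<notin> K \<Longrightarrow> v x = 0"
  shows "v \<in> C1_compact_support Om"
proof -
  have sub: "closure {x. v x \<noteq> 0} \<subseteq> K"
    using K by (intro closure_minimal compact_imp_closed) auto
  have "compact (K \<inter> closure {x. v x \<noteq> 0})"
    using K(1) closed_closure by (rule compact_Int_closed)
  then have "compact (closure {x. v x \<noteq> 0})"
    using sub by (simp add: inf.absorb2)
  then show ?thesis
    using D K sub unfolding C1_compact_support_def by blast
qed

lemma bounded_vanish_norm:
  assumes "bounded K" "\<And>x. x \<notin> K \<Longrightarrow> f x = 0"
  obtains e where "0 < e" "\<And>x. e \<le> norm x \<Longrightarrow> f x = 0"
proof -
  obtain e where e: "e > 0" "\<And>x. x \<in> K \<Longrightarrow> norm x \<le> e" using assms(1) by (auto simp: bounded_pos)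
  show ?thesis by (rule that[of "e + 1"]) (use e assms(2) in force)+
qed

text \<open>Translating \<open>v\<close> by \<open>t *\<^sub>R i\<close> does not change its
  integral, so \<open>t\<close> times the integral of \<open>D x \<bullet> i\<close> equals minus
  the integral of the linearization error. That error is at most \<open>r * t * norm i\<close> and
  lives on a fixed ball; divide by \<open>t\<close> and let \<open>r\<close> tend to 0.\<close>

lemma integral_gradient_compact_support:
  fixes v :: "'a::euclidean_space \<Rightarrow> real"
  assumes v: "v \<in> C1_compact_support Om" and D: "\<And>x. GDERIV v x :> D x"
  shows "(LINT x|lborel. D x \<bullet> i) = 0"
proof -
  obtain K where K: "continuous_on UNIV D" "continuous_on UNIV v" "compact K"
    "\<And>x. x \<notin> K \<Longrightarrow> v x = 0" "\<And>x. x \<notin> K \<Longrightarrow> D x = 0"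
    using C1_compact_supportE[OF v D] by metis
  obtain e where e: "0 < e" "\<And>x. e \<le> norm x \<Longrightarrow> (v x, D x) = 0"
    using bounded_vanish_norm[OF compact_imp_bounded[OF K(3)], of "\<lambda>x. (v x, D x)"] K(4,5) by (auto simp: zero_prod_def)
  have e0: "v x = 0" "D x = 0" if "e \<le> norm x" for x using e(2)[OF that] by (auto simp: zero_prod_def)
  have u: "uniformly_continuous_on UNIV D"
    by (rule uniformly_continuous_compact_support[OF K(1) e0(2)])
  have iv: "integrable lborel v" by (rule integrable_continuous_compact_support[OF K(2) e0(1)])
  have iD: "integrable lborel D" by (rule integrable_continuous_compact_support[OF K(1) e0(2)])
  note [measurable] = integrable_borel_measurable_borel[OF iv] integrable_borel_measurable_borel[OF iD]
  define V where "V = measure lborel (cball (0::'a) (e + 1))"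
  have V: "0 \<le> V" by (simp add: V_def)
  let ?I = "LINT x|lborel. D x \<bullet> i"
  have le: "\<bar>?I\<bar> \<le> r * (norm i * V)" if r: "0 < r" for r
  proof -
    obtain d where d: "0 < d" "\<And>a h. norm h < d \<Longrightarrow> \<bar>v (a + h) - v a - h \<bullet> D a\<bar> \<le> r * norm h"
      using GDERIV_linearization[OF D u r] by blast
    \<comment> \<open>Makes \<open>t *\<^sub>R i\<close> shorter than both \<open>d\<close> and 1,
      so that the linearization applies and the error vanishes off the ball of radius
      \<open>e + 1\<close>. The \<open>+ 1\<close> in the denominator covers
      \<open>i = 0\<close>.\<close>
    define t where "t = min d 1 / (2 * (norm i + 1))"
    have t: "0 < t" unfolding t_def using d(1) by (intro divide_pos_pos add_nonneg_pos) (auto simp: add_nonneg_pos)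
    have ti: "norm (t *\<^sub>R i) < min d 1"
    proof -
      have "norm (t *\<^sub>R i) = min d 1 * (norm i / (2 * (norm i + 1)))" using t d(1) by (simp add: t_def)
      also have "\<dots> < min d 1 * 1" using d(1) by (intro mult_strict_left_mono) (auto simp: divide_simps add_nonneg_pos)
      finally show ?thesis by simp
    qed
    have iDi: "integrable lborel (\<lambda>x. (t *\<^sub>R i) \<bullet> D x)" using iD by simp
    have ivt: "integrable lborel (\<lambda>x. v (x + t *\<^sub>R i))"
      using iv by (subst lborel_integrable_translate_iff) auto
    have "(LINT x|lborel. v (x + t *\<^sub>R i) - v x - (t *\<^sub>R i) \<bullet> D x) = (LINT x|lborel. v (x + t *\<^sub>R i)) - (LINT x|lborel. v x) - (LINT x|lborel. (t *\<^sub>R i) \<bullet> D x)"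
      using iDi ivt iv by simp
    also have "(LINT x|lborel. v (x + t *\<^sub>R i)) = (LINT x|lborel. v x)"
      by (rule lborel_integral_translate) auto
    also have "(LINT x|lborel. (t *\<^sub>R i) \<bullet> D x) = t * ?I"
      using iD by (simp add: inner_commute)
    finally have eq: "t * ?I = - (LINT x|lborel. v (x + t *\<^sub>R i) - v x - (t *\<^sub>R i) \<bullet> D x)" by simp
    have "t * \<bar>?I\<bar> = norm (LINT x|lborel. v (x + t *\<^sub>R i) - v x - (t *\<^sub>R i) \<bullet> D x)"
      using arg_cong[OF eq, of abs] t by (simp add: abs_mult)
    also have "\<dots> \<le> (LINT x|lborel. norm (v (x + t *\<^sub>R i) - v x - (t *\<^sub>R i) \<bullet> D x))"
      by (rule integral_norm_bound)
    also have "\<dots> \<le> (LINT x|lborel. (r * norm (t *\<^sub>R i)) * indicator (cball (0::'a) (e + 1)) x)"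
    proof (rule integral_mono)
      show "integrable lborel (\<lambda>x. norm (v (x + t *\<^sub>R i) - v x - (t *\<^sub>R i) \<bullet> D x))"
        using iDi ivt iv by (intro integrable_norm Bochner_Integration.integrable_diff)
      show "integrable lborel (\<lambda>x. (r * norm (t *\<^sub>R i)) * indicator (cball (0::'a) (e + 1)) x)"
        using emeasure_bounded_finite[of "cball (0::'a) (e + 1)"]
        by (intro integrable_mult_right integrable_real_indicator) auto
      fix x
      show "norm (v (x + t *\<^sub>R i) - v x - (t *\<^sub>R i) \<bullet> D x) \<le> (r * norm (t *\<^sub>R i)) * indicator (cball (0::'a) (e + 1)) x"
      proof (cases "norm x \<le> e + 1")
        case True then show ?thesis using d(2)[of "t *\<^sub>R i" x] ti by simp
      next
        case False
        have "norm x \<le> norm (x + t *\<^sub>R i) + norm (t *\<^sub>R i)"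
          using norm_triangle_ineq4[of "x + t *\<^sub>R i" "t *\<^sub>R i"] by simp
        then have "e \<le> norm (x + t *\<^sub>R i)" "e \<le> norm x" using False ti by linarith+
        then show ?thesis using e0 False by simp
      qed
    qed
    also have "\<dots> = t * (r * (norm i * V))"
      using t by (simp add: V_def)
    finally show ?thesis using t by simp
  qed
  have "\<bar>?I\<bar> \<le> 0"
  proof (rule field_le_epsilon)
    fix s :: real assume s: "0 < s"
    have nV: "0 \<le> norm i * V" using V by simp
    have "\<bar>?I\<bar> \<le> s / (norm i * V + 1) * (norm i * V)" using s nV by (intro le) (auto simp: add_nonneg_pos)
    also have "\<dots> \<le> s"
      using s nV by (simp add: field_simps)
    finally show "\<bar>?I\<bar> \<le> 0 + s" by simp
  qed
  then show ?thesis by simp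
qed

lemma integral_lebesgue_on_lborel_vanish:
  fixes f :: "'a::euclidean_space \<Rightarrow> 'b::euclidean_space"
  assumes "S \<in> sets lebesgue" "\<And>x. x \<notin> S \<Longrightarrow> f x = 0" "f \<in> borel_measurable borel"
  shows "integral\<^sup>L (lebesgue_on S) f = integral\<^sup>L lborel f"
  using integral_lebesgue_on_vanish[OF assms(1,2)] assms(3) by (simp add: integral_completion)

lemma loc_integrable_mult_continuous:
  fixes u :: "'a::euclidean_space \<Rightarrow> 'b::euclidean_space" and k :: "'a \<Rightarrow> real"
  assumes u: "loc_integrable Om u" and Om: "open Om" and k: "continuous_on UNIV k"
    and K: "compact K" "K \<subseteq> Om" "\<And>x. x \<notin> K \<Longrightarrow> k x = 0"
  shows "integrable (lebesgue_on Om) (\<lambda>x. k x *\<^sub>R u x)"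
proof -
  have "bounded (k ` K)" by (intro compact_imp_bounded compact_continuous_image continuous_on_subset[OF k] K) auto
  then obtain B where "\<forall>y\<in>k ` K. norm y \<le> B" unfolding bounded_iff by blast
  then have B: "\<bar>k x\<bar> \<le> B" if "x \<in> K" for x using that by auto
  have "integrable (lebesgue_on K) (\<lambda>x. k x *\<^sub>R u x)"
  proof (rule integrable_bounded_scaleR[where B = B])
    show "integrable (lebesgue_on K) u" using u K by (auto simp: loc_integrable_def)
    show "k \<in> borel_measurable (lebesgue_on K)" by (rule borel_measurable_lebesgue_on_continuous[OF k])
  qed (use B in auto)
  then show ?thesis using K Om by (subst integrable_lebesgue_on_subset_vanish[of Om K]) auto
qed

lemma loc_integrable_continuous:
  fixes f :: "'a::euclidean_space \<Rightarrow> 'b::euclidean_space"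
  assumes "continuous_on UNIV f"
  shows "loc_integrable Om f"
  unfolding loc_integrable_def
proof (intro allI impI)
  fix K :: "'a set" assume K: "compact K \<and> K \<subseteq> Om"
  have "integrable lborel (\<lambda>x. indicator K x *\<^sub>R f x)"
    using K by (intro borel_integrable_compact continuous_on_subset[OF assms]) auto
  then have "integrable lebesgue (\<lambda>x. indicator K x *\<^sub>R f x)"
    using borel_measurable_integrable by (subst integrable_completion) auto
  then show "integrable (lebesgue_on K) f" using K by (simp add: integrable_lebesgue_on_iff)
qed

lemma GDERIV_mult_fun:
  assumes "GDERIV f x :> D" "GDERIV g x :> E"
  shows "GDERIV (\<lambda>x. f x * g x) x :> f x *\<^sub>R E + g x *\<^sub>R D"
  using has_derivative_mult[OF assms[unfolded gderiv_def]]
  by (simp add: gderiv_def inner_add_right algebra_simps)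

section \<open>Integration by parts and the algebra of weak gradients\<close>

lemma has_weak_gradientD:
  assumes "has_weak_gradient Om u g" "v \<in> C1_compact_support Om" "\<And>x. GDERIV v x :> D x" "i \<in> Basis"
  shows "(LINT x|lebesgue_on Om. u x * (D x \<bullet> i)) = - (LINT x|lebesgue_on Om. (g x \<bullet> i) * v x)"
  using assms unfolding has_weak_gradient_def by blast

lemma has_weak_gradientI:
  assumes "loc_integrable Om u" "loc_integrable Om g"
    and "\<And>v D i. v \<in> C1_compact_support Om \<Longrightarrow> (\<And>x. GDERIV v x :> D x) \<Longrightarrow> i \<in> Basis \<Longrightarrow>
      (LINT x|lebesgue_on Om. u x * (D x \<bullet> i)) = - (LINT x|lebesgue_on Om. (g x \<bullet> i) * v x)"
  shows "has_weak_gradient Om u g"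
  using assms unfolding has_weak_gradient_def by blast

text \<open>The product \<open>f * v\<close> is again a test function, so its gradient
  \<open>f x *\<^sub>R D x + v x *\<^sub>R g x\<close> has integral zero in every direction.\<close>

lemma has_weak_gradient_C1:
  fixes f :: "'a::euclidean_space \<Rightarrow> real"
  assumes Om: "open Om" and f: "\<And>x. GDERIV f x :> g x" and g: "continuous_on UNIV g"
  shows "has_weak_gradient Om f g"
proof (rule has_weak_gradientI)
  have cf: "continuous_on UNIV f" by (rule GDERIV_continuous_on[OF f])
  show lf: "loc_integrable Om f" by (rule loc_integrable_continuous[OF cf])
  show lg: "loc_integrable Om g" by (rule loc_integrable_continuous[OF g])
  fix v :: "'a \<Rightarrow> real" and D i assume v: "v \<in> C1_compact_support Om" "\<And>x. GDERIV v x :> D x" and i: "i \<in> (Basis :: 'a set)"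
  obtain K where K: "continuous_on UNIV D" "continuous_on UNIV v" "compact K" "K \<subseteq> Om"
    "\<And>x. x \<notin> K \<Longrightarrow> v x = 0" "\<And>x. x \<notin> K \<Longrightarrow> D x = 0"
    using C1_compact_supportE[OF v] by metis
  have fv: "GDERIV (\<lambda>x. f x * v x) x :> f x *\<^sub>R D x + v x *\<^sub>R g x" for x
    by (rule GDERIV_mult_fun[OF f v(2)])
  have c: "continuous_on UNIV (\<lambda>x. f x *\<^sub>R D x + v x *\<^sub>R g x)"
    using K cf g by (intro continuous_intros) auto
  have C1: "(\<lambda>x. f x * v x) \<in> C1_compact_support Om"
    by (rule C1_compact_supportI[OF fv c K(3,4)]) (use K(5) in auto)
  have K0: "x \<in> Om" if "x \<in> K" for x using that K(4) by auto
  have "(LINT x|lebesgue_on Om. f x * (D x \<bullet> i) + (g x \<bullet> i) * v x)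
     = (LINT x|lebesgue_on Om. (f x *\<^sub>R D x + v x *\<^sub>R g x) \<bullet> i)"
    by (intro Bochner_Integration.integral_cong) (auto simp: inner_add_left)
  also have "\<dots> = (LINT x|lborel. (f x *\<^sub>R D x + v x *\<^sub>R g x) \<bullet> i)"
  proof (rule integral_lebesgue_on_lborel_vanish)
    show "(f x *\<^sub>R D x + v x *\<^sub>R g x) \<bullet> i = 0" if "x \<notin> Om" for x
    proof -
      have "x \<notin> K" using that K0 by blast
      then show ?thesis using K(5,6)[of x] by simp
    qed
    show "(\<lambda>x. (f x *\<^sub>R D x + v x *\<^sub>R g x) \<bullet> i) \<in> borel_measurable borel"
      by (intro borel_measurable_continuous_onI continuous_intros c)
  qed (use Om in simp)
  also have "\<dots> = 0" by (rule integral_gradient_compact_support[OF C1 fv])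
  also have "(LINT x|lebesgue_on Om. f x * (D x \<bullet> i) + (g x \<bullet> i) * v x) = (LINT x|lebesgue_on Om. f x * (D x \<bullet> i)) + (LINT x|lebesgue_on Om. (g x \<bullet> i) * v x)"
  proof (rule Bochner_Integration.integral_add)
    show "integrable (lebesgue_on Om) (\<lambda>x. f x * (D x \<bullet> i))"
      using loc_integrable_mult_continuous[OF lf Om, of "\<lambda>x. D x \<bullet> i" K] K by (simp add: mult.commute continuous_on_inner)
    show "integrable (lebesgue_on Om) (\<lambda>x. (g x \<bullet> i) * v x)"
      using integrable_inner_left[OF loc_integrable_mult_continuous[OF lg Om, of "v" K], of i] K by (simp add: mult.commute)
  qed
  finally show "(LINT x|lebesgue_on Om. f x * (D x \<bullet> i)) = - (LINT x|lebesgue_on Om. (g x \<bullet> i) * v x)" by simp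
qed

text \<open>Functions in the spaces at hand are merely Lebesgue measurable and matter only on a set,
  whereas convolution needs Borel functions integrable over the whole space. The representative is
  built coordinate by coordinate and extended by zero.\<close>

lemma lebesgue_on_borel_representative:
  fixes f :: "'a::euclidean_space \<Rightarrow> 'b::euclidean_space"
  assumes S: "S \<in> sets borel" and f: "integrable (lebesgue_on S) f"
  obtains f0 where "integrable lborel f0" "\<And>x. x \<notin> S \<Longrightarrow> f0 x = 0" "AE x in lborel. x \<in> S \<longrightarrow> f0 x = f x"
proof -
  have SL: "S \<in> sets lebesgue" using S by simp
  define F where "F x = indicator S x *\<^sub>R f x" for x
  have F: "integrable lebesgue F" using f SL by (simp add: F_def[abs_def] integrable_lebesgue_on_iff)
  have "\<exists>g. \<forall>b\<in>Basis. g b \<in> borel_measurable lborel \<and> (AE x in lborel. F x \<bullet> b = g b x)"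
  proof (rule bchoice, rule ballI)
    fix b :: 'b
    have "(\<lambda>x. F x \<bullet> b) \<in> borel_measurable lebesgue"
      using borel_measurable_integrable[OF F] by simp
    then show "\<exists>y. y \<in> borel_measurable lborel \<and> (AE x in lborel. F x \<bullet> b = y x)"
      using completion_ex_borel_measurable_real[of "\<lambda>x. F x \<bullet> b" lborel] by blast
  qed
  then obtain g where g: "\<And>b. b \<in> Basis \<Longrightarrow> g b \<in> borel_measurable lborel"
    "\<And>b. b \<in> Basis \<Longrightarrow> AE x in lborel. F x \<bullet> b = g b x" by blast
  define f0 where "f0 x = indicator S x *\<^sub>R (\<Sum>b\<in>Basis. g b x *\<^sub>R b)" for x
  have m: "f0 \<in> borel_measurable lborel"
    unfolding f0_def[abs_def] using g(1) S by (intro borel_measurable_scaleR borel_measurable_sum borel_measurable_indicator) auto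
  have "AE x in lborel. \<forall>b\<in>Basis. F x \<bullet> b = g b x"
    using g(2) by (intro AE_finite_allI) auto
  then have ae: "AE x in lborel. f0 x = F x"
  proof (rule eventually_mono)
    fix x assume "\<forall>b\<in>Basis. F x \<bullet> b = g b x"
    then have "(\<Sum>b\<in>Basis. g b x *\<^sub>R b) = (\<Sum>b\<in>Basis. (F x \<bullet> b) *\<^sub>R b)" by simp
    also have "\<dots> = F x" by (rule euclidean_representation)
    finally show "f0 x = F x" by (simp add: f0_def F_def indicator_def)
  qed
  have "integrable lebesgue f0"
    using ae F measurable_completion[OF m] borel_measurable_integrable[OF F]
    by (subst integrable_cong_AE[where g = F]) (auto simp: AE_completion_iff)
  then have "integrable lborel f0" using m by (simp add: integrable_completion)
  then show ?thesis
  proof (rule that)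
    show "f0 x = 0" if "x \<notin> S" for x using that by (simp add: f0_def)
    show "AE x in lborel. x \<in> S \<longrightarrow> f0 x = f x" using ae by (rule eventually_mono) (auto simp: F_def)
  qed
qed

lemma loc_integrable_cong_AE:
  assumes u: "loc_integrable Om u" and Om: "open Om" and ae: "AE x in lebesgue_on Om. u x = u' x"
  shows "loc_integrable Om u'"
  unfolding loc_integrable_def
proof (intro allI impI)
  fix K assume K: "compact K \<and> K \<subseteq> Om"
  show "integrable (lebesgue_on K) u'"
  proof (rule integrable_lebesgue_on_cong_AE)
    show "integrable (lebesgue_on K) u" using u K by (auto simp: loc_integrable_def)
    show "AE x in lebesgue_on K. u x = u' x"
      by (rule AE_lebesgue_on_subset[OF _ _ _ ae]) (use K Om in auto)
  qed (use K in auto)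
qed

lemma has_weak_gradient_cong_AE:
  assumes h: "has_weak_gradient Om u g" and Om: "open Om"
    and u: "AE x in lebesgue_on Om. u x = u' x" and g: "AE x in lebesgue_on Om. g x = g' x"
  shows "has_weak_gradient Om u' g'"
proof (rule has_weak_gradientI)
  show "loc_integrable Om u'" "loc_integrable Om g'"
    using h loc_integrable_cong_AE[OF _ Om u] loc_integrable_cong_AE[OF _ Om g] by (auto simp: has_weak_gradient_def)
  fix v :: "'a \<Rightarrow> real" and D i
  assume v: "v \<in> C1_compact_support Om" "\<And>x. GDERIV v x :> D x" and i: "i \<in> (Basis :: 'a set)"
  have "(LINT x|lebesgue_on Om. u x * (D x \<bullet> i)) = (LINT x|lebesgue_on Om. u' x * (D x \<bullet> i))"
    using u Om by (intro integral_lebesgue_on_cong_AE) (auto elim: eventually_mono)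
  moreover have "(LINT x|lebesgue_on Om. (g x \<bullet> i) * v x) = (LINT x|lebesgue_on Om. (g' x \<bullet> i) * v x)"
    using g Om by (intro integral_lebesgue_on_cong_AE) (auto elim: eventually_mono)
  ultimately show "(LINT x|lebesgue_on Om. u' x * (D x \<bullet> i)) = - (LINT x|lebesgue_on Om. (g' x \<bullet> i) * v x)"
    using has_weak_gradientD[OF h v i] by simp
qed

lemma weak_test_integrable:
  assumes h: "has_weak_gradient Om u g" and Om: "open Om"
    and v: "v \<in> C1_compact_support Om" "\<And>x. GDERIV v x :> D x"
  shows "integrable (lebesgue_on Om) (\<lambda>x. u x * (D x \<bullet> i))" "integrable (lebesgue_on Om) (\<lambda>x. (g x \<bullet> i) * v x)"
proof -
  obtain K where K: "continuous_on UNIV D" "continuous_on UNIV v" "compact K" "K \<subseteq> Om"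
    "\<And>x. x \<notin> K \<Longrightarrow> v x = 0" "\<And>x. x \<notin> K \<Longrightarrow> D x = 0"
    using C1_compact_supportE[OF v] by metis
  show "integrable (lebesgue_on Om) (\<lambda>x. u x * (D x \<bullet> i))"
    using loc_integrable_mult_continuous[of Om u "\<lambda>x. D x \<bullet> i" K] h Om K
    by (simp add: has_weak_gradient_def mult.commute continuous_on_inner)
  show "integrable (lebesgue_on Om) (\<lambda>x. (g x \<bullet> i) * v x)"
    using integrable_inner_left[OF loc_integrable_mult_continuous[of Om g "v" K], of i] h Om K
    by (simp add: has_weak_gradient_def mult.commute)
qed

lemma has_weak_gradient_lincomb:
  assumes h: "has_weak_gradient Om u g" "has_weak_gradient Om w k" and Om: "open Om"
  shows "has_weak_gradient Om (\<lambda>x. a * u x + b * w x) (\<lambda>x. a *\<^sub>R g x + b *\<^sub>R k x)"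
proof (rule has_weak_gradientI)
  show "loc_integrable Om (\<lambda>x. a * u x + b * w x)" "loc_integrable Om (\<lambda>x. a *\<^sub>R g x + b *\<^sub>R k x)"
    using h by (auto simp: has_weak_gradient_def loc_integrable_def)
  fix v :: "'a \<Rightarrow> real" and D i
  assume v: "v \<in> C1_compact_support Om" "\<And>x. GDERIV v x :> D x" and i: "i \<in> (Basis :: 'a set)"
  note I = weak_test_integrable[OF h(1) Om v, of i] weak_test_integrable[OF h(2) Om v, of i]
  have "(LINT x|lebesgue_on Om. (a * u x + b * w x) * (D x \<bullet> i)) = (LINT x|lebesgue_on Om. a * (u x * (D x \<bullet> i)) + b * (w x * (D x \<bullet> i)))"
    by (simp add: algebra_simps)
  also have "\<dots> = a * (LINT x|lebesgue_on Om. u x * (D x \<bullet> i)) + b * (LINT x|lebesgue_on Om. w x * (D x \<bullet> i))"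
    using I by simp
  also have "\<dots> = - (a * (LINT x|lebesgue_on Om. (g x \<bullet> i) * v x) + b * (LINT x|lebesgue_on Om. (k x \<bullet> i) * v x))"
    by (simp add: has_weak_gradientD[OF h(1) v i] has_weak_gradientD[OF h(2) v i])
  also have "a * (LINT x|lebesgue_on Om. (g x \<bullet> i) * v x) + b * (LINT x|lebesgue_on Om. (k x \<bullet> i) * v x)
    = (LINT x|lebesgue_on Om. a * ((g x \<bullet> i) * v x) + b * ((k x \<bullet> i) * v x))"
    using I by simp
  also have "\<dots> = (LINT x|lebesgue_on Om. ((a *\<^sub>R g x + b *\<^sub>R k x) \<bullet> i) * v x)"
    by (simp add: algebra_simps inner_add_left)
  finally show "(LINT x|lebesgue_on Om. (a * u x + b * w x) * (D x \<bullet> i)) = - (LINT x|lebesgue_on Om. ((a *\<^sub>R g x + b *\<^sub>R k x) \<bullet> i) * v x)" .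
qed

lemma has_weak_gradient_add:
  assumes "has_weak_gradient Om u g" "has_weak_gradient Om w k" "open Om"
  shows "has_weak_gradient Om (\<lambda>x. u x + w x) (\<lambda>x. g x + k x)"
  using has_weak_gradient_lincomb[OF assms, of 1 1] by simp

lemma has_weak_gradient_diff:
  assumes "has_weak_gradient Om u g" "has_weak_gradient Om w k" "open Om"
  shows "has_weak_gradient Om (\<lambda>x. u x - w x) (\<lambda>x. g x - k x)"
  using has_weak_gradient_lincomb[OF assms, of 1 "-1"] by simp

lemma has_weak_gradient_minus:
  assumes "has_weak_gradient Om u g" "open Om"
  shows "has_weak_gradient Om (\<lambda>x. - u x) (\<lambda>x. - g x)"
  using has_weak_gradient_lincomb[OF assms(1) assms, of "-1" 0] by simp

lemma has_weak_gradient_const: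
  "open Om \<Longrightarrow> has_weak_gradient Om (\<lambda>x. c) (\<lambda>x. 0)"
  by (rule has_weak_gradient_C1) (auto simp: gderiv_def)

lemma C1_compact_support_mono: "S \<subseteq> T \<Longrightarrow> C1_compact_support S \<subseteq> C1_compact_support T"
  by (auto simp: C1_compact_support_def)

lemma has_weak_gradient_subset:
  assumes h: "has_weak_gradient S u g" and o: "open S" "open T" "T \<subseteq> S"
  shows "has_weak_gradient T u g"
proof (rule has_weak_gradientI)
  show "loc_integrable T u" "loc_integrable T g"
    using h o by (auto simp: has_weak_gradient_def loc_integrable_def)
  fix v :: "'a \<Rightarrow> real" and D i
  assume v: "v \<in> C1_compact_support T" "\<And>x. GDERIV v x :> D x" and i: "i \<in> (Basis :: 'a set)"
  have v': "v \<in> C1_compact_support S" using v C1_compact_support_mono[OF o(3)] by auto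
  obtain K where K: "K \<subseteq> T" "\<And>x. x \<notin> K \<Longrightarrow> v x = 0" "\<And>x. x \<notin> K \<Longrightarrow> D x = 0"
    using C1_compact_supportE[OF v] by metis
  have K0: "v x = 0" "D x = 0" if "x \<notin> T" for x
    using K(2,3)[of x] K(1) that by blast+
  have "(LINT x|lebesgue_on S. u x * (D x \<bullet> i)) = (LINT x|lebesgue_on T. u x * (D x \<bullet> i))"
    using o K0 by (intro integral_lebesgue_on_subset_vanish) auto
  moreover have "(LINT x|lebesgue_on S. (g x \<bullet> i) * v x) = (LINT x|lebesgue_on T. (g x \<bullet> i) * v x)"
    using o K0 by (intro integral_lebesgue_on_subset_vanish) auto
  ultimately show "(LINT x|lebesgue_on T. u x * (D x \<bullet> i)) = - (LINT x|lebesgue_on T. (g x \<bullet> i) * v x)"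
    using has_weak_gradientD[OF h v' v(2) i] by simp
qed

section \<open>Mollification of weakly differentiable functions; uniqueness of the weak
  gradient\<close>

lemma GDERIV_translate:
  assumes "\<And>x. GDERIV f x :> D x"
  shows "GDERIV (\<lambda>y. f (y - x)) y :> D (y - x)"
proof -
  have "((\<lambda>y. y - x) has_derivative (\<lambda>h. h)) (at y)" by (auto intro!: derivative_eq_intros)
  from has_derivative_compose[OF this assms[unfolded gderiv_def]]
  show ?thesis by (simp add: gderiv_def)
qed

text \<open>The mollifier centred at \<open>x\<close> is itself an admissible test function as soon
  as \<open>cball x e\<close> lies in \<open>Om\<close>, and integration by parts moves the
  derivative from the kernel to \<open>u\<close>. Only values on that ball enter, so
  \<open>f0\<close> and \<open>g0\<close> may be any integrable functions that agree there with
  \<open>u\<close> and \<open>g\<close>.\<close>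

lemma convol_grad_eq:
  fixes u :: "'a::euclidean_space \<Rightarrow> real"
  assumes h: "has_weak_gradient Om u g" and Om: "open Om" and e: "0 < e" and cb: "cball x e \<subseteq> Om"
    and f0: "integrable lborel f0" and g0: "integrable lborel g0"
    and uf: "AE y in lborel. y \<in> cball x e \<longrightarrow> f0 y = u y" and gf: "AE y in lborel. y \<in> cball x e \<longrightarrow> g0 y = g y"
  shows "convol_grad e f0 x = convol e g0 x"
proof (rule euclidean_eqI)
  fix i :: 'a assume i: "i \<in> Basis"
  note [measurable] = integrable_borel_measurable_borel[OF f0] integrable_borel_measurable_borel[OF g0]
  let ?v = "\<lambda>y. mollifier e (y - x)" and ?D = "\<lambda>y. mollifier_grad e (y - x)"
  have D: "GDERIV ?v y :> ?D y" for y by (rule GDERIV_translate[OF GDERIV_mollifier])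
  have z: "?v y = 0" "?D y = 0" if "y \<notin> cball x e" for y
    using that mollifier_eq_0[OF e, of "y - x"] mollifier_grad_eq_0[OF e, of "y - x"] by (auto simp: dist_norm norm_minus_commute)
  have v: "?v \<in> C1_compact_support Om"
  proof (rule C1_compact_supportI[OF D _ compact_cball cb])
    have "continuous_on UNIV (mollifier_grad e \<circ> (\<lambda>y. y - x))"
      by (intro continuous_on_compose continuous_intros)
    then show "continuous_on UNIV ?D" by (simp add: comp_def)
  qed (use z in auto)
  have cl: "cball x e \<in> sets lebesgue" "Om \<in> sets lebesgue" using Om by (auto simp: compact_sets_lebesgue)
  have "convol_grad e f0 x \<bullet> i = (LINT y|lborel. - (f0 y * (?D y \<bullet> i)))"
    unfolding convol_grad_def using convol_grad_integrable[OF f0 e, of x]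
    by (subst integral_inner_left[symmetric]) auto
  also have "\<dots> = - (LINT y|lborel. f0 y * (?D y \<bullet> i))" by simp
  also have "(LINT y|lborel. f0 y * (?D y \<bullet> i)) = (LINT y|lebesgue_on (cball x e). f0 y * (?D y \<bullet> i))"
    using z cl by (intro integral_lebesgue_on_lborel_vanish[symmetric]) auto
  also have "\<dots> = (LINT y|lebesgue_on (cball x e). u y * (?D y \<bullet> i))"
    using uf cl by (intro integral_lebesgue_on_cong_AE) (auto simp: AE_lebesgue_on_iff simp del: mem_cball elim!: eventually_mono)
  also have "\<dots> = (LINT y|lebesgue_on Om. u y * (?D y \<bullet> i))"
    using z cl cb by (intro integral_lebesgue_on_subset_vanish[symmetric]) auto
  also have "\<dots> = - (LINT y|lebesgue_on Om. (g y \<bullet> i) * ?v y)"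
    by (rule has_weak_gradientD[OF h v D i])
  also have "(LINT y|lebesgue_on Om. (g y \<bullet> i) * ?v y) = (LINT y|lebesgue_on (cball x e). (g y \<bullet> i) * ?v y)"
    using z cl cb by (intro integral_lebesgue_on_subset_vanish) auto
  also have "\<dots> = (LINT y|lebesgue_on (cball x e). (g0 y \<bullet> i) * ?v y)"
    using gf cl by (intro integral_lebesgue_on_cong_AE) (auto simp: AE_lebesgue_on_iff simp del: mem_cball elim!: eventually_mono)
  also have "\<dots> = (LINT y|lborel. (g0 y \<bullet> i) * ?v y)"
    using z cl by (intro integral_lebesgue_on_lborel_vanish) auto
  also have "\<dots> = convol e g0 x \<bullet> i"
  proof -
    obtain B where "\<And>x::'a. norm (mollifier e x) \<le> B" using mollifier_bounded[OF e] by blast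
    then have "integrable lborel (\<lambda>y. ?v y *\<^sub>R g0 y)"
      by (intro integrable_bounded_scaleR[OF g0, where B = B]) auto
    then show ?thesis
      by (subst convol_altdef, simp) (subst integral_inner_left[symmetric], auto simp: mult.commute)
  qed
  finally show "convol_grad e f0 x \<bullet> i = convol e g0 x \<bullet> i" by simp
qed

lemma seq_inverse_pos: "0 < d \<Longrightarrow> 0 < d / real (Suc n)" by simp

lemma seq_inverse_tendsto: "(\<lambda>n. d / real (Suc n)) \<longlonglongrightarrow> 0"
  using tendsto_mult_right_zero[OF LIMSEQ_inverse_real_of_nat, of d] by (simp add: divide_inverse)

lemma compact_neighbourhood:
  fixes K :: "'a::euclidean_space set"
  assumes K: "compact K" "K \<subseteq> Om" and Om: "open Om"
  obtains d K' where "0 < d" "compact K'" "K' \<subseteq> Om" "K \<subseteq> K'" "\<And>x. x \<in> K \<Longrightarrow> cball x d \<subseteq> K'"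
    "\<And>x y. x \<in> K' \<Longrightarrow> y \<in> cball x d \<Longrightarrow> y \<in> Om" "\<And>x y. x \<notin> K' \<Longrightarrow> y \<in> K \<Longrightarrow> d < dist x y"
proof -
  obtain d where d: "0 < d" "(\<Union>x\<in>K. cball x d) \<subseteq> Om"
    using compact_subset_open_imp_cball_epsilon_subset[OF K(1) Om K(2)] by blast
  \<comment> \<open>Balls of radius \<open>d\<close> about points of \<open>K\<close> fit into
    \<open>Om\<close>. Half of the radius is spent on the fattening \<open>K'\<close>; the other
    half, which is the radius returned, remains available around the points of
    \<open>K'\<close>.\<close>
  define K' where "K' = {x + y |x y. x \<in> K \<and> y \<in> cball 0 (d / 2)}"
  have mem: "z \<in> K' \<longleftrightarrow> (\<exists>x\<in>K. dist x z \<le> d / 2)" for z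
  proof
    assume "z \<in> K'" then show "\<exists>x\<in>K. dist x z \<le> d / 2" by (force simp: K'_def dist_norm)
  next
    assume "\<exists>x\<in>K. dist x z \<le> d / 2"
    then obtain x where x: "x \<in> K" "dist x z \<le> d / 2" by blast
    then have "z = x + (z - x)" "z - x \<in> cball 0 (d / 2)" by (auto simp: dist_norm norm_minus_commute)
    then show "z \<in> K'" using x(1) unfolding K'_def by blast
  qed
  show ?thesis
  proof (rule that[of "d / 2" K'])
    show "compact K'" unfolding K'_def by (rule compact_sums[OF K(1) compact_cball])
    show "K' \<subseteq> Om"
    proof
      fix z assume "z \<in> K'"
      then obtain x where "x \<in> K" "dist x z \<le> d / 2" using mem by blast
      then have "z \<in> cball x d" using d(1) by simp
      then show "z \<in> Om" using d(2) \<open>x \<in> K\<close> by blast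
    qed
    show "K \<subseteq> K'" using mem d(1) by force
    show "cball x (d / 2) \<subseteq> K'" if "x \<in> K" for x using that mem by auto
    show "y \<in> Om" if xy: "x \<in> K'" "y \<in> cball x (d / 2)" for x y
    proof -
      obtain z where z: "z \<in> K" "dist z x \<le> d / 2" using xy(1) mem by blast
      then have "dist z y \<le> d" using xy(2) dist_triangle[of z y x] by simp
      then have "y \<in> cball z d" by simp
      then show ?thesis using z(1) d(2) by blast
    qed
    show "d / 2 < dist x y" if "x \<notin> K'" "y \<in> K" for x y
      using that mem by (metis dist_commute not_le)
  qed (use d in auto)
qed

lemma convol_L1_local:
  fixes f :: "'a::euclidean_space \<Rightarrow> 'b::euclidean_space"
  assumes f0: "integrable lborel f0" and e: "\<And>n. 0 < e n" "e \<longlonglongrightarrow> 0" and K: "compact K"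
    and eq: "AE x in lborel. x \<in> K \<longrightarrow> f0 x = f x"
  shows "integrable (lebesgue_on K) (\<lambda>x. norm (convol (e n) f0 x - f x))"
    and "(\<lambda>n. LINT x|lebesgue_on K. norm (convol (e n) f0 x - f x)) \<longlonglongrightarrow> 0"
proof -
  have KL: "K \<in> sets lebesgue" using K by simp
  have i: "integrable lborel (\<lambda>x. norm (convol (e n) f0 x - f0 x))" for n
    using convol_Lp_tendsto(1)[OF f0 _ _ e, of 1 n] f0 by simp
  have l: "(\<lambda>n. LINT x|lborel. norm (convol (e n) f0 x - f0 x)) \<longlonglongrightarrow> 0"
    using convol_Lp_tendsto(2)[OF f0 _ _ e, of 1] f0 by simp
  have iL: "integrable lebesgue (\<lambda>x. norm (convol (e n) f0 x - f0 x))" for n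
    using i[of n] borel_measurable_integrable[OF i[of n]] by (simp add: integrable_completion)
  have iK: "integrable (lebesgue_on K) (\<lambda>x. norm (convol (e n) f0 x - f0 x))" for n
    using iL[of n] KL integrable_mult_indicator[OF KL iL[of n]] by (simp add: integrable_lebesgue_on_iff)
  have ae: "AE x in lebesgue_on K. norm (convol (e n) f0 x - f0 x) = norm (convol (e n) f0 x - f x)" for n
    using eq KL by (auto simp: AE_lebesgue_on_iff elim!: eventually_mono)
  show "integrable (lebesgue_on K) (\<lambda>x. norm (convol (e n) f0 x - f x))"
    by (rule integrable_lebesgue_on_cong_AE[OF KL iK ae])
  show "(\<lambda>n. LINT x|lebesgue_on K. norm (convol (e n) f0 x - f x)) \<longlonglongrightarrow> 0"
  proof (rule Lim_null_comparison[OF always_eventually l], rule allI)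
    fix n
    have "(LINT x|lebesgue_on K. norm (convol (e n) f0 x - f x)) = (LINT x|lebesgue_on K. norm (convol (e n) f0 x - f0 x))"
      by (rule integral_lebesgue_on_cong_AE[OF KL ae, symmetric])
    also have "\<dots> = (LINT x|lebesgue. indicator K x *\<^sub>R norm (convol (e n) f0 x - f0 x))"
      by (rule integral_lebesgue_on_eq[OF KL])
    also have "\<dots> \<le> (LINT x|lebesgue. norm (convol (e n) f0 x - f0 x))"
      using iL[of n] integrable_mult_indicator[OF KL iL[of n]] by (intro integral_mono) (auto simp: indicator_def)
    also have "\<dots> = (LINT x|lborel. norm (convol (e n) f0 x - f0 x))"
      using borel_measurable_integrable[OF i[of n]] by (intro integral_completion) auto
    finally show "norm (LINT x|lebesgue_on K. norm (convol (e n) f0 x - f x)) \<le> (LINT x|lborel. norm (convol (e n) f0 x - f0 x))"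
      by (simp add: integral_nonneg_AE)
  qed
qed

text \<open>On a compact subset the mollifications of \<open>k\<close> are the gradients of the
  mollified zero function, hence 0; they also converge to \<open>k\<close> in mean there. An
  exhaustion of \<open>Om\<close> by countably many compact sets finishes the argument.\<close>

lemma weak_gradient_zero_unique:
  fixes k :: "'a::euclidean_space \<Rightarrow> 'a"
  assumes h: "has_weak_gradient Om (\<lambda>x. 0) k" and Om: "open Om"
  shows "AE x in lebesgue_on Om. k x = 0"
proof -
  have onK: "AE x in lborel. x \<in> K \<longrightarrow> k x = 0" if K: "compact K" "K \<subseteq> Om" for K
  proof -
    obtain d K' where d: "0 < d" "compact K'" "K' \<subseteq> Om" "K \<subseteq> K'" "\<And>x. x \<in> K \<Longrightarrow> cball x d \<subseteq> K'"
      using compact_neighbourhood[OF K Om] by metis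
    have "integrable (lebesgue_on K') k" using h d by (auto simp: has_weak_gradient_def loc_integrable_def)
    then obtain g0 where g0: "integrable lborel g0" "\<And>x. x \<notin> K' \<Longrightarrow> g0 x = 0" "AE x in lborel. x \<in> K' \<longrightarrow> g0 x = k x"
      using lebesgue_on_borel_representative[of K' k] d(2) by (auto simp: borel_compact)
    have ae: "AE x in lborel. x \<in> K \<longrightarrow> g0 x = k x" using g0(3) d(4) by (auto elim!: eventually_mono)
    define e where "e n = d / real (Suc n)" for n
    have e: "0 < e n" "e \<longlonglongrightarrow> 0" "e n \<le> d" for n
      unfolding e_def using d(1) seq_inverse_tendsto by (auto simp: field_simps)
    have z: "convol (e n) g0 x = 0" if x: "x \<in> K" for n x
    proof -
      have cb: "cball x (e n) \<subseteq> K'" using d(5)[OF x] e(3)[of n] by (meson subset_cball order_trans)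
      have "convol_grad (e n) (\<lambda>x. 0) x = convol (e n) g0 x"
        by (rule convol_grad_eq[OF h Om e(1)]) (use cb d(3) g0 in \<open>auto elim!: eventually_mono\<close>)
      then show ?thesis by (simp add: convol_grad_def)
    qed
    have "(\<lambda>n. LINT x|lebesgue_on K. norm (convol (e n) g0 x - k x)) \<longlonglongrightarrow> 0"
      by (rule convol_L1_local(2)[OF g0(1) e(1,2) K(1) ae])
    moreover have "(LINT x|lebesgue_on K. norm (convol (e n) g0 x - k x)) = (LINT x|lebesgue_on K. norm (k x))" for n
      by (intro Bochner_Integration.integral_cong) (auto simp: z)
    ultimately have "(LINT x|lebesgue_on K. norm (k x)) = 0" by (simp add: LIMSEQ_const_iff)
    moreover have "integrable (lebesgue_on K) k" using h K by (auto simp: has_weak_gradient_def loc_integrable_def)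
    ultimately have "AE x in lebesgue_on K. norm (k x) = 0"
      by (subst integral_nonneg_eq_0_iff_AE[symmetric]) auto
    then show ?thesis using K by (simp add: AE_lebesgue_on_iff)
  qed
  obtain C where C: "\<And>n. compact (C n)" "\<And>n. C n \<subseteq> Om" "\<And>n. C n \<subseteq> interior (C (Suc n))" "\<Union>(range C) = Om"
      "\<And>K. compact K \<Longrightarrow> K \<subseteq> Om \<Longrightarrow> \<exists>N. \<forall>n\<ge>N. K \<subseteq> C n"
  proof (rule open_Union_compact_subsets[OF Om], goal_cases)
    case (1 C)
    show ?case by (rule 1(1)[of C]) (fact 1(2), fact 1(3), fact 1(4), fact 1(5), fact 1(6))
  qed
  have "AE x in lborel. \<forall>n. x \<in> C n \<longrightarrow> k x = 0"
    unfolding AE_all_countable using onK[OF C(1,2)] by blast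
  then have "AE x in lborel. x \<in> Om \<longrightarrow> k x = 0"
    by (rule eventually_mono) (use C(4) in blast)
  then show ?thesis using Om by (simp add: AE_lebesgue_on_iff)
qed

lemma has_weak_gradient_unique:
  assumes "has_weak_gradient Om u g" "has_weak_gradient Om u g'" "open Om"
  shows "AE x in lebesgue_on Om. g x = g' x"
  using weak_gradient_zero_unique[of Om "\<lambda>x. g x - g' x"] has_weak_gradient_diff[OF assms] assms(3)
  by auto

text \<open>Lets any explicitly computed weak gradient stand in for the one selected by
  \<open>SOME\<close>.\<close>

lemma weak_gradient_AE_eq:
  assumes "has_weak_gradient Om u g" "open Om"
  shows "AE x in lebesgue_on Om. weak_gradient Om u x = g x"
  unfolding weak_gradient_def by (rule has_weak_gradient_unique[OF someI[of "has_weak_gradient Om u"] assms]) (rule assms)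

text \<open>The approximants are mollifications of a representative cut off outside a neighbourhood
  \<open>K'\<close> of \<open>K\<close>. The cut destroys the gradient relation near the boundary of
  \<open>K'\<close>, but on \<open>K\<close> the balls of radius \<open>e n\<close> stay inside
  \<open>K'\<close>, so mollifying and differentiating commute there.\<close>

lemma local_smooth_approximation:
  fixes u :: "'a::euclidean_space \<Rightarrow> real"
  assumes h: "has_weak_gradient Om u g" and Om: "open Om" and K: "compact K" "K \<subseteq> Om"
  obtains f D where "\<And>n x. GDERIV (f n) x :> D n x" "\<And>n. continuous_on UNIV (D n)"
    "\<And>n. integrable (lebesgue_on K) (\<lambda>x. norm (f n x - u x))"
    "\<And>n. integrable (lebesgue_on K) (\<lambda>x. norm (D n x - g x))"
    "(\<lambda>n. LINT x|lebesgue_on K. norm (f n x - u x)) \<longlonglongrightarrow> 0"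
    "(\<lambda>n. LINT x|lebesgue_on K. norm (D n x - g x)) \<longlonglongrightarrow> 0"
proof -
  obtain d K' where d: "0 < d" "compact K'" "K' \<subseteq> Om" "K \<subseteq> K'" "\<And>x. x \<in> K \<Longrightarrow> cball x d \<subseteq> K'"
    using compact_neighbourhood[OF K Om] by metis
  have "integrable (lebesgue_on K') u" "integrable (lebesgue_on K') g"
    using h d by (auto simp: has_weak_gradient_def loc_integrable_def)
  obtain f0 where f0: "integrable lborel f0" "AE x in lborel. x \<in> K' \<longrightarrow> f0 x = u x"
    using lebesgue_on_borel_representative[of K' u] d(2) \<open>integrable (lebesgue_on K') u\<close> by (auto simp: borel_compact)
  obtain g0 where g0: "integrable lborel g0" "AE x in lborel. x \<in> K' \<longrightarrow> g0 x = g x"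
    using lebesgue_on_borel_representative[of K' g] d(2) \<open>integrable (lebesgue_on K') g\<close> by (auto simp: borel_compact)
  have ae: "AE x in lborel. x \<in> K \<longrightarrow> f0 x = u x" "AE x in lborel. x \<in> K \<longrightarrow> g0 x = g x"
    by (rule eventually_mono[OF f0(2)], use d(4) in blast) (rule eventually_mono[OF g0(2)], use d(4) in blast)
  define e where "e n = d / real (Suc n)" for n
  have e: "0 < e n" "e \<longlonglongrightarrow> 0" "e n \<le> d" for n
    unfolding e_def using d(1) seq_inverse_tendsto by (auto simp: field_simps)
  have z: "convol_grad (e n) f0 x = convol (e n) g0 x" if x: "x \<in> K" for n x
  proof -
    have cb: "cball x (e n) \<subseteq> K'" using d(5)[OF x] e(3)[of n] by (meson subset_cball order_trans)
    show ?thesis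
    proof (rule convol_grad_eq[OF h Om e(1) _ f0(1) g0(1)])
      show "AE y in lborel. y \<in> cball x (e n) \<longrightarrow> f0 y = u y" using f0(2) by (rule eventually_mono) (use cb in blast)
      show "AE y in lborel. y \<in> cball x (e n) \<longrightarrow> g0 y = g y" using g0(2) by (rule eventually_mono) (use cb in blast)
    qed (use cb d(3) in blast)
  qed
  show ?thesis
  proof (rule that[of "\<lambda>n. convol (e n) f0" "\<lambda>n. convol_grad (e n) f0"])
    show "GDERIV (convol (e n) f0) x :> convol_grad (e n) f0 x" for n x by (rule GDERIV_convol[OF f0(1) e(1)])
    show "continuous_on UNIV (convol_grad (e n) f0)" for n by (rule continuous_convol_grad[OF f0(1) e(1)])
    show "integrable (lebesgue_on K) (\<lambda>x. norm (convol (e n) f0 x - u x))" for n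
      by (rule convol_L1_local(1)[OF f0(1) e(1,2) K(1) ae(1)])
    show "(\<lambda>n. LINT x|lebesgue_on K. norm (convol (e n) f0 x - u x)) \<longlonglongrightarrow> 0"
      by (rule convol_L1_local(2)[OF f0(1) e(1,2) K(1) ae(1)])
    have eq: "integrable (lebesgue_on K) (\<lambda>x. norm (convol_grad (e n) f0 x - g x)) \<longleftrightarrow> integrable (lebesgue_on K) (\<lambda>x. norm (convol (e n) g0 x - g x))" for n
      by (intro Bochner_Integration.integrable_cong) (auto simp: z)
    then show "integrable (lebesgue_on K) (\<lambda>x. norm (convol_grad (e n) f0 x - g x))" for n
      using convol_L1_local(1)[OF g0(1) e(1,2) K(1) ae(2)] by simp
    have "(LINT x|lebesgue_on K. norm (convol_grad (e n) f0 x - g x)) = (LINT x|lebesgue_on K. norm (convol (e n) g0 x - g x))" for n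
      by (intro Bochner_Integration.integral_cong) (auto simp: z)
    then show "(\<lambda>n. LINT x|lebesgue_on K. norm (convol_grad (e n) f0 x - g x)) \<longlonglongrightarrow> 0"
      using convol_L1_local(2)[OF g0(1) e(1,2) K(1) ae(2)] by simp
  qed
qed

section \<open>Chain rule for weak gradients\<close>

lemma Lipschitz_derivative_bound:
  fixes b :: "real \<Rightarrow> real"
  assumes b: "\<And>t. (b has_real_derivative b' t) (at t)" and b': "\<And>t. \<bar>b' t\<bar> \<le> 1"
  shows "\<bar>b s - b t\<bar> \<le> \<bar>s - t\<bar>"
proof -
  have "norm (b s - b t) \<le> 1 * norm (s - t)"
    by (rule field_differentiable_bound[of UNIV b b']) (use b b' in auto)
  then show ?thesis by simp
qed

lemma borel_measurable_loc_integrable: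
  assumes "loc_integrable Om u" "compact K" "K \<subseteq> Om"
  shows "u \<in> borel_measurable (lebesgue_on K)"
  using assms by (auto simp: loc_integrable_def)

lemma loc_integrable_bound:
  fixes u :: "'a::euclidean_space \<Rightarrow> 'b::euclidean_space" and w :: "'a \<Rightarrow> 'c::euclidean_space"
  assumes u: "loc_integrable Om u"
    and m: "\<And>K. compact K \<Longrightarrow> K \<subseteq> Om \<Longrightarrow> w \<in> borel_measurable (lebesgue_on K)"
    and b: "\<And>x. norm (w x) \<le> norm (u x) + c"
  shows "loc_integrable Om w"
  unfolding loc_integrable_def
proof (intro allI impI)
  fix K assume K: "compact K \<and> K \<subseteq> Om"
  have c: "integrable (lebesgue_on K) (\<lambda>x. c)"
    using loc_integrable_continuous[of "\<lambda>x. c" K] K by (auto simp: loc_integrable_def)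
  show "integrable (lebesgue_on K) w"
  proof (rule Bochner_Integration.integrable_bound)
    show "integrable (lebesgue_on K) (\<lambda>x. norm (u x) + c)"
      using u K c by (auto simp: loc_integrable_def)
    show "AE x in lebesgue_on K. norm (w x) \<le> norm (norm (u x) + c)"
      using b by (intro AE_I2) (force intro: order_trans)
  qed (use m K in auto)
qed

text \<open>The classical chain rule holds for smooth approximants \<open>f n\<close>. In the limit
  the values are handled by the Lipschitz bound on \<open>b\<close>. For the gradients,
  \<open>b' (f n x) *\<^sub>R (D n x - g x)\<close> is small in mean since
  \<open>\<bar>b'\<bar> \<le> 1\<close>, and \<open>b' (f n x) *\<^sub>R g x\<close> converges by
  domination.\<close>

lemma has_weak_gradient_compose_C1:
  fixes u :: "'a::euclidean_space \<Rightarrow> real"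
  assumes h: "has_weak_gradient Om u g" and Om: "open Om"
    and b: "\<And>t. (b has_real_derivative b' t) (at t)" "continuous_on UNIV b'" "\<And>t. \<bar>b' t\<bar> \<le> 1"
  shows "has_weak_gradient Om (\<lambda>x. b (u x)) (\<lambda>x. b' (u x) *\<^sub>R g x)"
proof (rule has_weak_gradientI)
  have lu: "loc_integrable Om u" and lg: "loc_integrable Om g" using h by (auto simp: has_weak_gradient_def)
  have cb: "continuous_on UNIV b" using b(1) by (meson DERIV_isCont continuous_at_imp_continuous_on)
  have [measurable]: "b \<in> borel_measurable borel" "b' \<in> borel_measurable borel"
    using cb b(2) by (auto intro: borel_measurable_continuous_onI)
  have Lip: "\<bar>b s - b t\<bar> \<le> \<bar>s - t\<bar>" for s t by (rule Lipschitz_derivative_bound[OF b(1,3)])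
  show "loc_integrable Om (\<lambda>x. b (u x))"
  proof (rule loc_integrable_bound[OF lu])
    show "(\<lambda>x. b (u x)) \<in> borel_measurable (lebesgue_on K)" if "compact K" "K \<subseteq> Om" for K
      using borel_measurable_loc_integrable[OF lu that] by measurable
    show "norm (b (u x)) \<le> norm (u x) + \<bar>b 0\<bar>" for x using Lip[of "u x" 0] by simp
  qed
  show "loc_integrable Om (\<lambda>x. b' (u x) *\<^sub>R g x)"
  proof (rule loc_integrable_bound[OF lg])
    show "(\<lambda>x. b' (u x) *\<^sub>R g x) \<in> borel_measurable (lebesgue_on K)" if "compact K" "K \<subseteq> Om" for K
      using borel_measurable_loc_integrable[OF lu that] borel_measurable_loc_integrable[OF lg that] by measurable
    show "norm (b' (u x) *\<^sub>R g x) \<le> norm (g x) + 0" for x using b(3) by (simp add: mult_left_le_one_le)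
  qed
  fix v :: "'a \<Rightarrow> real" and Dv i
  assume v: "v \<in> C1_compact_support Om" "\<And>x. GDERIV v x :> Dv x" and i: "i \<in> (Basis :: 'a set)"
  obtain K where K: "continuous_on UNIV Dv" "continuous_on UNIV v" "compact K" "K \<subseteq> Om"
    "\<And>x. x \<notin> K \<Longrightarrow> v x = 0" "\<And>x. x \<notin> K \<Longrightarrow> Dv x = 0"
    using C1_compact_supportE[OF v] by metis
  have KL: "K \<in> sets lebesgue" "Om \<in> sets lebesgue" using K Om by auto
  obtain f D where f: "\<And>n x. GDERIV (f n) x :> D n x" "\<And>n. continuous_on UNIV (D n)"
    "\<And>n. integrable (lebesgue_on K) (\<lambda>x. norm (f n x - u x))"
    "\<And>n. integrable (lebesgue_on K) (\<lambda>x. norm (D n x - g x))"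
    "(\<lambda>n. LINT x|lebesgue_on K. norm (f n x - u x)) \<longlonglongrightarrow> 0"
    "(\<lambda>n. LINT x|lebesgue_on K. norm (D n x - g x)) \<longlonglongrightarrow> 0"
  proof (rule local_smooth_approximation[OF h Om K(3,4)], goal_cases)
    case (1 f D)
    show ?case by (rule 1(1)[of f D]) (fact 1(2), fact 1(3), fact 1(4), fact 1(5), fact 1(6), fact 1(7))
  qed
  have iu: "integrable (lebesgue_on K) u" and ig: "integrable (lebesgue_on K) g"
    using lu lg K by (auto simp: loc_integrable_def)
  have cf: "continuous_on UNIV (f n)" for n by (rule GDERIV_continuous_on[OF f(1)])
  have [measurable]: "f n \<in> borel_measurable (lebesgue_on K)" "D n \<in> borel_measurable (lebesgue_on K)"
    "v \<in> borel_measurable (lebesgue_on K)" "Dv \<in> borel_measurable (lebesgue_on K)"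
    "u \<in> borel_measurable (lebesgue_on K)" "g \<in> borel_measurable (lebesgue_on K)" for n
    using borel_measurable_lebesgue_on_continuous[OF cf] borel_measurable_lebesgue_on_continuous[OF f(2)]
      borel_measurable_lebesgue_on_continuous[OF K(1)] borel_measurable_lebesgue_on_continuous[OF K(2)]
      borel_measurable_integrable[OF iu] borel_measurable_integrable[OF ig] by auto
  obtain Bv where Bv: "0 \<le> Bv" "\<And>x. \<bar>v x\<bar> \<le> Bv" "\<And>x. \<bar>Dv x \<bullet> i\<bar> \<le> Bv"
  proof -
    have z: "(v x, Dv x) = 0" if "x \<notin> K" for x using K(5,6)[OF that] by (simp add: zero_prod_def)
    obtain r where r: "0 < r" "\<And>x. r \<le> norm x \<Longrightarrow> (v x, Dv x) = 0"
      using bounded_vanish_norm[OF compact_imp_bounded[OF K(3)], of "\<lambda>x. (v x, Dv x)"] z by blast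
    obtain B where B: "0 \<le> B" "\<And>x. norm (v x, Dv x) \<le> B"
      using bounded_continuous_compact_support[OF continuous_on_Pair[OF K(2,1)] r(2)] by blast
    show ?thesis
    proof (rule that[OF B(1)])
      show "\<bar>v x\<bar> \<le> B" for x using norm_fst_le[of "v x" "Dv x"] B(2)[of x] by simp
      show "\<bar>Dv x \<bullet> i\<bar> \<le> B" for x
        using norm_snd_le[of "Dv x" "v x"] B(2)[of x] Basis_le_norm[OF i, of "Dv x"] by simp
    qed
  qed
  \<comment> \<open>Convergence in mean gives pointwise convergence only along a subsequence; it is
    used for \<open>b' (f n x)\<close>, where continuity of \<open>b'\<close> is all that is
    available.\<close>
  obtain r where r: "strict_mono r" "AE x in lebesgue_on K. (\<lambda>n. f (r n) x - u x) \<longlonglongrightarrow> 0"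
  proof -
    have "integrable (lebesgue_on K) (\<lambda>x. f n x - u x)" for n
      using f(3)[of n] by (subst integrable_norm_iff[symmetric]) auto
    then show ?thesis using tendsto_L1_AE_subseq[of "lebesgue_on K" "\<lambda>n x. f n x - u x"] f(5) that by blast
  qed
  have eqn: "(LINT x|lebesgue_on K. b (f n x) * (Dv x \<bullet> i)) = - (LINT x|lebesgue_on K. (b' (f n x) *\<^sub>R D n x \<bullet> i) * v x)" for n
  proof -
    have G: "GDERIV (\<lambda>x. b (f n x)) x :> b' (f n x) *\<^sub>R D n x" for x
      using has_derivative_compose[OF f(1)[of n x, unfolded gderiv_def] b(1)[of "f n x", unfolded has_field_derivative_def]]
      by (simp add: gderiv_def mult.commute)
    have "has_weak_gradient Om (\<lambda>x. b (f n x)) (\<lambda>x. b' (f n x) *\<^sub>R D n x)"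
    proof (rule has_weak_gradient_C1[OF Om G])
      have "continuous_on UNIV (\<lambda>x. b' (f n x))"
        by (rule continuous_on_compose2[OF b(2) cf]) auto
      then show "continuous_on UNIV (\<lambda>x. b' (f n x) *\<^sub>R D n x)" by (intro continuous_on_scaleR f(2))
    qed
    from has_weak_gradientD[OF this v i] show ?thesis
      using KL K by (simp add: integral_lebesgue_on_subset_vanish[of Om K])
  qed
  have L1: "(\<lambda>n. LINT x|lebesgue_on K. b (f n x) * (Dv x \<bullet> i)) \<longlonglongrightarrow> (LINT x|lebesgue_on K. b (u x) * (Dv x \<bullet> i))"
  proof (rule LIM_zero_cancel, rule Lim_null_comparison[OF always_eventually tendsto_mult_right_zero[OF f(5), of Bv]], rule allI)
    fix n
    have bi: "integrable (lebesgue_on K) (\<lambda>x. b (w x) * (Dv x \<bullet> i))" if w: "integrable (lebesgue_on K) w" for w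
    proof (rule Bochner_Integration.integrable_bound)
      have c: "integrable (lebesgue_on K) (\<lambda>x. \<bar>b 0\<bar>)"
        using loc_integrable_continuous[of "\<lambda>x. \<bar>b 0\<bar>" K] K by (auto simp: loc_integrable_def)
      show "integrable (lebesgue_on K) (\<lambda>x. Bv * (\<bar>w x\<bar> + \<bar>b 0\<bar>))" using w c by simp
      show "(\<lambda>x. b (w x) * (Dv x \<bullet> i)) \<in> borel_measurable (lebesgue_on K)" using borel_measurable_integrable[OF w] by measurable
      show "AE x in lebesgue_on K. norm (b (w x) * (Dv x \<bullet> i)) \<le> norm (Bv * (\<bar>w x\<bar> + \<bar>b 0\<bar>))"
      proof (rule AE_I2)
        fix x
        have "\<bar>b (w x)\<bar> * \<bar>Dv x \<bullet> i\<bar> \<le> (\<bar>w x\<bar> + \<bar>b 0\<bar>) * Bv"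
          using Lip[of "w x" 0] Bv by (intro mult_mono) auto
        then show "norm (b (w x) * (Dv x \<bullet> i)) \<le> norm (Bv * (\<bar>w x\<bar> + \<bar>b 0\<bar>))"
          using Bv(1) by (simp add: abs_mult mult.commute)
      qed
    qed
    have ifn: "integrable (lebesgue_on K) (f n)" using loc_integrable_continuous[OF cf] K by (auto simp: loc_integrable_def)
    have "norm ((LINT x|lebesgue_on K. b (f n x) * (Dv x \<bullet> i)) - (LINT x|lebesgue_on K. b (u x) * (Dv x \<bullet> i)))
      = norm (LINT x|lebesgue_on K. b (f n x) * (Dv x \<bullet> i) - b (u x) * (Dv x \<bullet> i))"
      using bi[OF ifn] bi[OF iu] by simp
    also have "\<dots> \<le> (LINT x|lebesgue_on K. norm (b (f n x) * (Dv x \<bullet> i) - b (u x) * (Dv x \<bullet> i)))"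
      by (rule integral_norm_bound)
    also have "\<dots> \<le> (LINT x|lebesgue_on K. Bv * norm (f n x - u x))"
    proof (rule integral_mono)
      show "integrable (lebesgue_on K) (\<lambda>x. norm (b (f n x) * (Dv x \<bullet> i) - b (u x) * (Dv x \<bullet> i)))"
        using bi[OF ifn] bi[OF iu] by (intro integrable_norm Bochner_Integration.integrable_diff)
      show "integrable (lebesgue_on K) (\<lambda>x. Bv * norm (f n x - u x))" using f(3) by simp
      fix x
      have "\<bar>b (f n x) - b (u x)\<bar> * \<bar>Dv x \<bullet> i\<bar> \<le> \<bar>f n x - u x\<bar> * Bv"
        using Lip Bv by (intro mult_mono) auto
      then show "norm (b (f n x) * (Dv x \<bullet> i) - b (u x) * (Dv x \<bullet> i)) \<le> Bv * norm (f n x - u x)"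
        by (simp only: left_diff_distrib[symmetric] real_norm_def abs_mult mult.commute[of Bv])
    qed
    finally show "norm ((LINT x|lebesgue_on K. b (f n x) * (Dv x \<bullet> i)) - (LINT x|lebesgue_on K. b (u x) * (Dv x \<bullet> i))) \<le> Bv * (LINT x|lebesgue_on K. norm (f n x - u x))"
      by simp
  qed
  have bound: "norm ((b' s *\<^sub>R y \<bullet> i) * v x) \<le> Bv * norm y" for s y x
  proof -
    have "\<bar>b' s\<bar> * \<bar>y \<bullet> i\<bar> \<le> 1 * norm y" using b(3) Basis_le_norm[OF i, of y] by (intro mult_mono) auto
    then have "(\<bar>b' s\<bar> * \<bar>y \<bullet> i\<bar>) * \<bar>v x\<bar> \<le> norm y * Bv" using Bv by (intro mult_mono) auto
    then show ?thesis by (simp add: abs_mult mult.commute)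
  qed
  have i2: "integrable (lebesgue_on K) (\<lambda>x. (b' (w x) *\<^sub>R y x \<bullet> i) * v x)"
    if "integrable (lebesgue_on K) y" "w \<in> borel_measurable (lebesgue_on K)" for w y
  proof (rule Bochner_Integration.integrable_bound)
    show "integrable (lebesgue_on K) (\<lambda>x. Bv * norm (y x))" using that by simp
    show "(\<lambda>x. (b' (w x) *\<^sub>R y x \<bullet> i) * v x) \<in> borel_measurable (lebesgue_on K)"
      using that by measurable
    show "AE x in lebesgue_on K. norm ((b' (w x) *\<^sub>R y x \<bullet> i) * v x) \<le> norm (Bv * norm (y x))"
      using bound Bv(1) by (intro AE_I2) (simp add: abs_mult)
  qed
  have iDn: "integrable (lebesgue_on K) (D n)" for n using loc_integrable_continuous[OF f(2)] K by (auto simp: loc_integrable_def)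
  have L2a: "(\<lambda>n. LINT x|lebesgue_on K. (b' (f (r n) x) *\<^sub>R g x \<bullet> i) * v x) \<longlonglongrightarrow> (LINT x|lebesgue_on K. (b' (u x) *\<^sub>R g x \<bullet> i) * v x)"
  proof (rule integral_dominated_convergence)
    show "integrable (lebesgue_on K) (\<lambda>x. Bv * norm (g x))" using ig by simp
    show "AE x in lebesgue_on K. (\<lambda>n. (b' (f (r n) x) *\<^sub>R g x \<bullet> i) * v x) \<longlonglongrightarrow> (b' (u x) *\<^sub>R g x \<bullet> i) * v x"
      using r(2)
    proof (rule eventually_mono)
      fix x assume "(\<lambda>n. f (r n) x - u x) \<longlonglongrightarrow> 0"
      then have "(\<lambda>n. f (r n) x) \<longlonglongrightarrow> u x" by (rule LIM_zero_cancel)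
      then have "(\<lambda>n. b' (f (r n) x)) \<longlonglongrightarrow> b' (u x)"
        by (intro continuous_on_tendsto_compose[OF b(2)]) auto
      then show "(\<lambda>n. (b' (f (r n) x) *\<^sub>R g x \<bullet> i) * v x) \<longlonglongrightarrow> (b' (u x) *\<^sub>R g x \<bullet> i) * v x"
        by (intro tendsto_intros)
    qed
    show "AE x in lebesgue_on K. norm ((b' (f (r n) x) *\<^sub>R g x \<bullet> i) * v x) \<le> Bv * norm (g x)" for n
      using bound by (intro AE_I2)
  qed measurable
  have L2b: "(\<lambda>n. LINT x|lebesgue_on K. (b' (f n x) *\<^sub>R (D n x - g x) \<bullet> i) * v x) \<longlonglongrightarrow> 0"
  proof (rule Lim_null_comparison[OF always_eventually tendsto_mult_right_zero[OF f(6), of Bv]], rule allI)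
    fix n
    have id: "integrable (lebesgue_on K) (\<lambda>x. D n x - g x)" using iDn ig by simp
    have "norm (LINT x|lebesgue_on K. (b' (f n x) *\<^sub>R (D n x - g x) \<bullet> i) * v x)
      \<le> (LINT x|lebesgue_on K. norm ((b' (f n x) *\<^sub>R (D n x - g x) \<bullet> i) * v x))"
      by (rule integral_norm_bound)
    also have "\<dots> \<le> (LINT x|lebesgue_on K. Bv * norm (D n x - g x))"
      using i2[OF id, of "f n"] f(4)[of n] bound by (intro integral_mono) (auto intro: integrable_norm)
    finally show "norm (LINT x|lebesgue_on K. (b' (f n x) *\<^sub>R (D n x - g x) \<bullet> i) * v x) \<le> Bv * (LINT x|lebesgue_on K. norm (D n x - g x))"
      by simp
  qed
  have "(\<lambda>n. (LINT x|lebesgue_on K. (b' (f (r n) x) *\<^sub>R (D (r n) x - g x) \<bullet> i) * v x) + (LINT x|lebesgue_on K. (b' (f (r n) x) *\<^sub>R g x \<bullet> i) * v x))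
    \<longlonglongrightarrow> 0 + (LINT x|lebesgue_on K. (b' (u x) *\<^sub>R g x \<bullet> i) * v x)"
    using LIMSEQ_subseq_LIMSEQ[OF L2b r(1)] by (intro tendsto_add L2a) (simp add: comp_def)
  moreover have "(LINT x|lebesgue_on K. (b' (f n x) *\<^sub>R (D n x - g x) \<bullet> i) * v x) + (LINT x|lebesgue_on K. (b' (f n x) *\<^sub>R g x \<bullet> i) * v x)
      = (LINT x|lebesgue_on K. (b' (f n x) *\<^sub>R D n x \<bullet> i) * v x)" for n
  proof -
    have id: "integrable (lebesgue_on K) (\<lambda>x. D n x - g x)" using iDn ig by simp
    show ?thesis
      by (subst Bochner_Integration.integral_add[OF i2[OF id] i2[OF ig], symmetric])
        (auto intro!: Bochner_Integration.integral_cong simp: algebra_simps inner_diff_left)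
  qed
  ultimately have "(\<lambda>n. - (LINT x|lebesgue_on K. (b' (f (r n) x) *\<^sub>R D (r n) x \<bullet> i) * v x)) \<longlonglongrightarrow> - (LINT x|lebesgue_on K. (b' (u x) *\<^sub>R g x \<bullet> i) * v x)"
    by (intro tendsto_minus) simp
  moreover have "(\<lambda>n. - (LINT x|lebesgue_on K. (b' (f (r n) x) *\<^sub>R D (r n) x \<bullet> i) * v x)) \<longlonglongrightarrow> (LINT x|lebesgue_on K. b (u x) * (Dv x \<bullet> i))"
    using LIMSEQ_subseq_LIMSEQ[OF L1 r(1)] unfolding eqn comp_def .
  ultimately have "(LINT x|lebesgue_on K. b (u x) * (Dv x \<bullet> i)) = - (LINT x|lebesgue_on K. (b' (u x) *\<^sub>R g x \<bullet> i) * v x)"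
    by (rule LIMSEQ_unique[rotated])
  then show "(LINT x|lebesgue_on Om. b (u x) * (Dv x \<bullet> i)) = - (LINT x|lebesgue_on Om. (b' (u x) *\<^sub>R g x \<bullet> i) * v x)"
    using KL K by (simp add: integral_lebesgue_on_subset_vanish[of Om K])
qed

text \<open>Both limits are only pointwise, so \<open>c'\<close> need not be continuous nor be the
  derivative of \<open>c\<close>: this covers the absolute value and also a zero limit whose
  derivatives tend to 1 at one point. The bounds on \<open>b' n\<close> and on \<open>b n 0\<close>
  give \<open>\<bar>b n t\<bar> \<le> \<bar>t\<bar> + 1\<close>, the domination for the
  values.\<close>

lemma has_weak_gradient_compose_limit:
  fixes u :: "'a::euclidean_space \<Rightarrow> real"
  assumes h: "has_weak_gradient Om u g" and Om: "open Om"
    and b: "\<And>n t. (b n has_real_derivative b' n t) (at t)" "\<And>n. continuous_on UNIV (b' n)" "\<And>n t. \<bar>b' n t\<bar> \<le> 1"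
    and b0: "\<And>n. \<bar>b n 0\<bar> \<le> 1"
    and lim: "\<And>t. (\<lambda>n. b n t) \<longlonglongrightarrow> c t" "\<And>t. (\<lambda>n. b' n t) \<longlonglongrightarrow> c' t"
  shows "has_weak_gradient Om (\<lambda>x. c (u x)) (\<lambda>x. c' (u x) *\<^sub>R g x)"
proof (rule has_weak_gradientI)
  have lu: "loc_integrable Om u" and lg: "loc_integrable Om g" using h by (auto simp: has_weak_gradient_def)
  have cb: "continuous_on UNIV (b n)" for n using b(1) by (meson DERIV_isCont continuous_at_imp_continuous_on)
  have [measurable]: "b n \<in> borel_measurable borel" "b' n \<in> borel_measurable borel" for n
    using cb b(2) by (auto intro: borel_measurable_continuous_onI)
  have [measurable]: "c \<in> borel_measurable borel" "c' \<in> borel_measurable borel"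
    by (rule borel_measurable_LIMSEQ_real[OF lim(1)], simp) (rule borel_measurable_LIMSEQ_real[OF lim(2)], simp)
  have bb: "\<bar>b n t\<bar> \<le> \<bar>t\<bar> + 1" for n t
    using Lipschitz_derivative_bound[OF b(1,3), of n t 0] b0[of n] by linarith
  have cc: "\<bar>c t\<bar> \<le> \<bar>t\<bar> + 1" for t
    by (rule tendsto_upperbound[OF tendsto_rabs[OF lim(1)]]) (auto simp: bb)
  have cc': "\<bar>c' t\<bar> \<le> 1" for t
    by (rule tendsto_upperbound[OF tendsto_rabs[OF lim(2)]]) (auto simp: b)
  show lcu: "loc_integrable Om (\<lambda>x. c (u x))"
  proof (rule loc_integrable_bound[OF lu])
    show "(\<lambda>x. c (u x)) \<in> borel_measurable (lebesgue_on K)" if "compact K" "K \<subseteq> Om" for K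
      using borel_measurable_loc_integrable[OF lu that] by measurable
    show "norm (c (u x)) \<le> norm (u x) + 1" for x using cc by simp
  qed
  show lcg: "loc_integrable Om (\<lambda>x. c' (u x) *\<^sub>R g x)"
  proof (rule loc_integrable_bound[OF lg])
    show "(\<lambda>x. c' (u x) *\<^sub>R g x) \<in> borel_measurable (lebesgue_on K)" if "compact K" "K \<subseteq> Om" for K
      using borel_measurable_loc_integrable[OF lu that] borel_measurable_loc_integrable[OF lg that] by measurable
    show "norm (c' (u x) *\<^sub>R g x) \<le> norm (g x) + 0" for x using cc' by (simp add: mult_left_le_one_le)
  qed
  fix v :: "'a \<Rightarrow> real" and D i
  assume v: "v \<in> C1_compact_support Om" "\<And>x. GDERIV v x :> D x" and i: "i \<in> (Basis :: 'a set)"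
  obtain K where K: "continuous_on UNIV D" "continuous_on UNIV v" "compact K" "K \<subseteq> Om"
    "\<And>x. x \<notin> K \<Longrightarrow> v x = 0" "\<And>x. x \<notin> K \<Longrightarrow> D x = 0"
    using C1_compact_supportE[OF v] by metis
  have KL: "K \<in> sets lebesgue" "Om \<in> sets lebesgue" using K Om by auto
  have iu: "integrable (lebesgue_on K) u" and ig: "integrable (lebesgue_on K) g"
    using lu lg K by (auto simp: loc_integrable_def)
  have [measurable]: "v \<in> borel_measurable (lebesgue_on K)" "D \<in> borel_measurable (lebesgue_on K)"
    "u \<in> borel_measurable (lebesgue_on K)" "g \<in> borel_measurable (lebesgue_on K)"
    using borel_measurable_lebesgue_on_continuous[OF K(1)] borel_measurable_lebesgue_on_continuous[OF K(2)]
      borel_measurable_integrable[OF iu] borel_measurable_integrable[OF ig] by auto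
  have ha: "has_weak_gradient Om (\<lambda>x. b n (u x)) (\<lambda>x. b' n (u x) *\<^sub>R g x)" for n
    by (rule has_weak_gradient_compose_C1[OF h Om b])
  have A: "(\<lambda>n. LINT x|lebesgue_on K. b n (u x) * (D x \<bullet> i)) \<longlonglongrightarrow> (LINT x|lebesgue_on K. c (u x) * (D x \<bullet> i))"
  proof (rule integral_dominated_convergence)
    have "loc_integrable Om (\<lambda>x. \<bar>u x\<bar> + 1)"
      by (rule loc_integrable_bound[OF lu, of _ 1]) (use borel_measurable_loc_integrable[OF lu] in auto)
    from loc_integrable_mult_continuous[OF this Om, of "\<lambda>x. \<bar>D x \<bullet> i\<bar>" K]
    have "integrable (lebesgue_on Om) (\<lambda>x. \<bar>D x \<bullet> i\<bar> *\<^sub>R (\<bar>u x\<bar> + 1))"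
      using K by (simp add: continuous_on_inner continuous_on_rabs)
    then show "integrable (lebesgue_on K) (\<lambda>x. \<bar>D x \<bullet> i\<bar> *\<^sub>R (\<bar>u x\<bar> + 1))"
      by (rule integrable_lebesgue_on_subset[OF _ KL(2,1) K(4)])
    show "AE x in lebesgue_on K. (\<lambda>n. b n (u x) * (D x \<bullet> i)) \<longlonglongrightarrow> c (u x) * (D x \<bullet> i)"
      by (intro AE_I2 tendsto_intros lim)
    show "AE x in lebesgue_on K. norm (b n (u x) * (D x \<bullet> i)) \<le> \<bar>D x \<bullet> i\<bar> *\<^sub>R (\<bar>u x\<bar> + 1)" for n
      using mult_right_mono[OF bb] by (intro AE_I2) (auto simp: abs_mult mult.commute)
  qed measurable
  have B: "(\<lambda>n. LINT x|lebesgue_on K. (b' n (u x) *\<^sub>R g x \<bullet> i) * v x) \<longlonglongrightarrow> (LINT x|lebesgue_on K. (c' (u x) *\<^sub>R g x \<bullet> i) * v x)"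
  proof (rule integral_dominated_convergence)
    have "integrable (lebesgue_on Om) (\<lambda>x. norm ((g x \<bullet> i) * v x))"
      using weak_test_integrable(2)[OF h Om v] by (rule integrable_norm)
    then show "integrable (lebesgue_on K) (\<lambda>x. norm ((g x \<bullet> i) * v x))"
      by (rule integrable_lebesgue_on_subset[OF _ KL(2,1) K(4)])
    show "AE x in lebesgue_on K. (\<lambda>n. (b' n (u x) *\<^sub>R g x \<bullet> i) * v x) \<longlonglongrightarrow> (c' (u x) *\<^sub>R g x \<bullet> i) * v x"
      by (intro AE_I2 tendsto_intros lim)
    show "AE x in lebesgue_on K. norm ((b' n (u x) *\<^sub>R g x \<bullet> i) * v x) \<le> norm ((g x \<bullet> i) * v x)" for n
      using b(3) by (intro AE_I2) (auto simp: abs_mult mult.assoc intro!: mult_left_le_one_le)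
  qed measurable
  have "(LINT x|lebesgue_on K. b n (u x) * (D x \<bullet> i)) = - (LINT x|lebesgue_on K. (b' n (u x) *\<^sub>R g x \<bullet> i) * v x)" for n
    using has_weak_gradientD[OF ha v i, of n] KL K by (simp add: integral_lebesgue_on_subset_vanish[of Om K])
  then have "(LINT x|lebesgue_on K. c (u x) * (D x \<bullet> i)) = - (LINT x|lebesgue_on K. (c' (u x) *\<^sub>R g x \<bullet> i) * v x)"
    using A tendsto_minus[OF B] by (auto intro: LIMSEQ_unique)
  then show "(LINT x|lebesgue_on Om. c (u x) * (D x \<bullet> i)) = - (LINT x|lebesgue_on Om. (c' (u x) *\<^sub>R g x \<bullet> i) * v x)"
    using KL K by (simp add: integral_lebesgue_on_subset_vanish[of Om K])
qed

text \<open>The absolute value is smoothed to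
  \<open>sqrt (t\<^sup>2 + (1 / real (Suc n))\<^sup>2)\<close>. The derivatives at 0 are all 0, so
  their limit is \<open>sgn\<close> at every point, including the kink.\<close>

lemma has_weak_gradient_abs:
  fixes u :: "'a::euclidean_space \<Rightarrow> real"
  assumes h: "has_weak_gradient Om u g" and Om: "open Om"
  shows "has_weak_gradient Om (\<lambda>x. \<bar>u x\<bar>) (\<lambda>x. sgn (u x) *\<^sub>R g x)"
proof (rule has_weak_gradient_compose_limit[OF h Om, where b = "\<lambda>n t. sqrt (t\<^sup>2 + (1 / real (Suc n))\<^sup>2)" and b' = "\<lambda>n t. t / sqrt (t\<^sup>2 + (1 / real (Suc n))\<^sup>2)"])
  have pos: "0 < t\<^sup>2 + (1 / real (Suc n))\<^sup>2" for t n by (intro add_nonneg_pos) auto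
  show "((\<lambda>t. sqrt (t\<^sup>2 + (1 / real (Suc n))\<^sup>2)) has_real_derivative t / sqrt (t\<^sup>2 + (1 / real (Suc n))\<^sup>2)) (at t)" for n t
    using pos[of t n] by (auto intro!: derivative_eq_intros simp: divide_simps)
  show "continuous_on UNIV (\<lambda>t. t / sqrt (t\<^sup>2 + (1 / real (Suc n))\<^sup>2))" for n
    using pos by (intro continuous_intros) (simp add: less_imp_neq[symmetric] del: power_divide)
  show "\<bar>t / sqrt (t\<^sup>2 + (1 / real (Suc n))\<^sup>2)\<bar> \<le> 1" for n t
  proof -
    have "\<bar>t\<bar> \<le> sqrt (t\<^sup>2 + (1 / real (Suc n))\<^sup>2)" by (intro real_le_rsqrt) auto
    then show ?thesis using pos[of t n] by (simp add: abs_divide divide_le_eq_1 del: power_divide)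
  qed
  show "\<bar>sqrt (0\<^sup>2 + (1 / real (Suc n))\<^sup>2)\<bar> \<le> 1" for n by simp
  have l0: "(\<lambda>n. sqrt (t\<^sup>2 + (1 / real (Suc n))\<^sup>2)) \<longlonglongrightarrow> sqrt (t\<^sup>2 + 0\<^sup>2)" for t
    by (intro tendsto_intros seq_inverse_tendsto)
  then show "(\<lambda>n. sqrt (t\<^sup>2 + (1 / real (Suc n))\<^sup>2)) \<longlonglongrightarrow> \<bar>t\<bar>" for t by simp
  show "(\<lambda>n. t / sqrt (t\<^sup>2 + (1 / real (Suc n))\<^sup>2)) \<longlonglongrightarrow> sgn t" for t
  proof (cases "t = 0")
    case False
    then have "(\<lambda>n. t / sqrt (t\<^sup>2 + (1 / real (Suc n))\<^sup>2)) \<longlonglongrightarrow> t / sqrt (t\<^sup>2 + 0\<^sup>2)"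
      by (intro tendsto_divide l0 tendsto_const) auto
    moreover have "t / sqrt (t\<^sup>2 + 0\<^sup>2) = sgn t" using False by (auto simp: sgn_if)
    ultimately show ?thesis by simp
  qed auto
qed

text \<open>The functions \<open>arctan (n * u) / n\<close> tend to \<open>0\<close>, while their gradients tend to \<open>g\<close> on \<open>{u = 0}\<close>
  and to \<open>0\<close> elsewhere.\<close>

lemma weak_gradient_zero_on_level:
  fixes u :: "'a::euclidean_space \<Rightarrow> real"
  assumes h: "has_weak_gradient Om u g" and Om: "open Om"
  shows "AE x in lebesgue_on Om. u x = 0 \<longrightarrow> g x = 0"
proof -
  have "has_weak_gradient Om (\<lambda>x. (\<lambda>t. 0) (u x)) (\<lambda>x. (if u x = 0 then 1 else 0 :: real) *\<^sub>R g x)"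
  proof (rule has_weak_gradient_compose_limit[OF h Om, where b = "\<lambda>n t. (1 / real (Suc n)) * arctan (t * real (Suc n))" and b' = "\<lambda>n t. 1 / (1 + (t * real (Suc n))\<^sup>2)"])
    have pos: "0 < 1 + (t * real (Suc n))\<^sup>2" for t n by (intro add_pos_nonneg) auto
    show "((\<lambda>t. (1 / real (Suc n)) * arctan (t * real (Suc n))) has_real_derivative 1 / (1 + (t * real (Suc n))\<^sup>2)) (at t)" for n t
    proof -
      define s where "s = real (Suc n)"
      have s: "0 < s" by (simp add: s_def)
      have "((\<lambda>t. arctan (t * s)) has_real_derivative inverse (1 + (t * s)\<^sup>2) * s) (at t)"
        by (auto intro!: derivative_eq_intros)
      from DERIV_cmult[OF this, of "1 / s"] show ?thesis
        using s unfolding s_def[symmetric] by (simp add: inverse_eq_divide)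
    qed
    show "continuous_on UNIV (\<lambda>t. 1 / (1 + (t * real (Suc n))\<^sup>2))" for n
      using pos by (intro continuous_intros) (simp add: less_imp_neq[symmetric] del: of_nat_Suc)
    show "\<bar>1 / (1 + (t * real (Suc n))\<^sup>2)\<bar> \<le> 1" for n t
      using pos[of t n] by (simp add: abs_divide divide_le_eq_1)
    show "\<bar>(1 / real (Suc n)) * arctan (0 * real (Suc n))\<bar> \<le> 1" for n by simp
    show "(\<lambda>n. (1 / real (Suc n)) * arctan (t * real (Suc n))) \<longlonglongrightarrow> 0" for t
    proof (rule Lim_null_comparison[OF always_eventually seq_inverse_tendsto[of 2]], rule allI)
      fix n
      have "\<bar>arctan (t * real (Suc n))\<bar> \<le> 2"
        using arctan_bounded[of "t * real (Suc n)"] pi_less_4 by linarith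
      then show "norm ((1 / real (Suc n)) * arctan (t * real (Suc n))) \<le> 2 / real (Suc n)"
        by (simp add: abs_mult divide_right_mono)
    qed
    show "(\<lambda>n. 1 / (1 + (t * real (Suc n))\<^sup>2)) \<longlonglongrightarrow> (if t = 0 then 1 else 0)" for t
    proof (cases "t = 0")
      case False
      show ?thesis
      proof (rule Lim_null_comparison[OF always_eventually, THEN tendsto_eq_rhs])
        show "(\<lambda>n. (1 / t\<^sup>2) / real (Suc n)) \<longlonglongrightarrow> 0" by (rule seq_inverse_tendsto)
        show "\<forall>n. norm (1 / (1 + (t * real (Suc n))\<^sup>2)) \<le> (1 / t\<^sup>2) / real (Suc n)"
        proof
          fix n
          have "t\<^sup>2 * real (Suc n) \<le> t\<^sup>2 * (real (Suc n))\<^sup>2"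
            by (intro mult_left_mono) (auto simp: power2_eq_square)
          also have "\<dots> \<le> 1 + (t * real (Suc n))\<^sup>2" by (simp add: power_mult_distrib)
          finally show "norm (1 / (1 + (t * real (Suc n))\<^sup>2)) \<le> (1 / t\<^sup>2) / real (Suc n)"
            using False pos[of t n] by (simp add: abs_divide frac_le del: of_nat_Suc)
        qed
      qed (use False in simp)
    qed simp
  qed
  \<comment> \<open>The zero function has just received \<open>g\<close> restricted to the zero set
    of \<open>u\<close> as a weak gradient; uniqueness makes that restriction vanish.\<close>
  then have "AE x in lebesgue_on Om. (if u x = 0 then 1 else 0 :: real) *\<^sub>R g x = 0"
    by (intro weak_gradient_zero_unique[OF _ Om]) simp
  then show ?thesis by (rule eventually_mono) auto
qed

section \<open>Sobolev functions with zero boundary values\<close>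

text \<open>Carries an explicit weak gradient along instead of the one selected by
  \<open>SOME\<close>, so that the gradients of sums, minima and maxima can be given by
  formulas.\<close>

definition sobolev :: "real \<Rightarrow> 'a::euclidean_space set \<Rightarrow> ('a \<Rightarrow> real) \<Rightarrow> ('a \<Rightarrow> 'a) \<Rightarrow> bool" where
  "sobolev p Om u g \<longleftrightarrow> has_weak_gradient Om u g \<and> u \<in> Lp_space p Om \<and> g \<in> Lp_space p Om"

lemma Lp_space_dominated:
  fixes f :: "'a::euclidean_space \<Rightarrow> 'b::euclidean_space" and g :: "'a \<Rightarrow> 'c::euclidean_space" and h :: "'a \<Rightarrow> 'd::euclidean_space"
  assumes f: "f \<in> Lp_space p Om" and g: "g \<in> Lp_space p Om" and h: "h \<in> borel_measurable (lebesgue_on Om)"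
    and le: "AE x in lebesgue_on Om. norm (h x) \<le> norm (f x) + norm (g x)" and p: "0 \<le> p"
  shows "h \<in> Lp_space p Om"
proof -
  have "integrable (lebesgue_on Om) (\<lambda>x. norm (h x) powr p)"
  proof (rule Bochner_Integration.integrable_bound)
    show "integrable (lebesgue_on Om) (\<lambda>x. 2 powr p * (norm (f x) powr p + norm (g x) powr p))"
      using f g by (auto simp: Lp_space_def)
    show "AE x in lebesgue_on Om. norm (norm (h x) powr p) \<le> norm (2 powr p * (norm (f x) powr p + norm (g x) powr p))"
      using le
    proof (rule eventually_mono)
      fix x assume "norm (h x) \<le> norm (f x) + norm (g x)"
      then have "norm (h x) powr p \<le> (norm (f x) + norm (g x)) powr p" using p by (intro powr_mono2) auto
      also have "\<dots> \<le> 2 powr p * (norm (f x) powr p + norm (g x) powr p)" using p by (intro powr_add_le) auto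
      finally show "norm (norm (h x) powr p) \<le> norm (2 powr p * (norm (f x) powr p + norm (g x) powr p))" by simp
    qed
  qed (use h in measurable)
  then show ?thesis using h by (simp add: Lp_space_def)
qed

lemma Lp_space_add: "0 \<le> p \<Longrightarrow> f \<in> Lp_space p Om \<Longrightarrow> g \<in> Lp_space p Om \<Longrightarrow> (\<lambda>x. f x + g x) \<in> Lp_space p Om"
  by (rule Lp_space_dominated[where f = f and g = g]) (auto simp: Lp_space_def norm_triangle_ineq)

lemma Lp_space_diff: "0 \<le> p \<Longrightarrow> f \<in> Lp_space p Om \<Longrightarrow> g \<in> Lp_space p Om \<Longrightarrow> (\<lambda>x. f x - g x) \<in> Lp_space p Om"
  by (rule Lp_space_dominated[where f = f and g = g]) (auto simp: Lp_space_def norm_triangle_ineq4)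

lemma Lp_space_minus: "f \<in> Lp_space p Om \<Longrightarrow> (\<lambda>x. - f x) \<in> Lp_space p Om"
  by (auto simp: Lp_space_def)

lemma Lp_space_cong_AE:
  assumes f: "f \<in> Lp_space p Om" and Om: "Om \<in> sets lebesgue" and ae: "AE x in lebesgue_on Om. f x = g x"
  shows "g \<in> Lp_space p Om"
proof -
  have "g \<in> borel_measurable (lebesgue_on Om)"
    using f by (intro borel_measurable_lebesgue_on_cong_AE[OF Om _ ae]) (simp add: Lp_space_def)
  moreover have "integrable (lebesgue_on Om) (\<lambda>x. norm (g x) powr p)"
    by (rule integrable_lebesgue_on_cong_AE[OF Om, of "\<lambda>x. norm (f x) powr p"])
      (use f ae in \<open>auto simp: Lp_space_def elim!: eventually_mono\<close>)
  ultimately show ?thesis by (simp add: Lp_space_def)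
qed

lemma Lp_norm_cong_AE:
  assumes Om: "Om \<in> sets lebesgue" and ae: "AE x in lebesgue_on Om. f x = g x"
  shows "Lp_norm p Om f = Lp_norm p Om g"
proof -
  have "(LINT x|lebesgue_on Om. norm (f x) powr p) = (LINT x|lebesgue_on Om. norm (g x) powr p)"
    by (rule integral_lebesgue_on_cong_AE[OF Om]) (use ae in \<open>auto elim!: eventually_mono\<close>)
  then show ?thesis by (simp add: Lp_norm_def)
qed

lemma Lp_space_subset:
  assumes "f \<in> Lp_space p S" "S \<in> sets lebesgue" "T \<in> sets lebesgue" "T \<subseteq> S"
  shows "f \<in> Lp_space p T"
proof -
  have "f \<in> borel_measurable (lebesgue_on T)"
  proof -
    have "(\<lambda>x. indicator T x *\<^sub>R (indicator S x *\<^sub>R f x)) \<in> borel_measurable lebesgue"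
      using assms by (intro borel_measurable_scaleR[OF borel_measurable_indicator[OF assms(3)]])
        (simp add: Lp_space_def borel_measurable_restrict_space_iff)
    also have "(\<lambda>x. indicator T x *\<^sub>R (indicator S x *\<^sub>R f x)) = (\<lambda>x. indicator T x *\<^sub>R f x)"
      using assms(4) by (auto simp: indicator_def fun_eq_iff)
    finally show ?thesis using assms(3) by (simp add: borel_measurable_restrict_space_iff)
  qed
  moreover have "integrable (lebesgue_on T) (\<lambda>x. norm (f x) powr p)"
    by (rule integrable_lebesgue_on_subset[OF _ assms(2-4)]) (use assms(1) in \<open>simp add: Lp_space_def\<close>)
  ultimately show ?thesis by (simp add: Lp_space_def)
qed

lemma Lp_space_bounded:
  fixes f :: "'a::euclidean_space \<Rightarrow> 'b::euclidean_space"
  assumes f: "f \<in> borel_measurable (lebesgue_on Om)" and Om: "open Om" "bounded Om"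
    and B: "AE x in lebesgue_on Om. norm (f x) \<le> B" and p: "0 \<le> p"
  shows "f \<in> Lp_space p Om"
proof -
  have "Om \<in> lmeasurable" using Om by (simp add: lmeasurable_open)
  then have "integrable lebesgue (\<lambda>x. indicat_real Om x *\<^sub>R c)" for c :: real
    by (intro integrable_scaleR_left) (simp add: lmeasurable_iff_integrable)
  then have c: "integrable (lebesgue_on Om) (\<lambda>x. c :: real)" for c
    using Om by (subst integrable_lebesgue_on_iff) auto
  have "integrable (lebesgue_on Om) (\<lambda>x. norm (f x) powr p)"
  proof (rule Bochner_Integration.integrable_bound[OF c])
    show "AE x in lebesgue_on Om. norm (norm (f x) powr p) \<le> norm (\<bar>B\<bar> powr p)"
      using B by (rule eventually_mono) (use p in \<open>auto intro!: powr_mono2\<close>)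
  qed (use f in measurable)
  then show ?thesis using f by (simp add: Lp_space_def)
qed

lemma sobolev_add:
  assumes "sobolev p Om u g" "sobolev p Om w k" "open Om" "0 \<le> p"
  shows "sobolev p Om (\<lambda>x. u x + w x) (\<lambda>x. g x + k x)"
  using assms by (simp add: sobolev_def has_weak_gradient_add Lp_space_add)

lemma sobolev_diff:
  assumes "sobolev p Om u g" "sobolev p Om w k" "open Om" "0 \<le> p"
  shows "sobolev p Om (\<lambda>x. u x - w x) (\<lambda>x. g x - k x)"
  using assms by (simp add: sobolev_def has_weak_gradient_diff Lp_space_diff)

lemma sobolev_minus:
  assumes "sobolev p Om u g" "open Om"
  shows "sobolev p Om (\<lambda>x. - u x) (\<lambda>x. - g x)"
  using assms by (simp add: sobolev_def has_weak_gradient_minus Lp_space_minus)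

lemma sobolev_cong_AE:
  assumes "sobolev p Om u g" "open Om" "AE x in lebesgue_on Om. u x = u' x" "AE x in lebesgue_on Om. g x = g' x"
  shows "sobolev p Om u' g'"
  using assms has_weak_gradient_cong_AE[of Om u g u' g'] Lp_space_cong_AE[of u p Om u'] Lp_space_cong_AE[of g p Om g']
  by (simp add: sobolev_def)

text \<open>The minimum is half the sum minus half the absolute difference. Where
  \<open>u = w\<close> this produces the mean of \<open>g\<close> and \<open>k\<close>; it equals
  \<open>g\<close> because the gradient of \<open>u - w\<close> vanishes almost everywhere on its
  zero set.\<close>

lemma has_weak_gradient_min:
  assumes u: "has_weak_gradient Om u g" and w: "has_weak_gradient Om w k" and Om: "open Om"
  shows "has_weak_gradient Om (\<lambda>x. min (u x) (w x)) (\<lambda>x. if u x \<le> w x then g x else k x)"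
proof (rule has_weak_gradient_cong_AE[OF _ Om])
  note d = has_weak_gradient_diff[OF u w Om]
  show "has_weak_gradient Om (\<lambda>x. (1/2) * (u x + w x) + (-1/2) * \<bar>u x - w x\<bar>)
    (\<lambda>x. (1/2) *\<^sub>R (g x + k x) + (-1/2) *\<^sub>R (sgn (u x - w x) *\<^sub>R (g x - k x)))"
    by (rule has_weak_gradient_lincomb[OF has_weak_gradient_add[OF u w Om] has_weak_gradient_abs[OF d Om] Om])
  show "AE x in lebesgue_on Om. (1/2) * (u x + w x) + (-1/2) * \<bar>u x - w x\<bar> = min (u x) (w x)"
    by (intro AE_I2) (auto simp: min_def abs_if field_simps)
  show "AE x in lebesgue_on Om. (1/2) *\<^sub>R (g x + k x) + (-1/2) *\<^sub>R (sgn (u x - w x) *\<^sub>R (g x - k x)) = (if u x \<le> w x then g x else k x)"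
    using weak_gradient_zero_on_level[OF d Om]
  proof (rule eventually_mono)
    fix x assume z: "u x - w x = 0 \<longrightarrow> g x - k x = 0"
    have h: "(1/2) *\<^sub>R y + (1/2) *\<^sub>R y = y" for y :: 'a by (simp add: scaleR_left_distrib[symmetric])
    consider "u x < w x" | "u x = w x" | "w x < u x" by linarith
    then show "(1/2) *\<^sub>R (g x + k x) + (-1/2) *\<^sub>R (sgn (u x - w x) *\<^sub>R (g x - k x)) = (if u x \<le> w x then g x else k x)"
      by cases (use z h[of "g x"] h[of "k x"] in \<open>auto simp: sgn_if algebra_simps\<close>)
  qed
qed

lemma sobolev_measurable:
  assumes "sobolev p Om u g"
  shows "u \<in> borel_measurable (lebesgue_on Om)" "g \<in> borel_measurable (lebesgue_on Om)"
  using assms by (auto simp: sobolev_def Lp_space_def)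

lemma sobolev_min:
  assumes u: "sobolev p Om u g" and w: "sobolev p Om w k" and Om: "open Om" and p: "0 \<le> p"
  shows "sobolev p Om (\<lambda>x. min (u x) (w x)) (\<lambda>x. if u x \<le> w x then g x else k x)"
proof -
  note [measurable] = sobolev_measurable[OF u] sobolev_measurable[OF w]
  have "(\<lambda>x. min (u x) (w x)) \<in> Lp_space p Om"
    by (rule Lp_space_dominated[where f = u and g = w]) (use u w p in \<open>auto simp: sobolev_def\<close>)
  moreover have "(\<lambda>x. if u x \<le> w x then g x else k x) \<in> Lp_space p Om"
    by (rule Lp_space_dominated[where f = g and g = k]) (use u w p in \<open>auto simp: sobolev_def\<close>)
  moreover have "has_weak_gradient Om (\<lambda>x. min (u x) (w x)) (\<lambda>x. if u x \<le> w x then g x else k x)"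
    using u w Om by (intro has_weak_gradient_min) (auto simp: sobolev_def)
  ultimately show ?thesis by (simp add: sobolev_def)
qed

lemma sobolev_max:
  assumes u: "sobolev p Om u g" and w: "sobolev p Om w k" and Om: "open Om" and p: "0 \<le> p"
  shows "sobolev p Om (\<lambda>x. max (u x) (w x)) (\<lambda>x. if w x \<le> u x then g x else k x)"
proof -
  have "sobolev p Om (\<lambda>x. - min (- u x) (- w x)) (\<lambda>x. - (if - u x \<le> - w x then - g x else - k x))"
    by (intro sobolev_minus sobolev_min u w Om p)
  moreover have "(\<lambda>x. - min (- u x) (- w x)) = (\<lambda>x. max (u x) (w x))" by (auto simp: fun_eq_iff)
  moreover have "(\<lambda>x. - (if - u x \<le> - w x then - g x else - k x)) = (\<lambda>x. if w x \<le> u x then g x else k x)" by (auto simp: fun_eq_iff)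
  ultimately show ?thesis by simp
qed

section \<open>Membership in \<open>W0\<close>: approximation, closedness and truncation\<close>

lemma W1_sobolev: "u \<in> W1 p Om \<longleftrightarrow> (\<exists>g. sobolev p Om u g)"
  by (auto simp: W1_def sobolev_def)

lemma W1_norm_eq:
  assumes "sobolev p Om u g" and Om: "open Om"
  shows "W1_norm p Om u = (LINT x|lebesgue_on Om. norm (u x) powr p) powr (1 / p) + (LINT x|lebesgue_on Om. norm (g x) powr p) powr (1 / p)"
proof -
  have "Lp_norm p Om (weak_gradient Om u) = Lp_norm p Om g"
    using assms by (intro Lp_norm_cong_AE weak_gradient_AE_eq) (auto simp: sobolev_def)
  then show ?thesis by (simp add: W1_norm_def Lp_norm_def)
qed

lemma sobolev_C1_compact_support:
  fixes v :: "'a::euclidean_space \<Rightarrow> real"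
  assumes v: "v \<in> C1_compact_support Om" "\<And>x. GDERIV v x :> D x" and Om: "open Om" and p: "0 \<le> p"
  shows "sobolev p Om v D"
proof -
  obtain K where K: "continuous_on UNIV D" "continuous_on UNIV v" "compact K" "K \<subseteq> Om"
    "\<And>x. x \<notin> K \<Longrightarrow> v x = 0" "\<And>x. x \<notin> K \<Longrightarrow> D x = 0"
    using C1_compact_supportE[OF v] by metis
  have *: "f \<in> Lp_space p Om" if f: "continuous_on UNIV f" "\<And>x. x \<notin> K \<Longrightarrow> f x = 0" for f :: "'a \<Rightarrow> 'b::euclidean_space"
  proof -
    obtain e where e: "\<And>x. e \<le> norm x \<Longrightarrow> f x = 0" using bounded_vanish_norm[OF compact_imp_bounded[OF K(3)], of f] f(2) by blast
    obtain B where B: "\<And>x. norm (f x) \<le> B" using bounded_continuous_compact_support[OF f(1) e] by blast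
    have m: "f \<in> borel_measurable (lebesgue_on S)" for S by (rule borel_measurable_lebesgue_on_continuous[OF f(1)])
    have c: "integrable (lebesgue_on K) (\<lambda>x. B powr p)"
      using loc_integrable_continuous[of "\<lambda>x. B powr p" K] K(3) by (auto simp: loc_integrable_def)
    have "integrable (lebesgue_on K) (\<lambda>x. norm (f x) powr p)"
    proof (rule Bochner_Integration.integrable_bound[OF c])
      show "AE x in lebesgue_on K. norm (norm (f x) powr p) \<le> norm (B powr p)"
        using B p by (intro AE_I2) (auto intro!: powr_mono2)
    qed (use m in measurable)
    then have "integrable (lebesgue_on Om) (\<lambda>x. norm (f x) powr p)"
      using K(3,4) Om f(2) by (subst integrable_lebesgue_on_subset_vanish[of Om K]) auto
    then show ?thesis using m by (simp add: Lp_space_def)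
  qed
  show ?thesis
    unfolding sobolev_def using *[OF K(2,5)] *[OF K(1,6)] has_weak_gradient_C1[OF Om v(2) K(1)] by blast
qed

text \<open>Trades the norm, with its roots and its selected gradient, for two integrals of p-th
  powers. The tolerance \<open>(e / 2) powr p\<close> for each integral adds up to \<open>e\<close>
  after taking roots.\<close>

lemma W0I:
  assumes s: "sobolev p Om w g" and Om: "open Om" and p: "1 \<le> p"
    and ap: "\<And>e. 0 < e \<Longrightarrow> \<exists>v\<in>C1_compact_support Om. \<exists>D. (\<forall>x. GDERIV v x :> D x) \<and>
      (LINT x|lebesgue_on Om. norm (v x - w x) powr p) < e \<and> (LINT x|lebesgue_on Om. norm (D x - g x) powr p) < e"
  shows "w \<in> W0 p Om"
proof -
  have "\<exists>v\<in>C1_compact_support Om. W1_norm p Om (\<lambda>x. v x - w x) < e" if e: "0 < e" for e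
  proof -
    obtain v D where v: "v \<in> C1_compact_support Om" "\<And>x. GDERIV v x :> D x"
      "(LINT x|lebesgue_on Om. norm (v x - w x) powr p) < (e / 2) powr p" "(LINT x|lebesgue_on Om. norm (D x - g x) powr p) < (e / 2) powr p"
      using ap[of "(e / 2) powr p"] e by auto
    have sv: "sobolev p Om (\<lambda>x. v x - w x) (\<lambda>x. D x - g x)"
      using p by (intro sobolev_diff sobolev_C1_compact_support s v Om) auto
    have root: "a powr (1 / p) < e / 2" if "0 \<le> a" "a < (e / 2) powr p" for a
    proof -
      have "a powr (1 / p) < ((e / 2) powr p) powr (1 / p)" using that p by (intro powr_less_mono2) auto
      then show ?thesis using p e by (simp add: powr_powr)
    qed
    have "W1_norm p Om (\<lambda>x. v x - w x) < e / 2 + e / 2"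
      unfolding W1_norm_eq[OF sv Om] by (intro add_strict_mono root v integral_nonneg_AE) auto
    then show ?thesis using v(1) by auto
  qed
  moreover have "w \<in> W1 p Om" using s W1_sobolev by blast
  ultimately show ?thesis by (auto simp: W0_def)
qed

lemma W0E:
  assumes w: "w \<in> W0 p Om" and s: "sobolev p Om w g" and Om: "open Om" and p: "1 \<le> p" and e: "0 < e"
  shows "\<exists>v\<in>C1_compact_support Om. \<exists>D. (\<forall>x. GDERIV v x :> D x) \<and>
      (LINT x|lebesgue_on Om. norm (v x - w x) powr p) < e \<and> (LINT x|lebesgue_on Om. norm (D x - g x) powr p) < e"
proof -
  have "0 < e powr (1 / p)" using e by simp
  then obtain v where v: "v \<in> C1_compact_support Om" "W1_norm p Om (\<lambda>x. v x - w x) < e powr (1 / p)"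
    using w unfolding W0_def by blast
  obtain D where D: "\<And>x. GDERIV v x :> D x" using v(1) by (auto simp: C1_compact_support_def)
  have sv: "sobolev p Om (\<lambda>x. v x - w x) (\<lambda>x. D x - g x)"
    using p by (intro sobolev_diff sobolev_C1_compact_support s v D Om) auto
  have root: "a < e" if "0 \<le> a" "a powr (1 / p) < e powr (1 / p)" for a
  proof (rule ccontr)
    assume "\<not> a < e"
    then have "e powr (1 / p) \<le> a powr (1 / p)" using e p by (intro powr_mono2) auto
    then show False using that by simp
  qed
  have "(LINT x|lebesgue_on Om. norm (v x - w x) powr p) powr (1 / p) + (LINT x|lebesgue_on Om. norm (D x - g x) powr p) powr (1 / p) < e powr (1 / p)"
    using v(2) W1_norm_eq[OF sv Om] by simp
  then have "(LINT x|lebesgue_on Om. norm (v x - w x) powr p) powr (1 / p) < e powr (1 / p)"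
    "(LINT x|lebesgue_on Om. norm (D x - g x) powr p) powr (1 / p) < e powr (1 / p)"
    using powr_ge_zero[of "LINT x|lebesgue_on Om. norm (v x - w x) powr p" "1 / p"] powr_ge_zero[of "LINT x|lebesgue_on Om. norm (D x - g x) powr p" "1 / p"]
    by linarith+
  then have "(LINT x|lebesgue_on Om. norm (v x - w x) powr p) < e" "(LINT x|lebesgue_on Om. norm (D x - g x) powr p) < e"
    by (intro root integral_nonneg_AE; simp)+
  then show ?thesis using v(1) D by blast
qed

lemma Lp_integral_triangle:
  fixes f g h :: "'a::euclidean_space \<Rightarrow> 'b::euclidean_space"
  assumes "f \<in> Lp_space p Om" "g \<in> Lp_space p Om" "h \<in> Lp_space p Om" "0 \<le> p"
  shows "(LINT x|lebesgue_on Om. norm (f x - h x) powr p)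
    \<le> 2 powr p * ((LINT x|lebesgue_on Om. norm (f x - g x) powr p) + (LINT x|lebesgue_on Om. norm (g x - h x) powr p))"
proof -
  have i: "integrable (lebesgue_on Om) (\<lambda>x. norm (f x - h x) powr p)" "integrable (lebesgue_on Om) (\<lambda>x. norm (f x - g x) powr p)"
    "integrable (lebesgue_on Om) (\<lambda>x. norm (g x - h x) powr p)"
    using Lp_space_diff[OF assms(4)] assms by (auto simp: Lp_space_def)
  have "(LINT x|lebesgue_on Om. norm (f x - h x) powr p) \<le> (LINT x|lebesgue_on Om. 2 powr p * (norm (f x - g x) powr p + norm (g x - h x) powr p))"
  proof (rule integral_mono)
    fix x show "norm (f x - h x) powr p \<le> 2 powr p * (norm (f x - g x) powr p + norm (g x - h x) powr p)"
      using norm_add_powr_le[OF assms(4), of "f x - g x" "g x - h x"] by simp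
  qed (use i in auto)
  also have "\<dots> = 2 powr p * ((LINT x|lebesgue_on Om. norm (f x - g x) powr p) + (LINT x|lebesgue_on Om. norm (g x - h x) powr p))"
    using i by simp
  finally show ?thesis .
qed

lemma W0_closed:
  assumes s: "sobolev p Om w g" and Om: "open Om" and p: "1 \<le> p"
    and ap: "\<And>e. 0 < e \<Longrightarrow> \<exists>w' g'. w' \<in> W0 p Om \<and> sobolev p Om w' g' \<and>
      (LINT x|lebesgue_on Om. norm (w' x - w x) powr p) < e \<and> (LINT x|lebesgue_on Om. norm (g' x - g x) powr p) < e"
  shows "w \<in> W0 p Om"
proof (rule W0I[OF s Om p])
  fix e :: real assume e: "0 < e"
  \<comment> \<open>Compensates the factor \<open>2 powr p\<close> of the triangle inequality for
    p-th power integrals and the two summands in it.\<close>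
  define e' where "e' = e / (2 powr p * 2)"
  have e': "0 < e'" using e by (simp add: e'_def)
  obtain w' g' where w': "w' \<in> W0 p Om" "sobolev p Om w' g'"
    "(LINT x|lebesgue_on Om. norm (w' x - w x) powr p) < e'" "(LINT x|lebesgue_on Om. norm (g' x - g x) powr p) < e'"
    using ap[OF e'] by blast
  obtain v D where v: "v \<in> C1_compact_support Om" "\<And>x. GDERIV v x :> D x"
    "(LINT x|lebesgue_on Om. norm (v x - w' x) powr p) < e'" "(LINT x|lebesgue_on Om. norm (D x - g' x) powr p) < e'"
    using W0E[OF w'(1,2) Om p e'] by blast
  have sv: "sobolev p Om v D" using p by (intro sobolev_C1_compact_support v Om) auto
  have sum: "2 powr p * (a + b) < e" if "a < e'" "b < e'" for a b
  proof -
    have "2 powr p * (a + b) < 2 powr p * (e' + e')" using that by (intro mult_strict_left_mono) auto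
    then show ?thesis by (simp add: e'_def)
  qed
  have "(LINT x|lebesgue_on Om. norm (v x - w x) powr p) < e"
    using Lp_integral_triangle[of v p Om w' w] sum[OF v(3) w'(3)] sv w'(2) s p by (simp add: sobolev_def)
  moreover have "(LINT x|lebesgue_on Om. norm (D x - g x) powr p) < e"
    using Lp_integral_triangle[of D p Om g' g] sum[OF v(4) w'(4)] sv w'(2) s p by (simp add: sobolev_def)
  ultimately show "\<exists>v\<in>C1_compact_support Om. \<exists>D. (\<forall>x. GDERIV v x :> D x) \<and>
      (LINT x|lebesgue_on Om. norm (v x - w x) powr p) < e \<and> (LINT x|lebesgue_on Om. norm (D x - g x) powr p) < e"
    using v(1,2) by blast
qed

text \<open>Mollifications with radius at most \<open>d\<close> are supported in the compact set
  \<open>K'\<close> inside \<open>Om\<close>, hence are test functions, and they converge in the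
  p-th power mean together with their gradients.\<close>

lemma W0_compact_support:
  fixes f :: "'a::euclidean_space \<Rightarrow> real"
  assumes s: "sobolev p Om f G" and Om: "open Om" and p: "1 \<le> p"
    and K: "compact K" "K \<subseteq> Om" and z: "AE x in lebesgue_on Om. x \<notin> K \<longrightarrow> f x = 0"
  shows "f \<in> W0 p Om"
proof (rule W0I[OF s Om p])
  fix r :: real assume r: "0 < r"
  have h: "has_weak_gradient Om f G" using s by (simp add: sobolev_def)
  obtain d K' where d: "0 < d" "compact K'" "K' \<subseteq> Om" "K \<subseteq> K'" "\<And>x. x \<in> K \<Longrightarrow> cball x d \<subseteq> K'"
    "\<And>x y. x \<in> K' \<Longrightarrow> y \<in> cball x d \<Longrightarrow> y \<in> Om" "\<And>x y. x \<notin> K' \<Longrightarrow> y \<in> K \<Longrightarrow> d < dist x y"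
    using compact_neighbourhood[OF K Om] by metis
  have iK: "integrable (lebesgue_on K) f" "integrable (lebesgue_on K) G"
    using h K by (auto simp: has_weak_gradient_def loc_integrable_def)
  have Kb: "K \<in> sets borel" using K(1) by (simp add: borel_compact)
  have OmL: "Om \<in> sets lebesgue" using Om by simp
  have zf: "AE x in lborel. x \<in> Om \<longrightarrow> x \<notin> K \<longrightarrow> f x = 0" using z OmL by (simp add: AE_lebesgue_on_iff)
  \<comment> \<open>The support condition concerns \<open>f\<close> only; the gradient follows since
    it vanishes almost everywhere on the zero set of \<open>f\<close>.\<close>
  have zG: "AE x in lborel. x \<in> Om \<longrightarrow> x \<notin> K \<longrightarrow> G x = 0"
    using weak_gradient_zero_on_level[OF h Om] zf OmL unfolding AE_lebesgue_on_iff[OF OmL] by eventually_elim auto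
  obtain f0 where f0: "integrable lborel f0" "\<And>x. x \<notin> K \<Longrightarrow> f0 x = 0" "AE x in lborel. x \<in> K \<longrightarrow> f0 x = f x"
    using lebesgue_on_borel_representative[OF Kb iK(1)] by blast
  obtain g0 where g0: "integrable lborel g0" "\<And>x. x \<notin> K \<Longrightarrow> g0 x = 0" "AE x in lborel. x \<in> K \<longrightarrow> g0 x = G x"
    using lebesgue_on_borel_representative[OF Kb iK(2)] by blast
  have ef: "AE x in lborel. x \<in> Om \<longrightarrow> f0 x = f x" using f0(3) zf by eventually_elim (use f0(2) in force)
  have eg: "AE x in lborel. x \<in> Om \<longrightarrow> g0 x = G x" using g0(3) zG by eventually_elim (use g0(2) in force)
  define e where "e n = d / real (Suc n)" for n
  have e: "0 < e n" "e \<longlonglongrightarrow> 0" "e n \<le> d" for n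
    unfolding e_def using d(1) seq_inverse_tendsto by (auto simp: field_simps)
  have far0: "k y = 0" if "x \<notin> K'" "dist y x \<le> d" "\<And>x. x \<notin> K \<Longrightarrow> k x = 0" for x y and k :: "'a \<Rightarrow> 'b::zero"
    using that d(7)[of x y] by (force simp: dist_commute)
  \<comment> \<open>Here the identity is global. For \<open>x\<close> in \<open>K'\<close> the ball
    fits into \<open>Om\<close> and the kernel is a test function; for other \<open>x\<close> the
    distance to \<open>K\<close> exceeds the radius and both sides are 0.\<close>
  have cg: "convol_grad (e n) f0 x = convol (e n) g0 x" for n x
  proof (cases "x \<in> K'")
    case True
    then have cb: "cball x (e n) \<subseteq> Om" using d(6)[OF True] e(3)[of n] by force
    show ?thesis
    proof (rule convol_grad_eq[OF h Om e(1) cb f0(1) g0(1)])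
      show "AE y in lborel. y \<in> cball x (e n) \<longrightarrow> f0 y = f y" using ef by (rule eventually_mono) (use cb in blast)
      show "AE y in lborel. y \<in> cball x (e n) \<longrightarrow> g0 y = G y" using eg by (rule eventually_mono) (use cb in blast)
    qed
  next
    case False
    have "convol (e n) g0 x = 0"
      by (rule convol_eq_0[OF e(1)]) (use far0[OF False _ g0(2)] e(3)[of n] in force)
    moreover have "f0 y *\<^sub>R mollifier_grad (e n) (y - x) = 0" for y
    proof (cases "dist y x \<le> d")
      case True then show ?thesis using far0[OF False True, of f0, OF f0(2)] by simp
    next
      case F: False then show ?thesis using mollifier_grad_eq_0[OF e(1), of n "y - x"] e(3)[of n] by (simp add: dist_norm)
    qed
    ultimately show ?thesis by (simp only: convol_grad_def minus_zero Bochner_Integration.integral_zero)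
  qed
  have cz: "convol (e n) f0 x = 0" if "x \<notin> K'" for n x
    by (rule convol_eq_0[OF e(1)]) (use far0[OF that _ f0(2)] e(3)[of n] in force)
  have C1: "convol (e n) f0 \<in> C1_compact_support Om" for n
    by (rule C1_compact_supportI[OF GDERIV_convol[OF f0(1) e(1)] continuous_convol_grad[OF f0(1) e(1)] d(2,3) cz])
  \<comment> \<open>The target type is left general because the statement is applied both to the
    function \<open>f\<close> and to its vector-valued gradient \<open>G\<close>.\<close>
  have main: "\<exists>n0. \<forall>n\<ge>n0. (LINT x|lebesgue_on Om. norm (convol (e n) k0 x - k x) powr p) < r"
    if k0: "integrable lborel k0" "AE x in lborel. x \<in> Om \<longrightarrow> k0 x = k x" "\<And>x. x \<notin> K \<Longrightarrow> k0 x = 0" and kp: "k \<in> Lp_space p Om"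
    for k0 k :: "'a \<Rightarrow> 'b::euclidean_space"
  proof -
    note [measurable] = integrable_borel_measurable_borel[OF k0(1)]
    have "integrable (lebesgue_on Om) (\<lambda>x. norm (k0 x) powr p)"
      by (rule integrable_lebesgue_on_cong_AE[OF OmL, of "\<lambda>x. norm (k x) powr p"])
        (use kp k0(2) OmL in \<open>auto simp: Lp_space_def AE_lebesgue_on_iff elim!: eventually_mono\<close>)
    then have "integrable lebesgue (\<lambda>x. norm (k0 x) powr p)"
      using k0(3) K(2) OmL by (subst integrable_lebesgue_on_vanish[OF OmL, symmetric]) auto
    then have k0p: "integrable lborel (\<lambda>x. norm (k0 x) powr p)" by (simp add: integrable_completion)
    have i: "integrable lborel (\<lambda>x. norm (convol (e n) k0 x - k0 x) powr p)" for n
      by (rule convol_Lp_tendsto(1)[OF k0(1) k0p p e(1,2)])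
    have l: "(\<lambda>n. LINT x|lborel. norm (convol (e n) k0 x - k0 x) powr p) \<longlonglongrightarrow> 0"
      by (rule convol_Lp_tendsto(2)[OF k0(1) k0p p e(1,2)])
    have le: "(LINT x|lebesgue_on Om. norm (convol (e n) k0 x - k x) powr p) \<le> (LINT x|lborel. norm (convol (e n) k0 x - k0 x) powr p)" for n
    proof -
      have iL: "integrable lebesgue (\<lambda>x. norm (convol (e n) k0 x - k0 x) powr p)"
        using i[of n] borel_measurable_integrable[OF i[of n]] by (simp add: integrable_completion)
      have "(LINT x|lebesgue_on Om. norm (convol (e n) k0 x - k x) powr p) = (LINT x|lebesgue_on Om. norm (convol (e n) k0 x - k0 x) powr p)"
        by (rule integral_lebesgue_on_cong_AE[OF OmL]) (use k0(2) OmL in \<open>auto simp: AE_lebesgue_on_iff elim!: eventually_mono\<close>)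
      also have "\<dots> = (LINT x|lebesgue. indicator Om x *\<^sub>R norm (convol (e n) k0 x - k0 x) powr p)"
        by (rule integral_lebesgue_on_eq[OF OmL])
      also have "\<dots> \<le> (LINT x|lebesgue. norm (convol (e n) k0 x - k0 x) powr p)"
        using iL integrable_mult_indicator[OF OmL iL] by (intro integral_mono) (auto simp: indicator_def)
      also have "\<dots> = (LINT x|lborel. norm (convol (e n) k0 x - k0 x) powr p)"
        using borel_measurable_integrable[OF i[of n]] by (intro integral_completion) auto
      finally show ?thesis .
    qed
    obtain n0 where n0: "\<forall>n\<ge>n0. norm ((LINT x|lborel. norm (convol (e n) k0 x - k0 x) powr p) - 0) < r"
      using LIMSEQ_D[OF l r] by blast
    show ?thesis
    proof (intro exI[of _ n0] allI impI)
      fix n assume "n \<ge> n0"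
      then have "norm ((LINT x|lborel. norm (convol (e n) k0 x - k0 x) powr p) - 0) < r" using n0 by blast
      then show "(LINT x|lebesgue_on Om. norm (convol (e n) k0 x - k x) powr p) < r" using le[of n] by simp
    qed
  qed
  obtain n1 where n1: "\<And>n. n \<ge> n1 \<Longrightarrow> (LINT x|lebesgue_on Om. norm (convol (e n) f0 x - f x) powr p) < r"
    using main[OF f0(1) ef f0(2)] s unfolding sobolev_def by blast
  obtain n2 where n2: "\<And>n. n \<ge> n2 \<Longrightarrow> (LINT x|lebesgue_on Om. norm (convol (e n) g0 x - G x) powr p) < r"
    using main[OF g0(1) eg g0(2)] s unfolding sobolev_def by blast
  let ?n = "max n1 n2"
  show "\<exists>v\<in>C1_compact_support Om. \<exists>D. (\<forall>x. GDERIV v x :> D x) \<and>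
      (LINT x|lebesgue_on Om. norm (v x - f x) powr p) < r \<and> (LINT x|lebesgue_on Om. norm (D x - G x) powr p) < r"
  proof (intro bexI[OF _ C1[of ?n]] exI[of _ "convol_grad (e ?n) f0"] conjI allI)
    show "GDERIV (convol (e ?n) f0) x :> convol_grad (e ?n) f0 x" for x by (rule GDERIV_convol[OF f0(1) e(1)])
  qed (use n1[of ?n] n2[of ?n] in \<open>auto simp: cg\<close>)
qed

lemma W0_minus:
  assumes w: "w \<in> W0 p Om" and s: "sobolev p Om w g" and Om: "open Om" and p: "1 \<le> p"
  shows "(\<lambda>x. - w x) \<in> W0 p Om"
proof (rule W0I[OF sobolev_minus[OF s Om] Om p])
  fix e :: real assume e: "0 < e"
  obtain v D where v: "v \<in> C1_compact_support Om" "\<And>x. GDERIV v x :> D x"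
    "(LINT x|lebesgue_on Om. norm (v x - w x) powr p) < e" "(LINT x|lebesgue_on Om. norm (D x - g x) powr p) < e"
    using W0E[OF w s Om p e] by blast
  obtain K where K: "continuous_on UNIV D" "compact K" "K \<subseteq> Om" "\<And>x. x \<notin> K \<Longrightarrow> v x = 0"
    using C1_compact_supportE[OF v(1,2)] by metis
  have D': "GDERIV (\<lambda>x. - v x) x :> - D x" for x
    using has_derivative_minus[OF v(2)[of x, unfolded gderiv_def]] by (simp add: gderiv_def)
  have v': "(\<lambda>x. - v x) \<in> C1_compact_support Om"
    by (rule C1_compact_supportI[OF D' continuous_on_minus[OF K(1)] K(2,3)]) (simp add: K(4))
  have "norm (- v x - - w x) = norm (v x - w x)" "norm (- D x - - g x) = norm (D x - g x)" for x
    by (simp_all add: norm_minus_commute)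
  then show "\<exists>v\<in>C1_compact_support Om. \<exists>D. (\<forall>x. GDERIV v x :> D x) \<and>
      (LINT x|lebesgue_on Om. norm (v x - - w x) powr p) < e \<and> (LINT x|lebesgue_on Om. norm (D x - - g x) powr p) < e"
    using v(3,4) by (intro bexI[OF _ v'] exI[of _ "\<lambda>x. - D x"] conjI allI D') (simp_all only:)
qed

text \<open>Since \<open>psi \<ge> 0\<close>, the minimum of a test function \<open>v n\<close> and
  \<open>psi\<close> vanishes off the support of \<open>v n\<close> and so lies in
  \<open>W0\<close>, whatever \<open>psi\<close> does at the boundary. As \<open>v n\<close> tends
  to \<open>w\<close>, the minima converge because taking the minimum with \<open>psi\<close> does
  not increase distances; their gradients converge along a subsequence, and closedness of
  \<open>W0\<close> concludes.\<close>

lemma W0_min: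
  assumes w: "w \<in> W0 p Om" and s: "sobolev p Om w g" and psi: "sobolev p Om psi k"
    and nn: "AE x in lebesgue_on Om. 0 \<le> psi x" and Om: "open Om" and p: "1 \<le> p"
  shows "(\<lambda>x. min (w x) (psi x)) \<in> W0 p Om"
proof -
  have p0: "0 \<le> p" using p by simp
  have ex: "\<forall>n. \<exists>v D. v \<in> C1_compact_support Om \<and> (\<forall>x. GDERIV v x :> D x) \<and>
      (LINT x|lebesgue_on Om. norm (v x - w x) powr p) < 1 / real (Suc n) \<and> (LINT x|lebesgue_on Om. norm (D x - g x) powr p) < 1 / real (Suc n)"
    using W0E[OF w s Om p seq_inverse_pos[of 1, OF zero_less_one]] by blast
  obtain v D where vD: "\<forall>n. v n \<in> C1_compact_support Om \<and> (\<forall>x. GDERIV (v n) x :> D n x) \<and>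
      (LINT x|lebesgue_on Om. norm (v n x - w x) powr p) < 1 / real (Suc n) \<and> (LINT x|lebesgue_on Om. norm (D n x - g x) powr p) < 1 / real (Suc n)"
    using ex[unfolded choice_iff] by blast
  have v: "v n \<in> C1_compact_support Om" "GDERIV (v n) x :> D n x"
      "(LINT x|lebesgue_on Om. norm (v n x - w x) powr p) < 1 / real (Suc n)"
      "(LINT x|lebesgue_on Om. norm (D n x - g x) powr p) < 1 / real (Suc n)" for n x
    using vD by blast+
  have lv: "(\<lambda>n. LINT x|lebesgue_on Om. norm (v n x - w x) powr p) \<longlonglongrightarrow> 0"
    by (rule Lim_null_comparison[OF always_eventually seq_inverse_tendsto[of 1]])
      (use v(3) in \<open>auto simp: integral_nonneg_AE less_imp_le simp del: of_nat_Suc\<close>)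
  have lD: "(\<lambda>n. LINT x|lebesgue_on Om. norm (D n x - g x) powr p) \<longlonglongrightarrow> 0"
    by (rule Lim_null_comparison[OF always_eventually seq_inverse_tendsto[of 1]])
      (use v(4) in \<open>auto simp: integral_nonneg_AE less_imp_le simp del: of_nat_Suc\<close>)
  have sv: "sobolev p Om (v n) (D n)" for n by (rule sobolev_C1_compact_support[OF v(1,2) Om p0])
  define f where "f n x = min (v n x) (psi x)" for n x
  define F where "F n x = (if v n x \<le> psi x then D n x else k x)" for n x
  define G where "G x = (if w x \<le> psi x then g x else k x)" for x
  have sf: "sobolev p Om (f n) (F n)" for n
    unfolding f_def[abs_def] F_def[abs_def] by (rule sobolev_min[OF sv psi Om p0])
  have sG: "sobolev p Om (\<lambda>x. min (w x) (psi x)) G"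
    unfolding G_def[abs_def] by (rule sobolev_min[OF s psi Om p0])
  note [measurable] = sobolev_measurable[OF sv] sobolev_measurable[OF sf] sobolev_measurable[OF sG] sobolev_measurable[OF s] sobolev_measurable[OF psi]
  have fW0: "f n \<in> W0 p Om" for n
  proof -
    obtain K where K: "compact K" "K \<subseteq> Om" "\<And>x. x \<notin> K \<Longrightarrow> v n x = 0"
      using C1_compact_supportE[OF v(1,2)] by metis
    show ?thesis
    proof (rule W0_compact_support[OF sf Om p K(1,2)])
      show "AE x in lebesgue_on Om. x \<notin> K \<longrightarrow> f n x = 0"
        using nn by (rule eventually_mono) (auto simp: f_def K(3))
    qed
  qed
  have ivw: "integrable (lebesgue_on Om) (\<lambda>x. norm (v n x - w x) powr p)" for n
    using sobolev_diff[OF sv s Om p0] by (auto simp: sobolev_def Lp_space_def)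
  have iDg: "integrable (lebesgue_on Om) (\<lambda>x. norm (D n x - g x) powr p)" for n
    using sobolev_diff[OF sv s Om p0] by (auto simp: sobolev_def Lp_space_def)
  have igk: "integrable (lebesgue_on Om) (\<lambda>x. norm (g x - k x) powr p)"
    using sobolev_diff[OF s psi Om p0] by (auto simp: sobolev_def Lp_space_def)
  have iff: "integrable (lebesgue_on Om) (\<lambda>x. norm (f n x - min (w x) (psi x)) powr p)" for n
    using sobolev_diff[OF sf sG Om p0] by (auto simp: sobolev_def Lp_space_def)
  have iFG: "integrable (lebesgue_on Om) (\<lambda>x. norm (F n x - G x) powr p)" for n
    using sobolev_diff[OF sf sG Om p0] by (auto simp: sobolev_def Lp_space_def)
  obtain r where r: "strict_mono r" "AE x in lebesgue_on Om. (\<lambda>n. norm (v (r n) x - w x) powr p) \<longlonglongrightarrow> 0"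
  proof -
    have "(\<lambda>n. LINT x|lebesgue_on Om. norm (norm (v n x - w x) powr p)) \<longlonglongrightarrow> 0" using lv by simp
    from tendsto_L1_AE_subseq[OF ivw this] show ?thesis using that by blast
  qed
  have rv: "AE x in lebesgue_on Om. (\<lambda>n. v (r n) x) \<longlonglongrightarrow> w x"
    using r(2)
  proof (rule eventually_mono)
    fix x assume "(\<lambda>n. norm (v (r n) x - w x) powr p) \<longlonglongrightarrow> 0"
    then have "(\<lambda>n. (norm (v (r n) x - w x) powr p) powr (1 / p)) \<longlonglongrightarrow> 0"
      by (rule tendsto_zero_powrI[OF _ tendsto_const]) (use p in auto)
    then have "(\<lambda>n. norm (v (r n) x - w x)) \<longlonglongrightarrow> 0" using p by (simp add: powr_powr)
    then show "(\<lambda>n. v (r n) x) \<longlonglongrightarrow> w x" by (rule LIM_zero_cancel[OF tendsto_norm_zero_cancel])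
  qed
  \<comment> \<open>The extra gradient error where \<open>v n\<close> and \<open>w\<close> lie on
    different sides of \<open>psi\<close>: there the formulas for the minimum select different
    gradients, \<open>g\<close> against \<open>k\<close>.\<close>
  define X where "X n x = (if (v n x \<le> psi x) = (w x \<le> psi x) then 0 else norm (g x - k x) powr p)" for n x
  have [measurable]: "X n \<in> borel_measurable (lebesgue_on Om)" for n unfolding X_def[abs_def] by measurable
  have Xle: "norm (X n x) \<le> norm (g x - k x) powr p" for n x by (simp add: X_def)
  have iX: "integrable (lebesgue_on Om) (X n)" for n
    by (rule Bochner_Integration.integrable_bound[OF igk]) (auto simp: X_def)
  have lX: "(\<lambda>n. LINT x|lebesgue_on Om. X (r n) x) \<longlonglongrightarrow> (LINT x|lebesgue_on Om. 0)"
  proof (rule integral_dominated_convergence[OF _ _ igk])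
    have "AE x in lebesgue_on Om. w x - psi x = 0 \<longrightarrow> g x - k x = 0"
      by (rule weak_gradient_zero_on_level[OF has_weak_gradient_diff Om]) (use s psi Om in \<open>auto simp: sobolev_def\<close>)
    with rv show "AE x in lebesgue_on Om. (\<lambda>n. X (r n) x) \<longlonglongrightarrow> 0"
    proof eventually_elim
      case (elim x)
      consider "w x < psi x" | "w x = psi x" | "psi x < w x" by linarith
      then show ?case
      proof cases
        case 1
        have "\<forall>\<^sub>F n in sequentially. v (r n) x < psi x" by (rule order_tendstoD(2)[OF elim(1) 1])
        then have "\<forall>\<^sub>F n in sequentially. X (r n) x = 0" by (rule eventually_mono) (use 1 in \<open>simp add: X_def\<close>)
        then show ?thesis by (rule tendsto_eventually)
      next
        \<comment> \<open>On the contact set the order of \<open>v (r n) x\<close> and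
          \<open>psi x\<close> may switch forever, but the gradients \<open>g\<close> and
          \<open>k\<close> agree there almost everywhere.\<close>
        case 2
        then have "g x - k x = 0" using elim(2) by simp
        then have "X (r n) x = 0" for n unfolding X_def by simp
        then show ?thesis by simp
      next
        case 3
        have "\<forall>\<^sub>F n in sequentially. psi x < v (r n) x" by (rule order_tendstoD(1)[OF elim(1) 3])
        then have "\<forall>\<^sub>F n in sequentially. X (r n) x = 0" by (rule eventually_mono) (use 3 in \<open>simp add: X_def\<close>)
        then show ?thesis by (rule tendsto_eventually)
      qed
    qed
  qed (use Xle in auto)
  have le1: "(LINT x|lebesgue_on Om. norm (f n x - min (w x) (psi x)) powr p) \<le> (LINT x|lebesgue_on Om. norm (v n x - w x) powr p)" for n
    using p0 by (intro integral_mono iff ivw powr_mono2) (auto simp: f_def)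
  have le2: "(LINT x|lebesgue_on Om. norm (F n x - G x) powr p) \<le> 2 powr p * ((LINT x|lebesgue_on Om. norm (D n x - g x) powr p) + (LINT x|lebesgue_on Om. X n x))" for n
  proof -
    have "(LINT x|lebesgue_on Om. norm (F n x - G x) powr p) \<le> (LINT x|lebesgue_on Om. 2 powr p * (norm (D n x - g x) powr p + X n x))"
    proof (rule integral_mono[OF iFG])
      show "integrable (lebesgue_on Om) (\<lambda>x. 2 powr p * (norm (D n x - g x) powr p + X n x))" using iDg iX by simp
      fix x
      have a: "norm (a + b) powr p \<le> 2 powr p * (norm a powr p + norm b powr p)" for a b :: 'a
        by (rule norm_add_powr_le[OF p0])
      \<comment> \<open>If \<open>v n x \<le> psi x\<close>, the difference is
        \<open>D n x - g x\<close>, plus \<open>g x - k x\<close> when \<open>w x\<close> lies above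
        \<open>psi x\<close>. Otherwise it is 0 or \<open>k x - g x\<close>, and the latter is
        covered by \<open>X\<close> because \<open>2 powr p \<ge> 1\<close>.\<close>
      show "norm (F n x - G x) powr p \<le> 2 powr p * (norm (D n x - g x) powr p + X n x)"
      proof (cases "v n x \<le> psi x")
        case T: True
        show ?thesis
          using T a[of "D n x - g x" 0] a[of "D n x - g x" "g x - k x"] by (auto simp: F_def G_def X_def)
      next
        case T: False
        have "norm (g x - k x) powr p \<le> 2 powr p * (norm (D n x - g x) powr p + norm (g x - k x) powr p)"
        proof -
          have "1 * (norm (g x - k x) powr p) \<le> 2 powr p * (norm (D n x - g x) powr p + norm (g x - k x) powr p)"
            using ge_one_powr_ge_zero[of 2 p] p0 by (intro mult_mono) auto
          then show ?thesis by simp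
        qed
        then show ?thesis using T by (auto simp: F_def G_def X_def norm_minus_commute)
      qed
    qed
    also have "\<dots> = 2 powr p * ((LINT x|lebesgue_on Om. norm (D n x - g x) powr p) + (LINT x|lebesgue_on Om. X n x))"
      using iDg iX by simp
    finally show ?thesis .
  qed
  have l1: "(\<lambda>n. LINT x|lebesgue_on Om. norm (v (r n) x - w x) powr p) \<longlonglongrightarrow> 0"
    using LIMSEQ_subseq_LIMSEQ[OF lv r(1)] by (simp add: comp_def)
  have l2: "(\<lambda>n. 2 powr p * ((LINT x|lebesgue_on Om. norm (D (r n) x - g x) powr p) + (LINT x|lebesgue_on Om. X (r n) x))) \<longlonglongrightarrow> 2 powr p * (0 + 0)"
    using LIMSEQ_subseq_LIMSEQ[OF lD r(1)] lX by (intro tendsto_mult tendsto_add tendsto_const) (simp_all add: comp_def)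
  show ?thesis
  proof (rule W0_closed[OF sG Om p])
    fix e :: real assume e: "0 < e"
    have "\<forall>\<^sub>F n in sequentially. (LINT x|lebesgue_on Om. norm (v (r n) x - w x) powr p) < e"
      by (rule order_tendstoD(2)[OF l1 e])
    moreover have "\<forall>\<^sub>F n in sequentially. 2 powr p * ((LINT x|lebesgue_on Om. norm (D (r n) x - g x) powr p) + (LINT x|lebesgue_on Om. X (r n) x)) < e"
      using order_tendstoD(2)[OF l2, of e] e by simp
    ultimately have "\<forall>\<^sub>F n in sequentially. (LINT x|lebesgue_on Om. norm (f (r n) x - min (w x) (psi x)) powr p) < e \<and> (LINT x|lebesgue_on Om. norm (F (r n) x - G x) powr p) < e"
    proof eventually_elim
      case (elim n)
      then show ?case using le1[of "r n"] le2[of "r n"] by linarith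
    qed
    then obtain n where "(LINT x|lebesgue_on Om. norm (f (r n) x - min (w x) (psi x)) powr p) < e \<and> (LINT x|lebesgue_on Om. norm (F (r n) x - G x) powr p) < e"
      using eventually_happens' sequentially_bot by blast
    then show "\<exists>w' g'. w' \<in> W0 p Om \<and> sobolev p Om w' g' \<and>
      (LINT x|lebesgue_on Om. norm (w' x - min (w x) (psi x)) powr p) < e \<and> (LINT x|lebesgue_on Om. norm (g' x - G x) powr p) < e"
      using fW0 sf by blast
  qed
qed

lemma W0_max:
  assumes w: "w \<in> W0 p Om" and s: "sobolev p Om w g" and psi: "sobolev p Om psi k"
    and np: "AE x in lebesgue_on Om. psi x \<le> 0" and Om: "open Om" and p: "1 \<le> p"
  shows "(\<lambda>x. max (w x) (psi x)) \<in> W0 p Om"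
proof -
  have p0: "0 \<le> p" using p by simp
  have nn: "AE x in lebesgue_on Om. 0 \<le> - psi x" using np by (rule eventually_mono) simp
  note sm = sobolev_minus[OF s Om] sobolev_minus[OF psi Om]
  have "(\<lambda>x. min (- w x) (- psi x)) \<in> W0 p Om"
    by (rule W0_min[OF W0_minus[OF w s Om p] sm nn Om p])
  from W0_minus[OF this sobolev_min[OF sm Om p0] Om p]
  have "(\<lambda>x. - min (- w x) (- psi x)) \<in> W0 p Om" .
  also have "(\<lambda>x. - min (- w x) (- psi x)) = (\<lambda>x. max (w x) (psi x))" by (auto simp: fun_eq_iff)
  finally show ?thesis .
qed

section \<open>Oscillating barriers with small energy\<close>

lemma weak_gradient_two_valued_abs:
  assumes h: "has_weak_gradient Om y k" and Om: "open Om" and k: "AE x in lebesgue_on Om. k x = a \<or> k x = - a"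
  shows "\<exists>k'. has_weak_gradient Om (\<lambda>x. \<bar>y x\<bar>) k' \<and> (AE x in lebesgue_on Om. k' x = a \<or> k' x = - a)"
proof (intro exI conjI)
  show "has_weak_gradient Om (\<lambda>x. \<bar>y x\<bar>) (\<lambda>x. sgn (y x) *\<^sub>R k x)"
    by (rule has_weak_gradient_abs[OF h Om])
  show "AE x in lebesgue_on Om. sgn (y x) *\<^sub>R k x = a \<or> sgn (y x) *\<^sub>R k x = - a"
    \<comment> \<open>On the zero set of \<open>y\<close> the sign is 0, which is not among the two
      values unless \<open>a = 0\<close>. But \<open>k\<close> vanishes almost everywhere there, so
      a point with \<open>k x = a\<close> or \<open>k x = - a\<close> forces
      \<open>a = 0\<close>.\<close>
    using k weak_gradient_zero_on_level[OF h Om] by eventually_elim (auto simp: sgn_if)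
qed

text \<open>Folding \<open>z \<mapsto> \<bar>z - c\<bar>\<close> halves the range of \<open>z\<close> and changes its gradient only by a sign.\<close>

lemma zigzag_exists:
  fixes Om :: "'a::euclidean_space set" and a :: 'a
  assumes Om: "open Om" "bounded Om" and e: "0 < e"
  shows "\<exists>z k. continuous_on UNIV z \<and> has_weak_gradient Om z k \<and> (\<forall>x\<in>Om. 0 \<le> z x \<and> z x \<le> e) \<and>
    (AE x in lebesgue_on Om. k x = a \<or> k x = - a)"
proof -
  obtain R where R: "0 < R" "\<And>x. x \<in> Om \<Longrightarrow> \<bar>x \<bullet> a\<bar> \<le> R"
  proof -
    obtain r where r: "0 < r" "\<And>x. x \<in> Om \<Longrightarrow> norm x \<le> r" using Om(2) by (auto simp: bounded_pos)
    show ?thesis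
    proof (rule that[of "r * norm a + 1"])
      show "0 < r * norm a + 1" using r(1) by (simp add: add_nonneg_pos)
      fix x assume "x \<in> Om"
      then have "norm x * norm a \<le> r * norm a" using r(2) by (intro mult_right_mono) auto
      then show "\<bar>x \<bullet> a\<bar> \<le> r * norm a + 1" using Cauchy_Schwarz_ineq2[of x a] by linarith
    qed
  qed
  have "\<exists>z k. continuous_on UNIV z \<and> has_weak_gradient Om z k \<and> (\<forall>x\<in>Om. 0 \<le> z x \<and> z x \<le> R / 2 ^ n) \<and>
    (AE x in lebesgue_on Om. k x = a \<or> k x = - a)" for n
  proof (induction n)
    case 0
    \<comment> \<open>The linear function with gradient \<open>a\<close> is folded once at 0 already
      in the base case, so that the range starts at 0 as the induction requires.\<close>
    have lin: "has_weak_gradient Om (\<lambda>x. x \<bullet> a) (\<lambda>x. a)"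
      by (rule has_weak_gradient_C1[OF Om(1)]) (auto simp: gderiv_def bounded_linear_imp_has_derivative bounded_linear_inner_left)
    obtain k where k: "has_weak_gradient Om (\<lambda>x. \<bar>x \<bullet> a\<bar>) k" "AE x in lebesgue_on Om. k x = a \<or> k x = - a"
      using weak_gradient_two_valued_abs[OF lin Om(1), of a] by auto
    show ?case
      by (rule exI[of _ "\<lambda>x. \<bar>x \<bullet> a\<bar>"], rule exI[of _ k]) (use k R in \<open>auto intro!: continuous_intros\<close>)
  next
    case (Suc n)
    then obtain z k where z: "continuous_on UNIV z" "has_weak_gradient Om z k" "\<And>x. x \<in> Om \<Longrightarrow> 0 \<le> z x \<and> z x \<le> R / 2 ^ n"
      "AE x in lebesgue_on Om. k x = a \<or> k x = - a" by blast
    define c where "c = R / 2 ^ Suc n"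
    have "has_weak_gradient Om (\<lambda>x. z x - c) (\<lambda>x. k x - 0)"
      by (rule has_weak_gradient_diff[OF z(2) has_weak_gradient_const[OF Om(1)] Om(1)])
    then obtain k' where k': "has_weak_gradient Om (\<lambda>x. \<bar>z x - c\<bar>) k'" "AE x in lebesgue_on Om. k' x = a \<or> k' x = - a"
      using weak_gradient_two_valued_abs[of Om "\<lambda>x. z x - c" "\<lambda>x. k x - 0" a] z(4) Om(1) by auto
    have "\<bar>z x - c\<bar> \<le> c" if "x \<in> Om" for x
    proof -
      have "R / 2 ^ n = 2 * c" by (simp add: c_def)
      then show ?thesis using z(3)[OF that] by linarith
    qed
    then show ?case
      by (intro exI[of _ "\<lambda>x. \<bar>z x - c\<bar>"] exI[of _ k'] conjI k') (use z(1) in \<open>auto intro!: continuous_intros simp: c_def\<close>)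
  qed
  moreover obtain n where "R / 2 ^ n < e"
  proof -
    obtain n where n: "R / e < 2 ^ n" using real_arch_pow[of 2 "R / e"] by auto
    then have "R < 2 ^ n * e" using e by (simp add: divide_less_eq)
    then show ?thesis by (intro that[of n]) (simp add: divide_less_eq mult.commute)
  qed
  ultimately show ?thesis by (meson less_imp_le order_trans)
qed

lemma integrable_indicator_restrict:
  fixes F :: "'a \<Rightarrow> real"
  assumes "integrable M F" "{x \<in> space M. P x} \<in> sets M"
  shows "integrable M (\<lambda>x. if P x then F x else 0)"
proof -
  have "integrable M (\<lambda>x. indicator {x \<in> space M. P x} x *\<^sub>R F x)"
    using assms by (intro integrable_mult_indicator)
  moreover have "integrable M (\<lambda>x. indicator {x \<in> space M. P x} x *\<^sub>R F x) \<longleftrightarrow> integrable M (\<lambda>x. if P x then F x else 0)"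
    by (intro Bochner_Integration.integrable_cong) (auto simp: indicator_def)
  ultimately show ?thesis by simp
qed

lemma integral_if_const:
  assumes "finite_measure M" "{x \<in> space M. P x} \<in> sets M"
  shows "(LINT x|M. (if P x then c else 0)) = measure M {x \<in> space M. P x} * (c::real)"
    "integrable M (\<lambda>x. if P x then c else 0)"
proof -
  have "integrable M (\<lambda>x. indicator {x \<in> space M. P x} x *\<^sub>R c)"
    using finite_measure.emeasure_finite[OF assms(1)] assms(2)
    by (intro integrable_scaleR_left) (simp add: integrable_indicator_iff less_top)
  moreover have *: "integrable M (\<lambda>x. indicator {x \<in> space M. P x} x *\<^sub>R c) \<longleftrightarrow> integrable M (\<lambda>x. if P x then c else 0)"
    by (intro Bochner_Integration.integrable_cong) (auto simp: indicator_def)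
  ultimately show "integrable M (\<lambda>x. if P x then c else 0)" by simp
  have "(LINT x|M. (if P x then c else 0)) = (LINT x|M. indicator {x \<in> space M. P x} x *\<^sub>R c)"
    by (intro Bochner_Integration.integral_cong) (auto simp: indicator_def)
  also have "\<dots> = measure M {x \<in> space M. P x} * c"
    using assms(2) finite_measure.emeasure_finite[OF assms(1)] by (subst integral_scaleR_left) (auto simp: integrable_indicator_iff less_top sets.Int_space_eq2)
  finally show "(LINT x|M. (if P x then c else 0)) = measure M {x \<in> space M. P x} * c" .
qed

text \<open>Some point of the superlevel set \<open>{u > m}\<close> does not exceed the average of \<open>h (u, g)\<close> there; its
  value of \<open>u\<close> is the new level, and the superlevel set only shrinks when \<open>m\<close> is raised to it.\<close>

lemma good_level_exists:
  fixes u :: "'a \<Rightarrow> real" and h :: "real \<Rightarrow> 'b::zero \<Rightarrow> real"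
  assumes fin: "finite_measure M" and [measurable]: "u \<in> borel_measurable M"
    and h: "\<And>s a. 0 \<le> h s a" and i: "integrable M (\<lambda>x. h (u x) (g x))"
  shows "\<exists>s\<ge>m. \<exists>a. measure M {x \<in> space M. s < u x} * h s a \<le> (LINT x|M. (if m < u x then h (u x) (g x) else 0))"
proof -
  define mu where "mu t = measure M {x \<in> space M. t < u x}" for t
  define F where "F x = h (u x) (g x)" for x
  define I where "I = (LINT x|M. (if m < u x then F x else 0))"
  have iF: "integrable M (\<lambda>x. if m < u x then F x else 0)"
    by (rule integrable_indicator_restrict) (use i in \<open>auto simp: F_def\<close>)
  have I0: "0 \<le> I" unfolding I_def by (intro integral_nonneg_AE) (auto simp: F_def h)
  have "\<exists>s\<ge>m. \<exists>a. mu s * h s a \<le> I"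
  proof (cases "mu m = 0")
    case True
    \<comment> \<open>A null superlevel set costs nothing: the level \<open>m\<close> itself serves,
      with an arbitrary \<open>a\<close>.\<close>
    then show ?thesis using I0 by (intro exI[of _ m]) auto
  next
    case False
    have "\<exists>x\<in>space M. m < u x \<and> mu m * F x \<le> I"
    proof (rule ccontr)
      assume "\<not> ?thesis"
      then have gt: "I < mu m * F x" if "x \<in> space M" "m < u x" for x using that by force
      \<comment> \<open>If every point of the superlevel set exceeded the average, this function
        would be positive there, yet its integral is \<open>mu m * I - mu m * I = 0\<close>; the set
        would then be null.\<close>
      let ?d = "\<lambda>x. mu m * (if m < u x then F x else 0) - (if m < u x then I else 0)"
      have c: "integrable M (\<lambda>x. if m < u x then I else 0)" "(LINT x|M. (if m < u x then I else 0)) = mu m * I"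
        using integral_if_const[OF fin, of "\<lambda>x. m < u x" I] by (auto simp: mu_def)
      have "(LINT x|M. ?d x) = 0" using iF c by (simp add: I_def[symmetric])
      moreover have "integrable M ?d" using iF c by simp
      moreover have "AE x in M. 0 \<le> ?d x" using gt by (intro AE_I2) (auto intro: less_imp_le)
      ultimately have "AE x in M. ?d x = 0" using integral_nonneg_eq_0_iff_AE[of M ?d] by blast
      then have "AE x in M. \<not> m < u x"
        by (rule AE_mp) (intro AE_I2, use gt in force)
      then have "AE x in M. x \<notin> {x \<in> space M. m < u x}" by (rule eventually_mono) simp
      moreover have "{x \<in> space M. m < u x} \<in> sets M" by measurable
      ultimately have "{x \<in> space M. m < u x} \<in> null_sets M" using AE_iff_null_sets by blast
      then have "mu m = 0" unfolding mu_def by (simp add: null_sets_def measure_def)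
      then show False using False by simp
    qed
    then obtain x where x: "x \<in> space M" "m < u x" "mu m * F x \<le> I" by blast
    have "mu (u x) \<le> mu m"
      unfolding mu_def using x(2) fin by (intro finite_measure.finite_measure_mono) auto
    then have "mu (u x) * F x \<le> mu m * F x" by (intro mult_right_mono) (auto simp: F_def h)
    then show ?thesis using x by (intro exI[of _ "u x"] conjI exI[of _ "g x"]) (auto simp: F_def)
  qed
  then show ?thesis unfolding mu_def I_def F_def .
qed

lemma finite_measure_lebesgue_on:
  fixes Om :: "'a::euclidean_space set"
  assumes "open Om" "bounded Om"
  shows "finite_measure (lebesgue_on Om)"
proof
  have "emeasure (lebesgue_on Om) Om = emeasure lebesgue Om"
    using assms by (intro emeasure_restrict_space) auto
  also have "\<dots> \<noteq> \<infinity>" unfolding infinity_ennreal_def by (rule fmeasurableD2[OF lmeasurable_open[OF assms(2,1)]])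
  finally show "emeasure (lebesgue_on Om) (space (lebesgue_on Om)) \<noteq> \<infinity>" by simp
qed

text \<open>A weak gradient obtained from \<open>zigzag_exists\<close> comes only with local
  integrability, while membership in \<open>Lp_space\<close> asks for measurability on all of
  \<open>Om\<close>; a compact exhaustion bridges the gap.\<close>

lemma loc_integrable_borel_measurable:
  fixes k :: "'a::euclidean_space \<Rightarrow> 'b::euclidean_space"
  assumes k: "loc_integrable Om k" and Om: "open Om"
  shows "k \<in> borel_measurable (lebesgue_on Om)"
proof -
  obtain S where S: "\<And>n::nat. compact (S n)" "\<And>n. S n \<subseteq> Om" "\<And>K. compact K \<Longrightarrow> K \<subseteq> Om \<Longrightarrow> \<exists>N. \<forall>n\<ge>N. K \<subseteq> S n"
  proof (rule open_Union_compact_subsets[OF Om], goal_cases)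
    case (1 S) show ?case by (rule 1(1)[of S]) (fact 1(2), fact 1(3), fact 1(6))
  qed
  have "(\<lambda>x. indicator Om x *\<^sub>R k x) \<in> borel_measurable lebesgue"
  proof (rule borel_measurable_LIMSEQ_metric)
    show "(\<lambda>x. indicator (S n) x *\<^sub>R k x) \<in> borel_measurable lebesgue" for n
    proof -
      have "k \<in> borel_measurable (lebesgue_on (S n))" by (rule borel_measurable_loc_integrable[OF k S(1,2)])
      then show ?thesis using S(1)[of n] by (subst (asm) borel_measurable_restrict_space_iff) auto
    qed
    fix x :: 'a
    show "(\<lambda>n. indicator (S n) x *\<^sub>R k x) \<longlonglongrightarrow> indicator Om x *\<^sub>R k x"
    proof (cases "x \<in> Om")
      case True
      then obtain N where "\<forall>n\<ge>N. {x} \<subseteq> S n" using S(3)[of "{x}"] by auto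
      then have "\<forall>\<^sub>F n in sequentially. indicator (S n) x *\<^sub>R k x = indicator Om x *\<^sub>R k x"
        unfolding eventually_sequentially using True by (intro exI[of _ N]) auto
      then show ?thesis by (rule tendsto_eventually)
    next
      case False
      then have "indicator (S n) x *\<^sub>R k x = indicator Om x *\<^sub>R k x" for n
        using S(2)[of n] by (auto simp: indicator_def)
      then show ?thesis by (simp only: tendsto_const)
    qed
  qed
  then show ?thesis using Om by (subst borel_measurable_restrict_space_iff) auto
qed

text \<open>The barrier is the level \<open>s\<close> plus a zigzag with gradient \<open>a\<close>
  or \<open>- a\<close>. Its energy density is bounded almost everywhere by a constant
  \<open>A\<close>, the set where it is used lies in the superlevel set of \<open>s\<close>, and
  \<open>good_level_exists\<close> bounds the product of that measure with the density at
  \<open>(s, a)\<close>. The upper bound \<open>B\<close> is what later makes the truncated function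
  bounded.\<close>

lemma barrier_exists:
  fixes Om :: "'a::euclidean_space set" and H :: "real \<times> 'a \<Rightarrow> real"
  assumes Om: "open Om" "bounded Om" and p: "1 \<le> p" and H: "continuous_on UNIV H" and C: "1 \<le> C"
    and sym: "\<And>t a. \<bar>H (t, - a)\<bar> \<le> C * (\<bar>H (t, a)\<bar> + 1)"
    and um: "u \<in> borel_measurable (lebesgue_on Om)"
    and i: "integrable (lebesgue_on Om) (\<lambda>x. \<bar>H (u x, g x)\<bar> + norm (g x) powr p)"
  shows "\<exists>b k B. sobolev p Om b k \<and> (\<forall>x\<in>Om. m \<le> b x \<and> b x \<le> B) \<and>
     integrable (lebesgue_on Om) (\<lambda>x. if b x < u x then \<bar>H (b x, k x)\<bar> + norm (k x) powr p else 0) \<and>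
     (LINT x|lebesgue_on Om. (if b x < u x then \<bar>H (b x, k x)\<bar> + norm (k x) powr p else 0))
       \<le> C * (LINT x|lebesgue_on Om. (if m < u x then \<bar>H (u x, g x)\<bar> + norm (g x) powr p else 0))
         + (C + 1) * measure (lebesgue_on Om) {x \<in> Om. m < u x}"
proof -
  note [measurable] = um
  note fin = finite_measure_lebesgue_on[OF Om]
  have sp: "space (lebesgue_on Om) = Om" by simp
  define mu where "mu t = measure (lebesgue_on Om) {x \<in> Om. t < u x}" for t
  have ms: "{x \<in> Om. t < u x} \<in> sets (lebesgue_on Om)" for t
  proof -
    have "{x \<in> space (lebesgue_on Om). t < u x} \<in> sets (lebesgue_on Om)" by measurable
    then show ?thesis by (simp only: sp)
  qed
  define I where "I = (LINT x|lebesgue_on Om. (if m < u x then \<bar>H (u x, g x)\<bar> + norm (g x) powr p else 0))"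
  obtain s a where s: "m \<le> s" "mu s * (\<bar>H (s, a)\<bar> + norm a powr p) \<le> I"
    using good_level_exists[OF fin um, of "\<lambda>s a. \<bar>H (s, a)\<bar> + norm a powr p" g m] i
    unfolding mu_def I_def sp by auto
  have "continuous_on UNIV (\<lambda>t. H (t, y))" for y
    by (rule continuous_on_compose2[OF H]) (auto intro!: continuous_intros)
  then have cont: "\<exists>d>0. \<forall>t. dist t s < d \<longrightarrow> dist (H (t, y)) (H (s, y)) < 1" for y
    unfolding continuous_on_iff by (metis UNIV_I zero_less_one)
  obtain d1 where d1: "d1 > 0" "\<And>t. dist t s < d1 \<Longrightarrow> dist (H (t, a)) (H (s, a)) < 1" using cont by blast
  obtain d2 where d2: "d2 > 0" "\<And>t. dist t s < d2 \<Longrightarrow> dist (H (t, - a)) (H (s, - a)) < 1" using cont by blast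
  \<comment> \<open>The continuity windows \<open>d1\<close> for \<open>a\<close> and
    \<open>d2\<close> for \<open>- a\<close> are open, while the zigzag may attain \<open>e\<close>;
    hence a radius strictly below both.\<close>
  define e where "e = min d1 d2 / 2"
  have e: "0 < e" "e < d1" "e < d2" using d1(1) d2(1) by (auto simp: e_def)
  obtain z k where z: "continuous_on UNIV z" "has_weak_gradient Om z k" "\<And>x. x \<in> Om \<Longrightarrow> 0 \<le> z x \<and> z x \<le> e"
    "AE x in lebesgue_on Om. k x = a \<or> k x = - a"
    using zigzag_exists[OF Om e(1), of a] by blast
  define b where "b x = s + z x" for x
  have b: "s \<le> b x" "b x \<le> s + e" if "x \<in> Om" for x using z(3)[OF that] by (auto simp: b_def)
  have cb: "continuous_on UNIV b" unfolding b_def[abs_def] by (intro continuous_intros z)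
  have bm: "b \<in> borel_measurable (lebesgue_on Om)" by (rule borel_measurable_lebesgue_on_continuous[OF cb])
  have bk: "has_weak_gradient Om b k"
    using has_weak_gradient_add[OF has_weak_gradient_const[OF Om(1), of s] z(2) Om(1)] by (simp add: b_def[abs_def])
  have km: "k \<in> borel_measurable (lebesgue_on Om)"
    by (rule loc_integrable_borel_measurable[OF _ Om(1)]) (use bk in \<open>simp add: has_weak_gradient_def\<close>)
  have sob: "sobolev p Om b k"
    unfolding sobolev_def
  proof (intro conjI bk)
    show "b \<in> Lp_space p Om"
      by (rule Lp_space_bounded[OF bm Om, where B = "\<bar>s\<bar> + e"]) (use b p in \<open>auto intro!: AE_I2 simp: abs_le_iff sp intro: order_trans, force+\<close>)
    show "k \<in> Lp_space p Om"
      by (rule Lp_space_bounded[OF km Om, where B = "norm a"]) (use z(4) p in \<open>auto elim!: eventually_mono\<close>)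
  qed
  note [measurable] = bm km
  have [measurable]: "H \<in> borel_measurable borel" using H by (rule borel_measurable_continuous_onI)
  \<comment> \<open>In the summand \<open>C + 1\<close>, the \<open>C\<close> comes from the
    \<open>+ 1\<close> inside the symmetry assumption and the 1 from the variation of
    \<open>H\<close> between \<open>s\<close> and \<open>b x\<close>. The power of the gradient is
    unchanged by the sign, and multiplying it by \<open>C \<ge> 1\<close> only unifies the
    formula.\<close>
  define A where "A = C * (\<bar>H (s, a)\<bar> + norm a powr p) + (C + 1)"
  have ae: "AE x in lebesgue_on Om. \<bar>H (b x, k x)\<bar> + norm (k x) powr p \<le> A"
  proof -
    have "AE x in lebesgue_on Om. x \<in> Om" by (rule AE_I2) simp
    with z(4) show ?thesis
    proof eventually_elim
      case (elim x)
      have ds: "dist (b x) s < d1" "dist (b x) s < d2" using b[OF elim(2)] e by (auto simp: dist_real_def)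
      have n: "norm (k x) powr p \<le> C * norm a powr p"
      proof -
        have "1 * norm a powr p \<le> C * norm a powr p" using C by (intro mult_right_mono) auto
        then show ?thesis using elim(1) by auto
      qed
      have "\<bar>H (s, a)\<bar> + 1 \<le> C * (\<bar>H (s, a)\<bar> + 1)" using C mult_right_mono[of 1 C "\<bar>H (s, a)\<bar> + 1"] by simp
      then have "\<bar>H (b x, k x)\<bar> \<le> C * (\<bar>H (s, a)\<bar> + 1) + 1"
        using elim(1) d1(2)[OF ds(1)] d2(2)[OF ds(2)] sym[of s a] by (auto simp: dist_real_def)
      then show ?case using n by (simp add: A_def algebra_simps)
    qed
  qed
  have A0: "0 \<le> A" using C by (auto simp: A_def intro!: add_nonneg_nonneg mult_nonneg_nonneg)
  let ?f = "\<lambda>x. if b x < u x then \<bar>H (b x, k x)\<bar> + norm (k x) powr p else 0"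
  have cA: "integrable (lebesgue_on Om) (\<lambda>x. if s < u x then A else 0)" "(LINT x|lebesgue_on Om. (if s < u x then A else 0)) = mu s * A"
    using integral_if_const[OF fin, of "\<lambda>x. s < u x" A] ms by (auto simp: mu_def)
  \<comment> \<open>As \<open>b x \<ge> s\<close> on \<open>Om\<close>, the condition
    \<open>b x < u x\<close> implies \<open>s < u x\<close>.\<close>
  have fle: "AE x in lebesgue_on Om. ?f x \<le> (if s < u x then A else 0)"
  proof -
    have "AE x in lebesgue_on Om. x \<in> Om" by (rule AE_I2) simp
    with ae show ?thesis by eventually_elim (use b A0 in force)
  qed
  have fi: "integrable (lebesgue_on Om) ?f"
  proof (rule Bochner_Integration.integrable_bound[OF cA(1)])
    show "AE x in lebesgue_on Om. norm (?f x) \<le> norm (if s < u x then A else 0)"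
      using fle by (rule eventually_mono) (auto split: if_splits)
  qed measurable
  have mus: "mu s \<le> mu m"
    unfolding mu_def using s(1) ms fin by (intro finite_measure.finite_measure_mono) auto
  have "(LINT x|lebesgue_on Om. ?f x) \<le> mu s * A"
    using integral_mono_AE[OF fi cA(1) fle] cA(2) by simp
  also have "\<dots> = C * (mu s * (\<bar>H (s, a)\<bar> + norm a powr p)) + (C + 1) * mu s"
    by (simp add: A_def algebra_simps)
  also have "\<dots> \<le> C * I + (C + 1) * mu m"
    using s(2) mus C by (intro add_mono mult_left_mono) auto
  finally have "(LINT x|lebesgue_on Om. ?f x) \<le> C * I + (C + 1) * mu m" .
  moreover have "\<forall>x\<in>Om. m \<le> b x \<and> b x \<le> s + e" using b s(1) by force
  ultimately show ?thesis using sob fi unfolding I_def mu_def by blast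
qed

section \<open>Approximation by bounded functions\<close>

lemma tail_integral_tendsto_0:
  fixes F :: "'a \<Rightarrow> real"
  assumes F: "integrable M F" and [measurable]: "u \<in> borel_measurable M"
  shows "(\<lambda>n. LINT x|M. (if c + real n < u x then F x else 0)) \<longlonglongrightarrow> 0"
proof -
  note [measurable] = borel_measurable_integrable[OF F]
  have "(\<lambda>n. LINT x|M. (if c + real n < u x then F x else 0)) \<longlonglongrightarrow> (LINT x|M. 0)"
  proof (rule integral_dominated_convergence)
    show "integrable M (\<lambda>x. norm (F x))" using F by simp
    show "AE x in M. (\<lambda>n. if c + real n < u x then F x else 0) \<longlonglongrightarrow> 0"
    proof (rule AE_I2)
      fix x
      have "\<forall>\<^sub>F n in sequentially. (if c + real n < u x then F x else 0) = 0"
      proof (rule eventually_sequentiallyI[of "nat \<lceil>u x - c\<rceil>"])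
        fix n assume "nat \<lceil>u x - c\<rceil> \<le> n"
        then have "u x \<le> c + real n" by linarith
        then show "(if c + real n < u x then F x else 0) = 0" by simp
      qed
      then show "(\<lambda>n. if c + real n < u x then F x else 0) \<longlonglongrightarrow> 0" by (rule tendsto_eventually)
    qed
  qed auto
  then show ?thesis by simp
qed

lemma tail_measure_tendsto_0:
  assumes fin: "finite_measure M" and [measurable]: "u \<in> borel_measurable M"
  shows "(\<lambda>n. measure M {x \<in> space M. c + real n < u x}) \<longlonglongrightarrow> 0"
proof -
  have "integrable M (\<lambda>x. 1 :: real)" using fin by (simp add: finite_measure.integrable_const)
  from tail_integral_tendsto_0[OF this, of u c] show ?thesis
    using integral_if_const(1)[OF fin, of "\<lambda>x. c + real _ < u x" 1] by simp
qed

theorem corollary2p12: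
  fixes Om :: "(real ^ 'n) set"
    and p :: real
    and phi :: "real ^ 'n \<Rightarrow> real"
    and H :: "real \<times> (real ^ 'n) \<Rightarrow> real"
    and L :: "real ^ 'n \<Rightarrow> real \<Rightarrow> real ^ 'n \<Rightarrow> real"
    and C :: real
  assumes "open Om" and "bounded Om"
    and "1 \<le> p" and "p \<le> real CARD('n)"
    and "phi \<in> W1 p UNIV \<inter> Linfty_space UNIV"
    and "continuous_on UNIV H"
    and "\<And>x t \<xi>. x \<in> Om \<Longrightarrow> L x t \<xi> = H (t, \<xi>)"
    and "C \<ge> 1"
    and "\<And>t \<xi>. \<bar>H (t, - \<xi>)\<bar> \<le> C * (\<bar>H (t, \<xi>)\<bar> + 1)"
  shows "\<forall>u \<in> admissible p phi Om L. Linfty_regular_at p phi Om L u"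
proof
  fix u assume u: "u \<in> admissible p phi Om L"
  note Om = assms(1,2) and p = assms(3) and H = assms(6) and LH = assms(7) and C = assms(8) and sym = assms(9)
  have p0: "0 \<le> p" using p by simp
  have OmL: "Om \<in> sets lebesgue" using Om by simp
  have sp: "space (lebesgue_on Om) = Om" by simp
  note fin = finite_measure_lebesgue_on[OF Om]
  let ?g = "weak_gradient Om u"
  obtain w where w: "w \<in> W0 p Om" "u = (\<lambda>x. phi x + w x)"
    using u by (auto simp: admissible_def W1_bdry_def)
  obtain gw where sw: "sobolev p Om w gw"
    using w(1) W1_sobolev unfolding W0_def by blast
  obtain gphi where "sobolev p UNIV phi gphi" using assms(5) W1_sobolev by blast
  then have sphi: "sobolev p Om phi gphi"
    using Om Lp_space_subset[of phi p UNIV Om] Lp_space_subset[of gphi p UNIV Om] by (auto simp: sobolev_def intro: has_weak_gradient_subset)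
  obtain M0 where M0: "AE x in lebesgue_on Om. \<bar>phi x\<bar> \<le> M0"
    using assms(5) AE_lebesgue_on_subset[OF _ OmL subset_UNIV] by (auto simp: Linfty_space_def)
  \<comment> \<open>The decomposition of \<open>u\<close> yields a concrete weak gradient. It is
    then exchanged for \<open>weak_gradient Om u\<close>, the one in which \<open>admissible\<close>
    and \<open>Linfty_regular_at\<close> are stated.\<close>
  have su0: "sobolev p Om u (\<lambda>x. gphi x + gw x)"
    unfolding w(2) by (rule sobolev_add[OF sphi sw Om(1) p0])
  have "AE x in lebesgue_on Om. ?g x = gphi x + gw x"
    by (rule weak_gradient_AE_eq[OF _ Om(1)]) (use su0 in \<open>simp add: sobolev_def\<close>)
  then have "AE x in lebesgue_on Om. gphi x + gw x = ?g x" by (rule eventually_mono) simp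
  then have su: "sobolev p Om u ?g"
    by (rule sobolev_cong_AE[OF su0 Om(1) AE_I2[OF refl]])
  have [measurable]: "H \<in> borel_measurable borel" using H by (rule borel_measurable_continuous_onI)
  note [measurable] = sobolev_measurable[OF su]
  have iH: "integrable (lebesgue_on Om) (\<lambda>x. H (u x, ?g x))"
  proof -
    have "integrable (lebesgue_on Om) (\<lambda>x. L x (u x) (?g x))" using u by (simp add: admissible_def)
    then show ?thesis by (subst Bochner_Integration.integrable_cong[OF refl, of _ _ "\<lambda>x. L x (u x) (?g x)"]) (auto simp: LH)
  qed
  \<comment> \<open>\<open>F0\<close> is the density that enters the barrier estimate;
    \<open>F\<close> adds the power of \<open>u\<close>, needed for the distance of the functions
    themselves.\<close>
  define F0 where "F0 x = \<bar>H (u x, ?g x)\<bar> + norm (?g x) powr p" for x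
  define F where "F x = F0 x + norm (u x) powr p" for x
  have iF0: "integrable (lebesgue_on Om) F0"
    unfolding F0_def[abs_def] using iH su by (simp add: sobolev_def Lp_space_def)
  have iF: "integrable (lebesgue_on Om) F"
    unfolding F_def[abs_def] using iF0 su by (simp add: sobolev_def Lp_space_def)
  have F0nn: "0 \<le> F0 x" for x by (simp add: F0_def)
  have Fnn: "0 \<le> F x" for x by (simp add: F_def F0nn)
  \<comment> \<open>Starting at \<open>\<bar>M0\<bar>\<close> puts every barrier beyond the values
    of \<open>phi\<close>, so that the truncations below preserve the boundary values; adding
    \<open>n\<close> drives the superlevel sets to measure zero.\<close>
  define M where "M n = \<bar>M0\<bar> + real n" for n
  have M0': "\<bar>M0\<bar> \<le> M n" "0 \<le> M n" for n by (auto simp: M_def)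
  \<comment> \<open>The reflected integrand \<open>H (- t, - \<xi>)\<close> inherits continuity and
    the symmetry bound with the same \<open>C\<close>, so the lower barriers are upper barriers for
    \<open>- u\<close>.\<close>
  have sym': "\<bar>H (- t, \<xi>)\<bar> \<le> C * (\<bar>H (- t, - \<xi>)\<bar> + 1)" for t \<xi> using sym[of "- t" "- \<xi>"] by simp
  have H': "continuous_on UNIV (\<lambda>y. H (- fst y, - snd y))"
    by (rule continuous_on_compose2[OF H]) (auto intro!: continuous_intros)

  have ex1: "\<forall>n. \<exists>b k B. sobolev p Om b k \<and> (\<forall>x\<in>Om. M n \<le> b x \<and> b x \<le> B) \<and>
     integrable (lebesgue_on Om) (\<lambda>x. if b x < u x then \<bar>H (b x, k x)\<bar> + norm (k x) powr p else 0) \<and>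
     (LINT x|lebesgue_on Om. (if b x < u x then \<bar>H (b x, k x)\<bar> + norm (k x) powr p else 0))
       \<le> C * (LINT x|lebesgue_on Om. (if M n < u x then F0 x else 0))
         + (C + 1) * measure (lebesgue_on Om) {x \<in> Om. M n < u x}"
    unfolding F0_def
    by (intro allI barrier_exists[OF Om p H C sym]) (use iF0 in \<open>auto simp: F0_def[abs_def]\<close>)
  obtain b kb Bb where b: "\<forall>n. sobolev p Om (b n) (kb n) \<and> (\<forall>x\<in>Om. M n \<le> b n x \<and> b n x \<le> Bb n) \<and>
     integrable (lebesgue_on Om) (\<lambda>x. if b n x < u x then \<bar>H (b n x, kb n x)\<bar> + norm (kb n x) powr p else 0) \<and>
     (LINT x|lebesgue_on Om. (if b n x < u x then \<bar>H (b n x, kb n x)\<bar> + norm (kb n x) powr p else 0))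
       \<le> C * (LINT x|lebesgue_on Om. (if M n < u x then F0 x else 0))
         + (C + 1) * measure (lebesgue_on Om) {x \<in> Om. M n < u x}"
    using ex1[unfolded choice_iff] by blast
  have ex2: "\<forall>n. \<exists>b k B. sobolev p Om b k \<and> (\<forall>x\<in>Om. M n \<le> b x \<and> b x \<le> B) \<and>
     integrable (lebesgue_on Om) (\<lambda>x. if b x < - u x then \<bar>H (- b x, - k x)\<bar> + norm (k x) powr p else 0) \<and>
     (LINT x|lebesgue_on Om. (if b x < - u x then \<bar>H (- b x, - k x)\<bar> + norm (k x) powr p else 0))
       \<le> C * (LINT x|lebesgue_on Om. (if M n < - u x then F0 x else 0))
         + (C + 1) * measure (lebesgue_on Om) {x \<in> Om. M n < - u x}"
    unfolding F0_def
    by (intro allI barrier_exists[OF Om p H' C, of "\<lambda>x. - u x" "\<lambda>x. - ?g x", unfolded fst_conv snd_conv minus_minus norm_minus_cancel])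
      (use sym' iF0 in \<open>auto simp: F0_def[abs_def]\<close>)
  obtain a ka Ba where a: "\<forall>n. sobolev p Om (a n) (ka n) \<and> (\<forall>x\<in>Om. M n \<le> a n x \<and> a n x \<le> Ba n) \<and>
     integrable (lebesgue_on Om) (\<lambda>x. if a n x < - u x then \<bar>H (- a n x, - ka n x)\<bar> + norm (ka n x) powr p else 0) \<and>
     (LINT x|lebesgue_on Om. (if a n x < - u x then \<bar>H (- a n x, - ka n x)\<bar> + norm (ka n x) powr p else 0))
       \<le> C * (LINT x|lebesgue_on Om. (if M n < - u x then F0 x else 0))
         + (C + 1) * measure (lebesgue_on Om) {x \<in> Om. M n < - u x}"
    using ex2[unfolded choice_iff] by blast
  have sb: "sobolev p Om (b n) (kb n)" and sa: "sobolev p Om (\<lambda>x. - a n x) (\<lambda>x. - ka n x)" for n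
    using a b sobolev_minus[OF _ Om(1)] by blast+
  have bM: "M n \<le> b n x" "b n x \<le> Bb n" and aM: "M n \<le> a n x" "a n x \<le> Ba n" if "x \<in> Om" for n x
    using a b that by blast+
  have sa': "sobolev p Om (a n) (ka n)" for n using a by blast
  note [measurable] = sobolev_measurable[OF sb] sobolev_measurable[OF sa']

  \<comment> \<open>Since \<open>- a n x \<le> 0 \<le> b n x\<close> on \<open>Om\<close>, the two
    truncations do not interfere. \<open>G\<close> is the gradient prescribed by the formulas for
    minimum and maximum, including their choice on the contact sets.\<close>
  define U where "U n x = max (min (u x) (b n x)) (- a n x)" for n x
  define G where "G n x = (if - a n x \<le> min (u x) (b n x) then (if u x \<le> b n x then ?g x else kb n x) else - ka n x)" for n x
  have sU: "sobolev p Om (U n) (G n)" for n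
    unfolding U_def[abs_def] G_def[abs_def]
    by (rule sobolev_max[OF sobolev_min[OF su sb Om(1) p0] sa Om(1) p0])
  note [measurable] = sobolev_measurable[OF sU]
  have hU: "has_weak_gradient Om (U n) (G n)" for n using sU by (simp add: sobolev_def)
  have gU: "AE x in lebesgue_on Om. weak_gradient Om (U n) x = G n x" for n
    by (rule weak_gradient_AE_eq[OF hU Om(1)])

  \<comment> \<open>Subtracting \<open>phi\<close> turns \<open>U n\<close> into a truncation of
    \<open>w\<close> between \<open>- a n x - phi x \<le> 0\<close> and
    \<open>b n x - phi x \<ge> 0\<close>, to which \<open>W0_min\<close> and \<open>W0_max\<close>
    apply.\<close>
  have bdry: "U n \<in> W1_bdry p phi Om" for n
  proof -
    have 1: "(\<lambda>x. min (w x) (b n x - phi x)) \<in> W0 p Om"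
    proof (rule W0_min[OF w(1) sw sobolev_diff[OF sb sphi Om(1) p0] _ Om(1) p])
      have "AE x in lebesgue_on Om. x \<in> Om" by (rule AE_I2) simp
      with M0 show "AE x in lebesgue_on Om. 0 \<le> b n x - phi x"
        by eventually_elim (use bM M0' in \<open>smt (verit)\<close>)
    qed
    have 2: "(\<lambda>x. max (min (w x) (b n x - phi x)) (- a n x - phi x)) \<in> W0 p Om"
    proof (rule W0_max[OF 1 sobolev_min[OF sw sobolev_diff[OF sb sphi Om(1) p0] Om(1) p0] sobolev_diff[OF sa sphi Om(1) p0] _ Om(1) p])
      have "AE x in lebesgue_on Om. x \<in> Om" by (rule AE_I2) simp
      with M0 show "AE x in lebesgue_on Om. - a n x - phi x \<le> 0"
        by eventually_elim (use aM M0' in \<open>smt (verit)\<close>)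
    qed
    have "U n = (\<lambda>x. phi x + max (min (w x) (b n x - phi x)) (- a n x - phi x))"
      by (auto simp: U_def w(2) fun_eq_iff max_def min_def)
    then show ?thesis
      unfolding W1_bdry_def by (intro CollectI exI[of _ "\<lambda>x. max (min (w x) (b n x - phi x)) (- a n x - phi x)"] conjI 2)
  qed

  define NB where "NB n x = \<bar>H (b n x, kb n x)\<bar> + norm (kb n x) powr p" for n x
  define NA where "NA n x = \<bar>H (- a n x, - ka n x)\<bar> + norm (ka n x) powr p" for n x
  have Nnn: "0 \<le> NB n x" "0 \<le> NA n x" for n x by (auto simp: NB_def NA_def)
  \<comment> \<open>One integrable majorant for all three errors: on the sets where
    \<open>U n\<close> differs from \<open>u\<close> it contains the energy of the barrier and that
    of \<open>u\<close>. The terms with \<open>F\<close> live on the larger sets beyond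
    \<open>M n\<close>, whose shrinking does not depend on the barriers.\<close>
  define W where "W n x = ((if b n x < u x then NB n x else 0) + (if M n < u x then F x else 0))
     + ((if a n x < - u x then NA n x else 0) + (if M n < - u x then F x else 0))" for n x
  have iNB: "integrable (lebesgue_on Om) (\<lambda>x. if b n x < u x then NB n x else 0)" for n
    using b unfolding NB_def by blast
  have iNA: "integrable (lebesgue_on Om) (\<lambda>x. if a n x < - u x then NA n x else 0)" for n
    using a unfolding NA_def by blast
  have iFM: "integrable (lebesgue_on Om) (\<lambda>x. if M n < u x then F x else 0)"
    "integrable (lebesgue_on Om) (\<lambda>x. if M n < - u x then F x else 0)" for n
    by (rule integrable_indicator_restrict[OF iF], measurable)+
  have iF0M: "integrable (lebesgue_on Om) (\<lambda>x. if M n < u x then F0 x else 0)"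
    "integrable (lebesgue_on Om) (\<lambda>x. if M n < - u x then F0 x else 0)" for n
    by (rule integrable_indicator_restrict[OF iF0], measurable)+
  have iW: "integrable (lebesgue_on Om) (W n)" for n
    unfolding W_def[abs_def] by (intro Bochner_Integration.integrable_add iNB iNA iFM)
  have lW: "(\<lambda>n. LINT x|lebesgue_on Om. W n x) \<longlonglongrightarrow> 0"
  proof (rule Lim_null_comparison[OF always_eventually], rule allI)
    define T where "T n = ((C * (LINT x|lebesgue_on Om. (if M n < u x then F0 x else 0)) + (C + 1) * measure (lebesgue_on Om) {x \<in> Om. M n < u x})
        + (LINT x|lebesgue_on Om. (if M n < u x then F x else 0)))
      + ((C * (LINT x|lebesgue_on Om. (if M n < - u x then F0 x else 0)) + (C + 1) * measure (lebesgue_on Om) {x \<in> Om. M n < - u x})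
        + (LINT x|lebesgue_on Om. (if M n < - u x then F x else 0)))" for n
    have mu: "(\<lambda>n. measure (lebesgue_on Om) {x \<in> Om. M n < u x}) \<longlonglongrightarrow> 0" "(\<lambda>n. measure (lebesgue_on Om) {x \<in> Om. M n < - u x}) \<longlonglongrightarrow> 0"
      using tail_measure_tendsto_0[OF fin, of u "\<bar>M0\<bar>"] tail_measure_tendsto_0[OF fin, of "\<lambda>x. - u x" "\<bar>M0\<bar>"]
      by (simp_all add: M_def)
    have t: "(\<lambda>n. LINT x|lebesgue_on Om. (if M n < u x then f x else 0)) \<longlonglongrightarrow> 0" "(\<lambda>n. LINT x|lebesgue_on Om. (if M n < - u x then f x else 0)) \<longlonglongrightarrow> 0"
      if "integrable (lebesgue_on Om) f" for f :: "real ^ 'n \<Rightarrow> real"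
      using tail_integral_tendsto_0[OF that, of u "\<bar>M0\<bar>"] tail_integral_tendsto_0[OF that, of "\<lambda>x. - u x" "\<bar>M0\<bar>"]
      by (simp_all add: M_def)
    have "T \<longlonglongrightarrow> ((C * 0 + (C + 1) * 0) + 0) + ((C * 0 + (C + 1) * 0) + 0)"
      unfolding T_def[abs_def] by (intro tendsto_add tendsto_mult tendsto_const mu t iF iF0)
    then show "T \<longlonglongrightarrow> 0" by simp
    fix n
    have "0 \<le> (LINT x|lebesgue_on Om. W n x)"
      by (intro integral_nonneg_AE AE_I2) (auto simp: W_def Nnn Fnn)
    moreover have "(LINT x|lebesgue_on Om. W n x) =
      ((LINT x|lebesgue_on Om. (if b n x < u x then NB n x else 0)) + (LINT x|lebesgue_on Om. (if M n < u x then F x else 0)))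
      + ((LINT x|lebesgue_on Om. (if a n x < - u x then NA n x else 0)) + (LINT x|lebesgue_on Om. (if M n < - u x then F x else 0)))"
      unfolding W_def using iNB[of n] iNA[of n] iFM[of n] by simp
    moreover have "(LINT x|lebesgue_on Om. (if b n x < u x then NB n x else 0)) \<le> C * (LINT x|lebesgue_on Om. (if M n < u x then F0 x else 0)) + (C + 1) * measure (lebesgue_on Om) {x \<in> Om. M n < u x}"
      using b unfolding NB_def by blast
    moreover have "(LINT x|lebesgue_on Om. (if a n x < - u x then NA n x else 0)) \<le> C * (LINT x|lebesgue_on Om. (if M n < - u x then F0 x else 0)) + (C + 1) * measure (lebesgue_on Om) {x \<in> Om. M n < - u x}"
      using a unfolding NA_def by blast
    ultimately show "norm (LINT x|lebesgue_on Om. W n x) \<le> T n"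
      unfolding T_def by simp
  qed

  \<comment> \<open>At a contact point \<open>u x = b n x\<close> or \<open>u x = - a n x\<close>
    the first alternative holds, because \<open>G\<close> selects the gradient of \<open>u\<close>
    there. The signs of \<open>b n x\<close> and \<open>a n x\<close> are recorded for the bound on
    \<open>U n x - u x\<close>.\<close>
  have cases: "U n x = u x \<and> G n x = ?g x \<or>
      (b n x < u x \<and> M n < u x \<and> 0 \<le> b n x \<and> U n x = b n x \<and> G n x = kb n x) \<or>
      (a n x < - u x \<and> M n < - u x \<and> 0 \<le> a n x \<and> U n x = - a n x \<and> G n x = - ka n x)" if x: "x \<in> Om" for n x
  proof -
    have ab: "0 \<le> M n" "M n \<le> b n x" "M n \<le> a n x" using bM[OF x] aM[OF x] M0' by auto
    consider "b n x < u x" | "u x < - a n x" | "- a n x \<le> u x" "u x \<le> b n x" by linarith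
    then show ?thesis by cases (use ab in \<open>auto simp: U_def G_def min_def max_def\<close>)
  qed
  have Wnn: "0 \<le> W n x" for n x by (auto simp: W_def Nnn Fnn)
  have Wb: "NB n x + F x \<le> W n x" if "b n x < u x" "M n < u x" for n x
    using that by (simp add: W_def Nnn Fnn)
  have Wa: "NA n x + F x \<le> W n x" if "a n x < - u x" "M n < - u x" for n x
    using that by (simp add: W_def Nnn Fnn)
  have dH: "\<bar>H (U n x, G n x) - H (u x, ?g x)\<bar> \<le> W n x" if x: "x \<in> Om" for n x
    using cases[OF x, of n]
  proof (elim disjE conjE)
    assume "b n x < u x" "M n < u x" "U n x = b n x" "G n x = kb n x"
    then show ?thesis using Wb[of n x] by (simp add: NB_def F_def F0_def)
      (smt (verit) powr_ge_zero)
  next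
    assume "a n x < - u x" "M n < - u x" "U n x = - a n x" "G n x = - ka n x"
    then show ?thesis using Wa[of n x] by (simp add: NA_def F_def F0_def)
      (smt (verit) powr_ge_zero)
  qed (simp add: Wnn)
  have dU: "norm (U n x - u x) powr p \<le> W n x" if x: "x \<in> Om" for n x
  proof -
    \<comment> \<open>A barrier value lies between 0 and \<open>u x\<close>, so the truncation moves
      \<open>u x\<close> by at most \<open>\<bar>u x\<bar>\<close>; the power of \<open>u\<close> in
      \<open>F\<close> pays for it without any estimate on the barrier.\<close>
    have le: "norm (U n x - u x) powr p \<le> norm (u x) powr p" if "\<bar>U n x - u x\<bar> \<le> \<bar>u x\<bar>"
      using that p0 by (intro powr_mono2) auto
    have FU: "norm (u x) powr p \<le> F x" by (simp add: F_def F0nn)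
    show ?thesis
      using cases[OF x, of n]
    proof (elim disjE conjE)
      assume "b n x < u x" "M n < u x" "0 \<le> b n x" "U n x = b n x"
      then show ?thesis using Wb[of n x] le FU Nnn(1)[of n x] by simp
    next
      assume "a n x < - u x" "M n < - u x" "0 \<le> a n x" "U n x = - a n x"
      then show ?thesis using Wa[of n x] le FU Nnn(2)[of n x] by simp
    qed (simp add: Wnn)
  qed
  \<comment> \<open>The two gradients on a truncated set are unrelated, so their powers are added
    separately, at the price of the factor \<open>2 powr p\<close>.\<close>
  have dG: "norm (G n x - ?g x) powr p \<le> 2 powr p * W n x" if x: "x \<in> Om" for n x
  proof -
    have gF: "norm (?g x) powr p \<le> F x" by (simp add: F_def F0_def)
    show ?thesis
      using cases[OF x, of n]
    proof (elim disjE conjE)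
      assume *: "b n x < u x" "M n < u x" "G n x = kb n x"
      have "norm (kb n x) powr p + norm (?g x) powr p \<le> W n x"
        using Wb[OF *(1,2)] gF by (simp add: NB_def)
      then show ?thesis
        unfolding *(3) by (intro order_trans[OF norm_diff_powr_le[OF p0]] mult_left_mono) auto
    next
      assume *: "a n x < - u x" "M n < - u x" "G n x = - ka n x"
      have "norm (- ka n x) powr p + norm (?g x) powr p \<le> W n x"
        using Wa[OF *(1,2)] gF by (simp add: NA_def)
      then show ?thesis
        unfolding *(3) by (intro order_trans[OF norm_diff_powr_le[OF p0]] mult_left_mono) auto
    qed (simp add: Wnn)
  qed
  have idH: "integrable (lebesgue_on Om) (\<lambda>x. \<bar>H (U n x, G n x) - H (u x, ?g x)\<bar>)" for n
    by (rule Bochner_Integration.integrable_bound[OF iW[of n]]) (use dH Wnn in \<open>auto intro!: AE_I2\<close>)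
  \<comment> \<open>Integrability of the new energy comes through its difference from the integrable
    energy of \<open>u\<close>, which \<open>W n\<close> dominates.\<close>
  have iHU: "integrable (lebesgue_on Om) (\<lambda>x. H (U n x, G n x))" for n
  proof -
    have "integrable (lebesgue_on Om) (\<lambda>x. H (U n x, G n x) - H (u x, ?g x))"
      using idH[of n] by (subst integrable_norm_iff[symmetric]) auto
    from Bochner_Integration.integrable_add[OF this iH] show ?thesis by simp
  qed
  have idU: "integrable (lebesgue_on Om) (\<lambda>x. norm (U n x - u x) powr p)"
    and idG: "integrable (lebesgue_on Om) (\<lambda>x. norm (G n x - ?g x) powr p)" for n
    using sobolev_diff[OF sU su Om(1) p0] by (auto simp: sobolev_def Lp_space_def)
  \<comment> \<open>Returns from \<open>H\<close> and the explicit gradient to \<open>L\<close> and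
    the selected gradient; \<open>L\<close> agrees with \<open>H\<close> only at points of
    \<open>Om\<close>.\<close>
  have AEeq: "AE x in lebesgue_on Om. H (U n x, G n x) = L x (U n x) (weak_gradient Om (U n) x)" for n
  proof -
    have "AE x in lebesgue_on Om. x \<in> Om" by (rule AE_I2) simp
    with gU[of n] show ?thesis by eventually_elim (simp add: LH)
  qed

  have adm: "U n \<in> admissible p phi Om L" for n
    unfolding admissible_def
    using bdry integrable_lebesgue_on_cong_AE[OF OmL iHU AEeq] by simp
  have Linf: "U n \<in> Linfty_space Om" for n
  proof -
    have "\<bar>U n x\<bar> \<le> max (Bb n) (Ba n)" if x: "x \<in> Om" for x
      using bM[OF x, of n] aM[OF x, of n] M0'(2)[of n] by (auto simp: U_def min_def max_def)
    then have "AE x in lebesgue_on Om. \<bar>U n x\<bar> \<le> max (Bb n) (Ba n)" by (intro AE_I2) simp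
    then show ?thesis unfolding Linfty_space_def by auto
  qed
  \<comment> \<open>Common conclusion for the values, the gradients and the energies, which differ
    only in the factor \<open>c\<close> in front of the majorant.\<close>
  have null: "(\<lambda>n. LINT x|lebesgue_on Om. f n x) \<longlonglongrightarrow> 0"
    if f: "\<And>n. integrable (lebesgue_on Om) (f n)" "\<And>n x. x \<in> Om \<Longrightarrow> f n x \<le> c * W n x" "\<And>n x. 0 \<le> f n x" for f :: "nat \<Rightarrow> real ^ 'n \<Rightarrow> real" and c
  proof (rule Lim_null_comparison[OF always_eventually], rule allI)
    show "(\<lambda>n. c * (LINT x|lebesgue_on Om. W n x)) \<longlonglongrightarrow> 0" by (rule tendsto_mult_right_zero[OF lW])
    fix n
    have "(LINT x|lebesgue_on Om. f n x) \<le> (LINT x|lebesgue_on Om. c * W n x)"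
      using f iW by (intro integral_mono) auto
    then show "norm (LINT x|lebesgue_on Om. f n x) \<le> c * (LINT x|lebesgue_on Om. W n x)"
      using f(3) by (simp add: integral_nonneg_AE)
  qed
  have nU: "(\<lambda>n. LINT x|lebesgue_on Om. norm (U n x - u x) powr p) \<longlonglongrightarrow> 0"
    by (rule null[where c = 1, OF idU]) (use dU in auto)
  have nG: "(\<lambda>n. LINT x|lebesgue_on Om. norm (G n x - ?g x) powr p) \<longlonglongrightarrow> 0"
    by (rule null[where c = "2 powr p", OF idG]) (use dG in auto)
  have nH: "(\<lambda>n. LINT x|lebesgue_on Om. \<bar>H (U n x, G n x) - H (u x, ?g x)\<bar>) \<longlonglongrightarrow> 0"
    by (rule null[where c = 1, OF idH]) (use dH in auto)
  have root: "(\<lambda>n. y n powr (1 / p)) \<longlonglongrightarrow> 0" if "y \<longlonglongrightarrow> 0" "\<And>n. 0 \<le> y n" for y :: "nat \<Rightarrow> real"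
    by (rule tendsto_zero_powrI[OF that(1) tendsto_const]) (use that(2) p in auto)
  have "(\<lambda>n. W1_norm p Om (\<lambda>x. U n x - u x)) \<longlonglongrightarrow> 0 + 0"
    unfolding W1_norm_eq[OF sobolev_diff[OF sU su Om(1) p0] Om(1)]
    by (intro tendsto_add root nU nG integral_nonneg_AE) auto
  then have "(\<lambda>n. W1_norm p Om (\<lambda>x. U n x - u x)) \<longlonglongrightarrow> 0" by simp
  moreover have "(LINT x|lebesgue_on Om. \<bar>H (U n x, G n x) - H (u x, ?g x)\<bar>)
     = (LINT x|lebesgue_on Om. \<bar>L x (U n x) (weak_gradient Om (U n) x) - L x (u x) (weak_gradient Om u x)\<bar>)" for n
  proof (rule integral_lebesgue_on_cong_AE[OF OmL])
    have "AE x in lebesgue_on Om. x \<in> Om" by (rule AE_I2) simp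
    with AEeq[of n] show "AE x in lebesgue_on Om. \<bar>H (U n x, G n x) - H (u x, ?g x)\<bar> = \<bar>L x (U n x) (weak_gradient Om (U n) x) - L x (u x) (weak_gradient Om u x)\<bar>"
      by eventually_elim (simp add: LH)
  qed
  ultimately show "Linfty_regular_at p phi Om L u"
    using adm Linf nH unfolding Linfty_regular_at_def by (intro exI[of _ U]) simp
qed

end
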